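(* Let $X$ be a regular CW complex of finite dimension, i.e. $X=X^{(n)}$ for some $n\ge0$. Then $X$ is reflexive: every pre-plot of $X$ is a plot.
   Context: A parametrization of a diffeological space $Y$ is any map $P:U\to Y$ with $U$ open in some $\mathbb{R}^k$; it is a pre-plot if $f\circ P$ is smooth for every smooth $f:Y\to\mathbb{R}$. $Y$ is reflexive if every pre-plot is a plot. An induction is an injective smooth map that is a diffeomorphism onto its image with subset diffeology; $D$-topology: $O\subset Y$ open iff $P^{-1}(O)$ open for all plots $P$. Let $\ell(t)=0$ for $t\le0$, $e^{-1/t}$ for $t>0$; $\alpha_0=\int_0^1\ell(3x)\ell(3-3x)dx$; $\lambda(t)=\frac1{\alpha_0}\int_0^t\ell(3x)\ell(3-3x)dx$; $\phi(t)=\int_0^{1/2+t}\lambda(x)dx$. For integers $n,m\ge0$: $\mathbb{D}^{n,m}=\{(u,v)\in\mathbb{R}^n\times\mathbb{R}^m:\|u\|\ge1-\phi(2-\|u\|-\|v\|)\}$, $\mathbb{S}^{n-1,m}=\{(u,v):\|u\|\ge1\}$ (empty for $n=0$), with subset diffeologies. A fat CW complex is a diffeological space $X$ with subspaces $\emptyset=X^{(-1)}\subset X^{(0)}\subset\cdots$, index sets $J_n$, maps $m_n:J_n\to\mathbb{N}_0$ and smooth maps $h_n:\coprod_{j\in J_n}\mathbb{S}^{n-1,m_n(j)}\to X^{(n-1)}$ such that each $X^{(n)}$ is the pushout in diffeological spaces of the inclusion $\coprod_j\mathbb{S}^{n-1,m_n(j)}\hookrightarrow\coprod_j\mathbb{D}^{n,m_n(j)}$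 and $h_n$, and $X$ is the diffeological colimit of the $X^{(n)}$. It is regular (a regular CW complex) if every $h_n$ is an induction whose image is $D$-open in $X^{(n-1)}$. *)

theory Defs
  imports "HOL-Analysis.Analysis"
begin

type_synonym rvec = "nat \<Rightarrow> real"

definition Rk :: "nat \<Rightarrow> rvec set" where
  "Rk k = {x. \<forall>i\<ge>k. x i = 0}"

definition openR :: "nat \<Rightarrow> rvec set \<Rightarrow> bool" where
  "openR k U \<longleftrightarrow> U \<subseteq> Rk k \<and>
     (\<forall>x\<in>U. \<exists>e>0. \<forall>y\<in>Rk k. (\<Sum>i<k. (y i - x i)^2) < e^2 \<longrightarrow> y \<in> U)"

definition pdir :: "nat \<Rightarrow> (rvec \<Rightarrow> real) \<Rightarrow> rvec \<Rightarrow> real" where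
  "pdir i g x = deriv (\<lambda>t. g (x(i := x i + t))) 0"

fun dpart :: "nat list \<Rightarrow> (rvec \<Rightarrow> real) \<Rightarrow> rvec \<Rightarrow> real" where
  "dpart [] g = g"
| "dpart (i # is) g = pdir i (dpart is g)"

definition smooth_real :: "nat \<Rightarrow> rvec set \<Rightarrow> (rvec \<Rightarrow> real) \<Rightarrow> bool" where
  "smooth_real k U g \<longleftrightarrow>
     (\<forall>is. set is \<subseteq> {..<k} \<longrightarrow>
        continuous_on U (dpart is g) \<and>
        (\<forall>i<k. \<forall>x\<in>U. (\<lambda>t. dpart is g (x(i := x i + t))) differentiable (at 0)))"

definition smooth_map :: "nat \<Rightarrow> rvec set \<Rightarrow> nat \<Rightarrow> (rvec \<Rightarrow> rvec) \<Rightarrow> bool" where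
  "smooth_map k U l F \<longleftrightarrow> (\<forall>x\<in>U. F x \<in> Rk l) \<and> (\<forall>j<l. smooth_real k U (\<lambda>x. F x j))"

text \<open>A diffeology on a carrier set Y is given by its plot predicate D k U P
  (P a plot with domain U, open in R^k).\<close>

type_synonym 'a diffeology = "nat \<Rightarrow> rvec set \<Rightarrow> (rvec \<Rightarrow> 'a) \<Rightarrow> bool"

definition smooth_fun :: "'a set \<Rightarrow> 'a diffeology \<Rightarrow> ('a \<Rightarrow> real) \<Rightarrow> bool" where
  "smooth_fun Y D f \<longleftrightarrow> (\<forall>k U P. D k U P \<longrightarrow> smooth_real k U (f \<circ> P))"

definition pre_plot :: "'a set \<Rightarrow> 'a diffeology \<Rightarrow> nat \<Rightarrow> rvec set \<Rightarrow> (rvec \<Rightarrow> 'a) \<Rightarrow> bool" where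
  "pre_plot Y D k U P \<longleftrightarrow> openR k U \<and> P ` U \<subseteq> Y \<and>
     (\<forall>f. smooth_fun Y D f \<longrightarrow> smooth_real k U (f \<circ> P))"

definition reflexive_diff :: "'a set \<Rightarrow> 'a diffeology \<Rightarrow> bool" where
  "reflexive_diff Y D \<longleftrightarrow> (\<forall>k U P. pre_plot Y D k U P \<longrightarrow> D k U P)"

definition smooth_between :: "'a set \<Rightarrow> 'a diffeology \<Rightarrow> 'b set \<Rightarrow> 'b diffeology \<Rightarrow> ('a \<Rightarrow> 'b) \<Rightarrow> bool" where
  "smooth_between A DA B DB f \<longleftrightarrow> f ` A \<subseteq> B \<and> (\<forall>k U P. DA k U P \<longrightarrow> DB k U (f \<circ> P))"

text \<open>Induction: injective smooth map which is a diffeomorphism onto its image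
  with the subset diffeology (i.e. the inverse is smooth on plots of B landing in the image).\<close>
definition induction :: "'a set \<Rightarrow> 'a diffeology \<Rightarrow> 'b set \<Rightarrow> 'b diffeology \<Rightarrow> ('a \<Rightarrow> 'b) \<Rightarrow> bool" where
  "induction A DA B DB f \<longleftrightarrow> inj_on f A \<and> smooth_between A DA B DB f \<and>
     (\<forall>k U P. DB k U P \<longrightarrow> P ` U \<subseteq> f ` A \<longrightarrow> DA k U (inv_into A f \<circ> P))"

definition D_open :: "'a set \<Rightarrow> 'a diffeology \<Rightarrow> 'a set \<Rightarrow> bool" where
  "D_open Y D W \<longleftrightarrow> W \<subseteq> Y \<and> (\<forall>k U P. D k U P \<longrightarrow> openR k {x\<in>U. P x \<in> W})"

text \<open>Coproduct over j in J of subsets A j of R^(d j), each with the subset diffeology.\<close>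
definition sumD :: "'j set \<Rightarrow> ('j \<Rightarrow> nat) \<Rightarrow> ('j \<Rightarrow> rvec set) \<Rightarrow> ('j \<times> rvec) diffeology" where
  "sumD J d A k U P \<longleftrightarrow> openR k U \<and>
     (\<forall>x\<in>U. \<exists>V. openR k V \<and> x \<in> V \<and> V \<subseteq> U \<and>
        (\<exists>j\<in>J. \<exists>R. smooth_map k V (d j) R \<and> R ` V \<subseteq> A j \<and> (\<forall>y\<in>V. P y = (j, R y))))"

definition ell :: "real \<Rightarrow> real" where
  "ell t = (if t \<le> 0 then 0 else exp (- 1 / t))"

definition alpha0 :: real where
  "alpha0 = integral {0..1} (\<lambda>x. ell (3 * x) * ell (3 - 3 * x))"

text \<open>For t < 0 the integrand vanishes on [t,0], so integral over {0..t} (= 0) is correct.\<close>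
definition lam :: "real \<Rightarrow> real" where
  "lam t = integral {0..t} (\<lambda>x. ell (3 * x) * ell (3 - 3 * x)) / alpha0"

definition phi :: "real \<Rightarrow> real" where
  "phi t = integral {0..1/2 + t} lam"

text \<open>A point (u,v) of R^n x R^m is encoded as w in R^(n+m): u = w 0..w (n-1), v = w n..w (n+m-1).\<close>
definition normu :: "nat \<Rightarrow> rvec \<Rightarrow> real" where
  "normu n w = sqrt (\<Sum>i<n. (w i)^2)"

definition normv :: "nat \<Rightarrow> nat \<Rightarrow> rvec \<Rightarrow> real" where
  "normv n m w = sqrt (\<Sum>i<m. (w (n + i))^2)"

definition Dnm :: "nat \<Rightarrow> nat \<Rightarrow> rvec set" where
  "Dnm n m = {w \<in> Rk (n + m). normu n w \<ge> 1 - phi (2 - normu n w - normv n m w)}"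

text \<open>S^{n-1,m}; empty for n = 0.\<close>
definition Snm :: "nat \<Rightarrow> nat \<Rightarrow> rvec set" where
  "Snm n m = {w \<in> Rk (n + m). normu n w \<ge> 1}"

definition cellsD :: "nat \<Rightarrow> 'j set \<Rightarrow> ('j \<Rightarrow> nat) \<Rightarrow> ('j \<times> rvec) set" where
  "cellsD n J m = Sigma J (\<lambda>j. Dnm n (m j))"

definition cellsS :: "nat \<Rightarrow> 'j set \<Rightarrow> ('j \<Rightarrow> nat) \<Rightarrow> ('j \<times> rvec) set" where
  "cellsS n J m = Sigma J (\<lambda>j. Snm n (m j))"

text \<open>B (with diffeology DB) is the pushout in diffeological spaces of the inclusion
  of the coproduct of the S^{n-1,m j} into the coproduct of the D^{n,m j} and of h,
  realised with A a subset of B and characteristic map Phi: the square commutes, the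
  underlying set is the set-theoretic pushout, and DB is the final (pushout) diffeology
  with respect to the inclusion of A and Phi.\<close>
definition cell_pushout :: "nat \<Rightarrow> 'j set \<Rightarrow> ('j \<Rightarrow> nat) \<Rightarrow> 'a set \<Rightarrow> 'a diffeology \<Rightarrow>
    ('j \<times> rvec \<Rightarrow> 'a) \<Rightarrow> 'a set \<Rightarrow> 'a diffeology \<Rightarrow> ('j \<times> rvec \<Rightarrow> 'a) \<Rightarrow> bool" where
  "cell_pushout n J m A DA h B DB Phi \<longleftrightarrow>
     B = A \<union> Phi ` cellsD n J m \<and>
     (\<forall>c\<in>cellsS n J m. Phi c = h c) \<and>
     inj_on Phi (cellsD n J m - cellsS n J m) \<and>
     Phi ` (cellsD n J m - cellsS n J m) \<inter> A = {} \<and>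
     (\<forall>k U P. DB k U P \<longleftrightarrow> openR k U \<and> P ` U \<subseteq> B \<and>
        (\<forall>x\<in>U. \<exists>V. openR k V \<and> x \<in> V \<and> V \<subseteq> U \<and>
           ((\<exists>Q. DA k V Q \<and> (\<forall>y\<in>V. P y = Q y)) \<or>
            (\<exists>Q. sumD J (\<lambda>j. n + m j) (\<lambda>j. Dnm n (m j)) k V Q \<and> (\<forall>y\<in>V. P y = Phi (Q y))))))"

definition skel :: "(nat \<Rightarrow> 'a set) \<Rightarrow> nat \<Rightarrow> 'a set" where
  "skel Xs n = (if n = 0 then {} else Xs (n - 1))"

definition skelD :: "(nat \<Rightarrow> 'a diffeology) \<Rightarrow> nat \<Rightarrow> 'a diffeology" where
  "skelD Ds n = (if n = 0 then (\<lambda>k U P. openR k U \<and> U = {}) else Ds (n - 1))"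

text \<open>Xs n / Ds n: the n-skeleton X^(n) and its diffeology; J n, m n, h n as in the paper;
  Phi n the characteristic map of the n-cells.\<close>
definition fat_CW :: "'a set \<Rightarrow> 'a diffeology \<Rightarrow> (nat \<Rightarrow> 'a set) \<Rightarrow> (nat \<Rightarrow> 'a diffeology) \<Rightarrow>
    (nat \<Rightarrow> 'j set) \<Rightarrow> (nat \<Rightarrow> 'j \<Rightarrow> nat) \<Rightarrow> (nat \<Rightarrow> 'j \<times> rvec \<Rightarrow> 'a) \<Rightarrow>
    (nat \<Rightarrow> 'j \<times> rvec \<Rightarrow> 'a) \<Rightarrow> bool" where
  "fat_CW X DX Xs Ds J m h Phi \<longleftrightarrow>
     (\<forall>n. smooth_between (cellsS n (J n) (m n)) (sumD (J n) (\<lambda>j. n + m n j) (\<lambda>j. Snm n (m n j)))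
            (skel Xs n) (skelD Ds n) (h n)) \<and>
     (\<forall>n. cell_pushout n (J n) (m n) (skel Xs n) (skelD Ds n) (h n) (Xs n) (Ds n) (Phi n)) \<and>
     X = (\<Union>n. Xs n) \<and>
     (\<forall>k U P. DX k U P \<longleftrightarrow> openR k U \<and> P ` U \<subseteq> X \<and>
        (\<forall>x\<in>U. \<exists>V. openR k V \<and> x \<in> V \<and> V \<subseteq> U \<and>
           (\<exists>n Q. Ds n k V Q \<and> (\<forall>y\<in>V. P y = Q y))))"

definition regular_CW :: "'a set \<Rightarrow> 'a diffeology \<Rightarrow> (nat \<Rightarrow> 'a set) \<Rightarrow> (nat \<Rightarrow> 'a diffeology) \<Rightarrow>
    (nat \<Rightarrow> 'j set) \<Rightarrow> (nat \<Rightarrow> 'j \<Rightarrow> nat) \<Rightarrow> (nat \<Rightarrow> 'j \<times> rvec \<Rightarrow> 'a) \<Rightarrow>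
    (nat \<Rightarrow> 'j \<times> rvec \<Rightarrow> 'a) \<Rightarrow> bool" where
  "regular_CW X DX Xs Ds J m h Phi \<longleftrightarrow> fat_CW X DX Xs Ds J m h Phi \<and>
     (\<forall>n. induction (cellsS n (J n) (m n)) (sumD (J n) (\<lambda>j. n + m n j) (\<lambda>j. Snm n (m n j)))
            (skel Xs n) (skelD Ds n) (h n) \<and>
          D_open (skel Xs n) (skelD Ds n) (h n ` cellsS n (J n) (m n)))"

end

theory Submission
  imports Defs
begin

text \<open>
  The proof goes by induction on the skeleta, carrying along that smooth functions separate points.
  Let \<open>P\<close> be a pre-plot of \<open>B\<close>, obtained from \<open>A\<close> by attaching cells \<open>Dnm n m\<close> along shells \<open>Snm n m\<close>.
  If \<open>P x\<close> lies in a closed cell, then bump functions and their products with the coordinates,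
  extended by zero (the shells are \<open>D\<close>-open in \<open>A\<close>), are smooth on \<open>B\<close> and exhibit \<open>P\<close> near \<open>x\<close> as a plot of
  the cell. Otherwise \<open>P\<close> stays in \<open>A\<close> near \<open>x\<close>: functions on the open cells can be rescaled cell by cell, so
  only finitely many open cells are met near \<open>x\<close>, and as open cells are bounded, points in a single one
  accumulate at a point of its closure, which a smooth function separates from \<open>P x\<close>. There \<open>P\<close> is a pre-plot of
  \<open>A\<close> because every smooth function on \<open>A\<close> extends to \<open>B\<close>.

  That extension is the analytic core: a function on the shell \<open>\<parallel>u\<parallel> \<ge> 1\<close> that is smooth along all plots has all
  its derivatives up to the boundary (Whitney's theorem on even functions) and hence extends smoothly
  across it (Seeley's theorem).
\<close>

section \<open>Smooth functions on open subsets of \<open>Rk k\<close>\<close>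

text \<open>Separation by smooth functions stands in for the Hausdorff property: the limit arguments
  end with two candidate limits that a smooth function tells apart. Regularity enters through three
  consequences: \<open>Phi\<close> is injective on closed cells, so the cell coordinates of a point
  make sense; plots of \<open>A\<close> inside the image of the shells lift to them; and that image
  is open along plots, so a bump centred at a shell point continues by zero over \<open>A\<close>.

  The obstacle to extension is that a normal derivative at the boundary cannot be read off a plot
  directly: the normal coordinate s \<ge> 0 of a plot has a minimum wherever it is 0, so its first
  derivatives vanish there. The plot s + t^2 escapes this, its second derivative giving twice the
  missing value. Seeley's sum over s \<mapsto> -4^j s is explicit, treats the base point as a mere
  parameter and reproduces its own form under differentiation, so smoothness reduces to continuity
  and first derivatives. To have a half space at all, the normal coordinate of the shell is made a
  variable independent of the point.\<close>

lemma Rk_beyond: "x \<in> Rk k \<Longrightarrow> k \<le> i \<Longrightarrow> x i = 0"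
  by (simp add: Rk_def)

lemma Rk_upd: "x \<in> Rk k \<Longrightarrow> i < k \<Longrightarrow> x(i := a) \<in> Rk k"
  by (auto simp: Rk_def)

lemma Rk_mono: "k \<le> l \<Longrightarrow> Rk k \<subseteq> Rk l"
  by (auto simp: Rk_def)

lemma continuous_on_coord:
  fixes F :: "'b::topological_space \<Rightarrow> rvec"
  shows "continuous_on U F \<Longrightarrow> continuous_on U (\<lambda>x. F x i)"
  by (rule continuous_on_product_then_coordinatewise)

lemma continuous_on_upd:
  fixes F :: "'b::topological_space \<Rightarrow> rvec" and a :: "'b \<Rightarrow> real"
  assumes "continuous_on U F" "continuous_on U a"
  shows "continuous_on U (\<lambda>x. (F x)(i := a x))"
proof (rule continuous_on_coordinatewise_then_product)
  fix j show "continuous_on U (\<lambda>x. ((F x)(i := a x)) j)"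
    by (cases "i = j") (simp_all add: assms continuous_on_coord)
qed

text \<open>\<open>openR\<close> speaks of Euclidean balls, while \<open>continuous_on\<close> in
  \<open>smooth_real\<close> refers to the product topology on
  \<open>nat \<Rightarrow> real\<close>. On \<open>Rk k\<close> the two agree because only finitely
  many coordinates are free.\<close>

lemma openR_iff: "openR k U \<longleftrightarrow> openin (top_of_set (Rk k)) U"
proof
  assume U: "openR k U"
  show "openin (top_of_set (Rk k)) U"
  proof (subst openin_subopen, intro ballI)
    fix x assume x: "x \<in> U"
    with U obtain e where e: "e > 0" "\<And>y. y \<in> Rk k \<Longrightarrow> (\<Sum>i<k. (y i - x i)^2) < e^2 \<Longrightarrow> y \<in> U"
      and sub: "U \<subseteq> Rk k" by (auto simp: openR_def)
    let ?O = "{y::rvec. (\<Sum>i<k. (y i - x i)^2) < e^2}"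
    have "open ?O"
      by (intro open_Collect_less continuous_on_sum continuous_on_power continuous_on_diff continuous_on_const
          continuous_on_product_coordinates)
    hence "openin (top_of_set (Rk k)) (Rk k \<inter> ?O)" by blast
    moreover have "x \<in> Rk k \<inter> ?O" using x sub e(1) by auto
    moreover have "Rk k \<inter> ?O \<subseteq> U" using e by auto
    ultimately show "\<exists>T. openin (top_of_set (Rk k)) T \<and> x \<in> T \<and> T \<subseteq> U" by blast
  qed
next
  assume "openin (top_of_set (Rk k)) U"
  then obtain O' where O': "open O'" "U = Rk k \<inter> O'" by (auto simp: openin_open)
  show "openR k U" unfolding openR_def
  proof (intro conjI ballI)
    show "U \<subseteq> Rk k" using O' by auto
    fix x assume x: "x \<in> U"
    have "openin (product_topology (\<lambda>i::nat. euclidean::real topology) UNIV) O'"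
      using O' by (simp add: euclidean_product_topology)
    from product_topology_open_contains_basis[OF this, of x]
    obtain A where A: "x \<in> (\<Pi>\<^sub>E i\<in>UNIV. A i)" "\<And>i. openin euclidean (A i)"
      "(\<Pi>\<^sub>E i\<in>UNIV. A i) \<subseteq> O'" using x O' by auto
    have "\<exists>e>0. ball (x i) e \<subseteq> A i" for i
      
    proof -
      have "open (A i)" using A(2)[of i] open_openin by blast
      moreover have "x i \<in> A i" using PiE_mem[OF A(1), of i] by simp
      ultimately show ?thesis using open_contains_ball by blast
    qed
    then obtain e where e: "\<And>i. e i > 0" "\<And>i. ball (x i) (e i) \<subseteq> A i" by metis
    \<comment> \<open>The extra element 1 keeps \<open>Min\<close> meaningful for k = 0.\<close>
    define d where "d = Min (insert 1 (e ` {..<k}))"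
    have d: "d > 0" using e(1) by (auto simp: d_def)
    have de: "i < k \<Longrightarrow> d \<le> e i" for i by (simp add: d_def)
    have "y \<in> U" if y: "y \<in> Rk k" "(\<Sum>i<k. (y i - x i)^2) < d^2" for y
    proof -
      have "y i \<in> A i" for i
      proof (cases "i < k")
        case True
        have "(y i - x i)^2 \<le> (\<Sum>i<k. (y i - x i)^2)"
          by (rule member_le_sum) (use True in auto)
        hence "(y i - x i)^2 < d^2" using y by linarith
        hence "\<bar>y i - x i\<bar> < d" using d power2_less_imp_less[of "\<bar>y i - x i\<bar>" d] by simp
        hence "y i \<in> ball (x i) (e i)" using de[OF True] by (auto simp: dist_real_def)
        thus ?thesis using e by blast
      next
        case False
        hence "y i = x i" using y x O' by (auto simp: Rk_def)
        thus ?thesis using A(1) by auto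
      qed
      thus ?thesis using A(3) y O' by auto
    qed
    thus "\<exists>e>0. \<forall>y\<in>Rk k. (\<Sum>i<k. (y i - x i)^2) < e^2 \<longrightarrow> y \<in> U" using d by blast
  qed
qed

lemma openR_subset: "openR k U \<Longrightarrow> U \<subseteq> Rk k"
  by (simp add: openR_def)

lemma openR_Int: "openR k U \<Longrightarrow> openR k V \<Longrightarrow> openR k (U \<inter> V)"
  by (simp add: openR_iff openin_Int)

lemma openR_empty: "openR k {}"
  by (simp add: openR_iff)

lemma openR_vimage:
  assumes "openR k U" "continuous_on U F" "open T"
  shows "openR k {x\<in>U. F x \<in> T}"
proof -
  have "openin (top_of_set U) (U \<inter> F -` T)"
    using assms by (simp add: continuous_openin_preimage_gen)
  moreover have "U \<inter> F -` T = {x\<in>U. F x \<in> T}" by auto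
  ultimately show ?thesis using assms(1) by (metis openR_iff openin_trans)
qed

lemma openR_vimage_R:
  assumes "openR k U" "continuous_on U F" "openR l T" "F ` U \<subseteq> Rk l"
  shows "openR k {x\<in>U. F x \<in> T}"
proof -
  obtain O' where O': "open O'" "T = Rk l \<inter> O'" using assms(3) by (auto simp: openR_iff openin_open)
  have "{x\<in>U. F x \<in> T} = {x\<in>U. F x \<in> O'}" using O' assms(4) by auto
  thus ?thesis using openR_vimage[OF assms(1,2) O'(1)] by simp
qed

lemma openR_line:
  assumes "openR k U" "x \<in> U" "i < k"
  shows "eventually (\<lambda>t::real. x(i := x i + t) \<in> U) (nhds 0)"
proof -
  obtain O' where O': "open O'" "U = Rk k \<inter> O'" using assms(1) by (auto simp: openR_iff openin_open)
  have c: "continuous_on UNIV (\<lambda>t::real. x(i := x i + t))"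
    by (intro continuous_on_upd continuous_on_add continuous_on_const continuous_on_id)
  have "open ((\<lambda>t::real. x(i := x i + t)) -` O')"
    using open_vimage[OF O'(1) c] by simp
  moreover have "0 \<in> (\<lambda>t::real. x(i := x i + t)) -` O'" using assms O' by auto
  ultimately have "eventually (\<lambda>t::real. x(i := x i + t) \<in> O') (nhds 0)"
    by (auto simp: eventually_nhds)
  thus ?thesis by eventually_elim (use assms O' in \<open>auto intro: Rk_upd\<close>)
qed

section \<open>Partial derivatives along coordinate lines\<close>

definition has_pd :: "nat \<Rightarrow> (rvec \<Rightarrow> real) \<Rightarrow> rvec \<Rightarrow> real \<Rightarrow> bool" where
  "has_pd i g x D \<longleftrightarrow> ((\<lambda>t. g (x(i := x i + t))) has_real_derivative D) (at 0)"

lemma has_pd_pdir: "has_pd i g x D \<Longrightarrow> pdir i g x = D"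
  unfolding has_pd_def pdir_def by (rule DERIV_imp_deriv)

lemma has_pd_iff: "(\<lambda>t. g (x(i := x i + t))) differentiable (at 0) \<longleftrightarrow> has_pd i g x (pdir i g x)"
  unfolding has_pd_def pdir_def by (rule DERIV_deriv_iff_real_differentiable[symmetric])

lemma has_pd_cong:
  assumes "openR k U" "x \<in> U" "i < k" "\<And>y. y \<in> U \<Longrightarrow> g y = g' y" "has_pd i g x D"
  shows "has_pd i g' x D"
proof -
  have "eventually (\<lambda>t. g (x(i := x i + t)) = g' (x(i := x i + t))) (nhds 0)"
    using openR_line[OF assms(1-3)] by eventually_elim (use assms(4) in auto)
  from DERIV_cong_ev[OF refl this refl, of D] show ?thesis using assms(5)
    by (simp only: has_pd_def)
qed

lemma pdir_cong:
  assumes "openR k U" "x \<in> U" "i < k" "\<And>y. y \<in> U \<Longrightarrow> g y = g' y"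
  shows "pdir i g x = pdir i g' x"
proof -
  have "eventually (\<lambda>t. g (x(i := x i + t)) = g' (x(i := x i + t))) (nhds 0)"
    using openR_line[OF assms(1-3)] by eventually_elim (use assms(4) in auto)
  thus ?thesis unfolding pdir_def by (rule deriv_cong_ev) simp
qed

lemma dpart_append: "dpart (is @ js) g = dpart is (dpart js g)"
  by (induction "is") auto

text \<open>\<open>dpart\<close> applies the last entry of its list first, so splitting off that
  entry turns the quantification over index lists into a recursion on first derivatives.\<close>

lemma smooth_real_unfold:
  "smooth_real k U g \<longleftrightarrow> continuous_on U g \<and>
     (\<forall>i<k. (\<forall>x\<in>U. has_pd i g x (pdir i g x)) \<and> smooth_real k U (pdir i g))" (is "_ \<longleftrightarrow> ?R")
proof
  assume g: "smooth_real k U g"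
  show ?R
  proof (intro conjI allI impI ballI)
    show "continuous_on U g" using g[unfolded smooth_real_def, rule_format, of "[]"] by auto
    fix i assume i: "i < k"
    show "has_pd i g x (pdir i g x)" if "x \<in> U" for x
      using g[unfolded smooth_real_def, rule_format, of "[]"] i that by (auto simp: has_pd_iff)
    show "smooth_real k U (pdir i g)" unfolding smooth_real_def
    proof (intro allI impI)
      fix js assume "set js \<subseteq> {..<k}"
      with i g[unfolded smooth_real_def, rule_format, of "js @ [i]"]
      show "continuous_on U (dpart js (pdir i g)) \<and>
        (\<forall>i'<k. \<forall>x\<in>U. (\<lambda>t. dpart js (pdir i g) (x(i' := x i' + t))) differentiable at 0)"
        by (simp add: dpart_append)
    qed
  qed
next
  assume R: ?R
  show "smooth_real k U g" unfolding smooth_real_def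
  proof (intro allI impI)
    fix js assume js: "set js \<subseteq> {..<k}"
    show "continuous_on U (dpart js g) \<and>
        (\<forall>i<k. \<forall>x\<in>U. (\<lambda>t. dpart js g (x(i := x i + t))) differentiable at 0)"
    proof (cases js rule: rev_cases)
      case Nil thus ?thesis using R by (simp add: has_pd_iff)
    next
      case (snoc is' i)
      hence "smooth_real k U (pdir i g)" using R js by auto
      thus ?thesis using js snoc by (simp add: smooth_real_def dpart_append)
    qed
  qed
qed

lemma smooth_real_continuous: "smooth_real k U g \<Longrightarrow> continuous_on U g"
  using smooth_real_unfold by blast

lemma smooth_real_pd: "smooth_real k U g \<Longrightarrow> i < k \<Longrightarrow> x \<in> U \<Longrightarrow> has_pd i g x (pdir i g x)"
  using smooth_real_unfold by blast

lemma smooth_real_pdir: "smooth_real k U g \<Longrightarrow> i < k \<Longrightarrow> smooth_real k U (pdir i g)"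
  using smooth_real_unfold by blast

text \<open>The derivative is an arbitrary witness \<open>g'\<close> and not
  \<open>pdir i g\<close>: it then only has to be right on \<open>U\<close>, and formulas such as
  the product rule can be supplied directly. The order \<open>p\<close> provides an induction for
  closure properties.\<close>

primrec ck :: "nat \<Rightarrow> nat \<Rightarrow> rvec set \<Rightarrow> (rvec \<Rightarrow> real) \<Rightarrow> bool" where
  "ck 0 k U g \<longleftrightarrow> continuous_on U g"
| "ck (Suc p) k U g \<longleftrightarrow> continuous_on U g \<and>
     (\<forall>i<k. \<exists>g'. (\<forall>x\<in>U. has_pd i g x (g' x)) \<and> ck p k U g')"

lemma ck_continuous: "ck p k U g \<Longrightarrow> continuous_on U g"
  by (cases p) auto

lemma ck_cong:
  assumes "openR k U" "\<And>y. y \<in> U \<Longrightarrow> g y = g' y" "ck p k U g"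
  shows "ck p k U g'"
proof -
  have "continuous_on U g'" using assms ck_continuous continuous_on_cong by metis
  thus ?thesis using assms has_pd_cong[OF assms(1) _ _ assms(2)] by (cases p) fastforce+
qed

lemma ck_Suc: "ck (Suc p) k U g \<Longrightarrow> ck p k U g"
proof (induction p arbitrary: g)
  case 0 thus ?case by simp
next
  case (Suc p)
  show ?case unfolding ck.simps(2)[of p]
  proof (intro conjI allI impI)
    show "continuous_on U g" using Suc.prems ck_continuous by blast
    fix i assume "i < k"
    then obtain g' where "\<forall>x\<in>U. has_pd i g x (g' x)" "ck (Suc p) k U g'"
      using Suc.prems unfolding ck.simps(2)[of "Suc p"] by blast
    thus "\<exists>g'. (\<forall>x\<in>U. has_pd i g x (g' x)) \<and> ck p k U g'" using Suc.IH by blast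
  qed
qed

lemma smooth_real_ck:
  assumes "openR k U"
  shows "smooth_real k U g \<longleftrightarrow> (\<forall>p. ck p k U g)"
proof
  assume g: "smooth_real k U g"
  have "ck p k U g" for p using g
  proof (induction p arbitrary: g)
    case 0 thus ?case by (simp add: smooth_real_continuous)
  next
    case (Suc p) thus ?case
      using smooth_real_continuous[of k U g] smooth_real_pd[of k U g] smooth_real_pdir[of k U g] Suc.IH
      unfolding ck.simps by blast
  qed
  thus "\<forall>p. ck p k U g" ..
next
  assume g: "\<forall>p. ck p k U g"
  have *: "ck p k U (pdir i g)" if all: "\<forall>p. ck p k U g" and "i < k" for g i p
  proof -
    obtain g' where g': "\<forall>x\<in>U. has_pd i g x (g' x)" "ck p k U g'"
      using spec[OF all, of "Suc p"] \<open>i < k\<close> by auto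
    have "g' y = pdir i g y" if "y \<in> U" for y using has_pd_pdir g'(1) that by metis
    thus ?thesis using ck_cong[OF assms _ g'(2)] by blast
  qed
  have "\<forall>p. ck p k U (dpart js g)" if "set js \<subseteq> {..<k}" for js
    using that by (induction js) (use g * in auto)
  moreover have "has_pd i g x (pdir i g x)" if "\<forall>p. ck p k U g" "i < k" "x \<in> U" for g x i
    using spec[OF that(1), of "Suc 0"] that(2,3) has_pd_pdir by fastforce
  ultimately show "smooth_real k U g"
    unfolding smooth_real_def has_pd_iff using ck.simps(1) by blast
qed

text \<open>Membership in \<open>\<P>\<close> is passed on to derivatives, so it controls every
  order at once. Meant for the Seeley extensions, whose derivatives are again Seeley extensions of
  other functions.\<close>

lemma smooth_real_coinduct:
  assumes "openR k U" "\<P> g"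
    and "\<And>g. \<P> g \<Longrightarrow> continuous_on U g"
    and "\<And>g i. \<P> g \<Longrightarrow> i < k \<Longrightarrow> \<exists>g'. (\<forall>x\<in>U. has_pd i g x (g' x)) \<and> \<P> g'"
  shows "smooth_real k U g"
proof -
  have "ck p k U g" for p using assms(2)
  proof (induction p arbitrary: g)
    case 0 thus ?case using assms(3) by simp
  next
    case (Suc p) thus ?case unfolding ck.simps(2)[of p] using assms(3,4) by meson
  qed
  thus ?thesis using smooth_real_ck[OF assms(1)] by blast
qed

lemma smooth_real_cong:
  assumes "openR k U" "smooth_real k U g" "\<And>y. y \<in> U \<Longrightarrow> g y = g' y"
  shows "smooth_real k U g'"
  using assms smooth_real_ck ck_cong by metis

lemma smooth_real_subset: "smooth_real k U g \<Longrightarrow> V \<subseteq> U \<Longrightarrow> smooth_real k V g"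
  unfolding smooth_real_def by (meson continuous_on_subset subsetD)

text \<open>Since \<open>Rk k\<close> is literally contained in \<open>Rk l\<close>, this and
  \<open>smooth_real_subset\<close> restrict a smooth function of more variables to a slice, with no
  inclusion map to compose with.\<close>

lemma smooth_real_lower: "smooth_real l U g \<Longrightarrow> k \<le> l \<Longrightarrow> smooth_real k U g"
  unfolding smooth_real_def by (meson lessThan_subset_iff order_less_le_trans subset_trans)

lemma smooth_real_local:
  assumes "U \<subseteq> Rk k" "\<And>x. x \<in> U \<Longrightarrow> \<exists>V. openR k V \<and> x \<in> V \<and> smooth_real k V g"
  shows "smooth_real k U g"
  unfolding smooth_real_def
proof (intro allI impI conjI ballI)
  fix js assume js: "set js \<subseteq> {..<k}"
  show "continuous_on U (dpart js g)" unfolding continuous_on_eq_continuous_within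
  proof
    fix x assume x: "x \<in> U"
    then obtain V where V: "openR k V" "x \<in> V" "smooth_real k V g" using assms by blast
    obtain O' where O': "open O'" "V = Rk k \<inter> O'" using V(1) by (auto simp: openR_iff openin_open)
    have "continuous_on V (dpart js g)" using V(3) js by (simp add: smooth_real_def)
    hence "continuous (at x within V) (dpart js g)"
      using V(2) by (simp add: continuous_on_eq_continuous_within)
    hence "continuous (at x within U \<inter> O') (dpart js g)"
      by (rule continuous_within_subset) (use O' assms(1) in auto)
    thus "continuous (at x within U) (dpart js g)"
      using O' V(2) at_within_nhd[of x O' U "U \<inter> O'"] by (simp add: continuous_within Int_assoc)
  qed
next
  fix js i x assume "set js \<subseteq> {..<k}" "i < k" "x \<in> U"
  thus "(\<lambda>t. dpart js g (x(i := x i + t))) differentiable at 0"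
    using assms(2)[of x] by (auto simp: smooth_real_def)
qed

section \<open>Closure of the differentiability classes under arithmetic\<close>

lemma has_pd_const: "has_pd i (\<lambda>x. c) x 0"
  by (simp add: has_pd_def)

lemma ck_const: "ck p k U (\<lambda>x. c)"
  by (induction p arbitrary: c) (use has_pd_const in \<open>auto intro!: exI[of _ "\<lambda>x. 0"]\<close>)

lemma ck_coord: "ck p k U (\<lambda>x. x j)"
proof (cases p)
  case 0 thus ?thesis by (simp add: continuous_on_subset[OF continuous_on_product_coordinates])
next
  case (Suc q)
  have "has_pd i (\<lambda>x. x j) x (if i = j then 1 else 0)" for i x
    unfolding has_pd_def by (auto intro!: derivative_eq_intros)
  hence "\<exists>g'. (\<forall>x\<in>U. has_pd i (\<lambda>x. x j) x (g' x)) \<and> ck q k U g'" for i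
    using ck_const by (intro exI[of _ "\<lambda>x. if i = j then 1 else 0"]) blast
  thus ?thesis using Suc ck_const continuous_on_subset[OF continuous_on_product_coordinates[of j], of U]
    by auto
qed

lemma ck_add: "ck p k U f \<Longrightarrow> ck p k U g \<Longrightarrow> ck p k U (\<lambda>x. f x + g x)"
proof (induction p arbitrary: f g)
  case 0 thus ?case by (simp add: continuous_on_add)
next
  case (Suc p)
  show ?case unfolding ck.simps
  proof (intro conjI allI impI)
    show "continuous_on U (\<lambda>x. f x + g x)" using Suc.prems ck_continuous continuous_on_add by blast
    fix i assume "i < k"
    then obtain f' g' where "\<forall>x\<in>U. has_pd i f x (f' x)" "ck p k U f'"
      "\<forall>x\<in>U. has_pd i g x (g' x)" "ck p k U g'" using Suc.prems unfolding ck.simps by blast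
    thus "\<exists>h. (\<forall>x\<in>U. has_pd i (\<lambda>x. f x + g x) x (h x)) \<and> ck p k U h"
      by (intro exI[of _ "\<lambda>x. f' x + g' x"]) (auto simp: has_pd_def intro!: Suc.IH derivative_eq_intros)
  qed
qed

lemma ck_mult: "ck p k U f \<Longrightarrow> ck p k U g \<Longrightarrow> ck p k U (\<lambda>x. f x * g x)"
proof (induction p arbitrary: f g)
  case 0 thus ?case by (simp add: continuous_on_mult)
next
  case (Suc p)
  show ?case unfolding ck.simps
  proof (intro conjI allI impI)
    show "continuous_on U (\<lambda>x. f x * g x)" using Suc.prems ck_continuous continuous_on_mult by blast
    fix i assume "i < k"
    then obtain f' g' where *: "\<forall>x\<in>U. has_pd i f x (f' x)" "ck p k U f'"
      "\<forall>x\<in>U. has_pd i g x (g' x)" "ck p k U g'" using Suc.prems unfolding ck.simps by blast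
    have "has_pd i (\<lambda>x. f x * g x) x (f' x * g x + g' x * f x)" if "x \<in> U" for x
      using *(1,3)[rule_format, OF that] unfolding has_pd_def
      by - (drule (1) DERIV_mult, simp)
    moreover have "ck p k U (\<lambda>x. f' x * g x + g' x * f x)"
      using * Suc.prems ck_Suc by (intro ck_add Suc.IH) auto
    ultimately show "\<exists>h. (\<forall>x\<in>U. has_pd i (\<lambda>x. f x * g x) x (h x)) \<and> ck p k U h"
      by (intro exI[of _ "\<lambda>x. f' x * g x + g' x * f x"]) auto
  qed
qed

lemma ck_inverse:
  assumes "\<And>x. x \<in> U \<Longrightarrow> g x \<noteq> 0"
  shows "ck p k U g \<Longrightarrow> ck p k U (\<lambda>x. inverse (g x))"
proof (induction p)
  case 0 thus ?case using assms by (auto intro!: continuous_intros)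
next
  case (Suc p)
  hence IH: "ck p k U (\<lambda>x. inverse (g x))" using ck_Suc by blast
  show ?case unfolding ck.simps
  proof (intro conjI allI impI)
    show "continuous_on U (\<lambda>x. inverse (g x))"
      using Suc.prems assms by (auto intro!: continuous_intros)
    fix i assume "i < k"
    then obtain g' where *: "\<forall>x\<in>U. has_pd i g x (g' x)" "ck p k U g'"
      using Suc.prems unfolding ck.simps by blast
    let ?h = "\<lambda>x. (-1) * (inverse (g x) * g' x * inverse (g x))"
    have "has_pd i (\<lambda>x. inverse (g x)) x (?h x)" if "x \<in> U" for x
      using *(1)[rule_format, OF that] assms[OF that] unfolding has_pd_def
      by - (drule DERIV_inverse', auto)
    moreover have "ck p k U ?h" using * IH by (intro ck_mult ck_const)
    ultimately show "\<exists>h. (\<forall>x\<in>U. has_pd i (\<lambda>x. inverse (g x)) x (h x)) \<and> ck p k U h"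
      by (intro exI[of _ ?h]) auto
  qed
qed

lemma ck_sum: "(\<And>j. j \<in> A \<Longrightarrow> ck p k U (f j)) \<Longrightarrow> ck p k U (\<lambda>x. \<Sum>j\<in>A. f j x)"
  by (induction A rule: infinite_finite_induct) (auto intro: ck_const ck_add)

lemma smooth_real_const: "openR k U \<Longrightarrow> smooth_real k U (\<lambda>x. c)"
  by (simp add: smooth_real_ck ck_const)

lemma smooth_real_coord: "openR k U \<Longrightarrow> smooth_real k U (\<lambda>x. x j)"
  by (simp add: smooth_real_ck ck_coord)

lemma smooth_real_add: "openR k U \<Longrightarrow> smooth_real k U f \<Longrightarrow> smooth_real k U g \<Longrightarrow> smooth_real k U (\<lambda>x. f x + g x)"
  by (simp add: smooth_real_ck ck_add)

lemma smooth_real_mult: "openR k U \<Longrightarrow> smooth_real k U f \<Longrightarrow> smooth_real k U g \<Longrightarrow> smooth_real k U (\<lambda>x. f x * g x)"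
  by (simp add: smooth_real_ck ck_mult)

lemma smooth_real_power: "openR k U \<Longrightarrow> smooth_real k U f \<Longrightarrow> smooth_real k U (\<lambda>x. f x ^ n)"
  by (induction n) (auto intro: smooth_real_const smooth_real_mult)

lemma smooth_real_diff:
  assumes "openR k U" "smooth_real k U f" "smooth_real k U g"
  shows "smooth_real k U (\<lambda>x. f x - g x)"
  using smooth_real_add[OF assms(1,2) smooth_real_mult[OF assms(1) smooth_real_const[OF assms(1), of "-1"] assms(3)]]
  by simp

lemma smooth_real_divide:
  assumes "openR k U" "smooth_real k U f" "smooth_real k U g" "\<And>x. x \<in> U \<Longrightarrow> g x \<noteq> 0"
  shows "smooth_real k U (\<lambda>x. f x / g x)"
  using assms by (simp add: smooth_real_ck ck_mult ck_inverse divide_inverse)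

lemma smooth_real_sum:
  "openR k U \<Longrightarrow> (\<And>j. j \<in> A \<Longrightarrow> smooth_real k U (f j)) \<Longrightarrow> smooth_real k U (\<lambda>x. \<Sum>j\<in>A. f j x)"
  by (simp add: smooth_real_ck ck_sum)

section \<open>Chain rule\<close>

lemma MVT_segment:
  fixes f f' :: "real \<Rightarrow> real"
  assumes "\<And>x. \<bar>x - a\<bar> \<le> \<bar>b - a\<bar> \<Longrightarrow> (f has_real_derivative f' x) (at x)"
  shows "\<exists>z. \<bar>z - a\<bar> \<le> \<bar>b - a\<bar> \<and> f b - f a = (b - a) * f' z"
proof (cases a b rule: linorder_cases)
  case less
  from MVT2[OF less, of f f'] obtain z where "a < z" "z < b" "f b - f a = (b - a) * f' z"
    using assms less by force
  thus ?thesis by (intro exI[of _ z]) auto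
next
  case greater
  from MVT2[OF greater, of f f'] obtain z where z: "b < z" "z < a" "f a - f b = (a - b) * f' z"
    using assms greater by force
  hence "f b - f a = (b - a) * f' z" by (simp add: algebra_simps)
  thus ?thesis using z by (intro exI[of _ z]) auto
qed auto

text \<open>The condition on \<open>y\<close> describes a box around \<open>\<gamma> 0\<close> that
  shrinks with \<open>t\<close>. It contains the mixed points and mean value points of the chain
  rule, which need not lie on the curve.\<close>

lemma eventually_near_curve:
  assumes W: "openR l W" "\<gamma> 0 \<in> W"
    and c: "\<And>j. j < l \<Longrightarrow> isCont (\<lambda>t::real. \<gamma> t j) 0"
  shows "eventually (\<lambda>t. \<forall>y\<in>Rk l. (\<forall>i<l. \<bar>y i - \<gamma> 0 i\<bar> \<le> \<bar>\<gamma> t i - \<gamma> 0 i\<bar>) \<longrightarrow> y \<in> W) (nhds 0)"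
proof -
  obtain e where e: "e > 0" "\<And>y. y \<in> Rk l \<Longrightarrow> (\<Sum>i<l. (y i - \<gamma> 0 i)^2) < e^2 \<Longrightarrow> y \<in> W"
    using W by (auto simp: openR_def)
  have cn: "((\<lambda>t. \<gamma> t j) \<longlongrightarrow> \<gamma> 0 j) (nhds 0)" if "j < l" for j
    using c[OF that] tendsto_at_iff_tendsto_nhds[of "\<lambda>t. \<gamma> t j" 0] by (simp add: isCont_def)
  have "((\<lambda>t. \<Sum>i<l. (\<gamma> t i - \<gamma> 0 i)^2) \<longlongrightarrow> (\<Sum>i<l. (\<gamma> 0 i - \<gamma> 0 i)^2)) (nhds 0)"
    by (intro tendsto_intros cn) simp
  hence "eventually (\<lambda>t. (\<Sum>i<l. (\<gamma> t i - \<gamma> 0 i)^2) < e^2) (nhds 0)"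
    by (rule order_tendstoD) (use e in auto)
  thus ?thesis
  proof eventually_elim
    case (elim t)
    show ?case
    proof (intro ballI impI)
      fix y assume y: "y \<in> Rk l" "\<forall>i<l. \<bar>y i - \<gamma> 0 i\<bar> \<le> \<bar>\<gamma> t i - \<gamma> 0 i\<bar>"
      have "(\<Sum>i<l. (y i - \<gamma> 0 i)^2) \<le> (\<Sum>i<l. (\<gamma> t i - \<gamma> 0 i)^2)"
        by (intro sum_mono) (use y in \<open>simp add: abs_le_square_iff\<close>)
      thus "y \<in> W" using elim e y by auto
    qed
  qed
qed

text \<open>Walking from \<open>\<gamma> 0\<close> to \<open>\<gamma> t\<close> one coordinate at a
  time splits the increment into one-variable mean value steps, so continuous partial derivatives
  suffice.\<close>

lemma chain_rule_curve:
  assumes V: "openR l V"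
    and pd: "\<And>j x. j < l \<Longrightarrow> x \<in> V \<Longrightarrow> has_pd j G x (G' j x)"
    and cont: "\<And>j. j < l \<Longrightarrow> continuous_on V (G' j)"
    and \<gamma>: "eventually (\<lambda>t. \<gamma> t \<in> V) (nhds 0)"
    and d: "\<And>j. j < l \<Longrightarrow> ((\<lambda>t::real. \<gamma> t j) has_real_derivative D j) (at 0)"
  shows "((\<lambda>t. G (\<gamma> t)) has_real_derivative (\<Sum>j<l. D j * G' j (\<gamma> 0))) (at 0)"
proof -
  have \<gamma>0: "\<gamma> 0 \<in> V" using \<gamma> by (rule eventually_nhds_x_imp_x)
  have c: "isCont (\<lambda>t. \<gamma> t j) 0" if "j < l" for j using d[OF that] by (rule DERIV_isCont)
  \<comment> \<open>Mixed point: the first \<open>j\<close> coordinates have already moved.\<close>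
  define z where "z j t = (\<lambda>i. if i < j then \<gamma> t i else \<gamma> 0 i)" for j t
  define near where "near t y \<longleftrightarrow> y \<in> Rk l \<and> (\<forall>i<l. \<bar>y i - \<gamma> 0 i\<bar> \<le> \<bar>\<gamma> t i - \<gamma> 0 i\<bar>)" for t y
  have evnear: "eventually (\<lambda>t. \<forall>y. near t y \<longrightarrow> y \<in> W) (nhds 0)" if "openR l W" "\<gamma> 0 \<in> W" for W
    using eventually_near_curve[of l W \<gamma>, OF that, OF c] by (simp add: near_def Ball_def imp_conjL)
  define good where "good t \<longleftrightarrow> \<gamma> t \<in> V \<and> (\<forall>y. near t y \<longrightarrow> y \<in> V)" for t
  have evgood: "eventually good (nhds 0)"
    using \<gamma> evnear[OF V \<gamma>0] by eventually_elim (simp add: good_def)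
  have "\<exists>\<xi>. near t \<xi> \<and> G (z (Suc j) t) - G (z j t) = (\<gamma> t j - \<gamma> 0 j) * G' j \<xi>"
    if t: "good t" and j: "j < l" for t j
  proof -
    let ?p = "\<lambda>s. (z j t)(j := s)"
    have near: "near t (?p s)" if "\<bar>s - \<gamma> 0 j\<bar> \<le> \<bar>\<gamma> t j - \<gamma> 0 j\<bar>" for s
      using that j openR_subset[OF V] \<gamma>0 t unfolding near_def z_def good_def Rk_def by auto
    have "((\<lambda>s. G (?p s)) has_real_derivative G' j (?p s)) (at s)"
      if "\<bar>s - \<gamma> 0 j\<bar> \<le> \<bar>\<gamma> t j - \<gamma> 0 j\<bar>" for s
    proof -
      have "has_pd j G (?p s) (G' j (?p s))" using near[OF that] t j pd by (auto simp: good_def)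
      hence "((\<lambda>h. G (?p (h + s))) has_real_derivative G' j (?p s)) (at 0)"
        by (simp add: has_pd_def add.commute)
      hence "((\<lambda>h. G (?p h)) has_real_derivative G' j (?p s)) (at (0 + s))"
        by (simp only: DERIV_shift[of _ _ 0 s])
      thus ?thesis by simp
    qed
    from MVT_segment[OF this] obtain s where s: "\<bar>s - \<gamma> 0 j\<bar> \<le> \<bar>\<gamma> t j - \<gamma> 0 j\<bar>"
      "G (?p (\<gamma> t j)) - G (?p (\<gamma> 0 j)) = (\<gamma> t j - \<gamma> 0 j) * G' j (?p s)" by blast
    have "?p (\<gamma> t j) = z (Suc j) t" "?p (\<gamma> 0 j) = z j t"
      by (auto simp: z_def fun_eq_iff less_Suc_eq)
    with s(2) have "G (z (Suc j) t) - G (z j t) = (\<gamma> t j - \<gamma> 0 j) * G' j (?p s)" by (simp only:)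
    with near[OF s(1)] show ?thesis by blast
  qed
  then obtain \<xi> where \<xi>: "\<And>t j. good t \<Longrightarrow> j < l \<Longrightarrow> near t (\<xi> t j)"
    "\<And>t j. good t \<Longrightarrow> j < l \<Longrightarrow> G (z (Suc j) t) - G (z j t) = (\<gamma> t j - \<gamma> 0 j) * G' j (\<xi> t j)"
    by metis
  have tele: "G (\<gamma> t) - G (\<gamma> 0) = (\<Sum>j<l. (\<gamma> t j - \<gamma> 0 j) * G' j (\<xi> t j))" if t: "good t" for t
  proof -
    have "(\<Sum>j<l. (\<gamma> t j - \<gamma> 0 j) * G' j (\<xi> t j)) = (\<Sum>j<l. G (z (Suc j) t) - G (z j t))"
      using \<xi>(2)[OF t] by simp
    also have "\<dots> = G (z l t) - G (z 0 t)" by (rule sum_lessThan_telescope)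
    also have "z l t = \<gamma> t" 
    proof
      have "\<gamma> t \<in> Rk l" "\<gamma> 0 \<in> Rk l" using t \<gamma>0 openR_subset[OF V] by (auto simp: good_def)
      thus "z l t i = \<gamma> t i" for i by (cases "i < l") (simp_all add: z_def Rk_beyond)
    qed
    also have "z 0 t = \<gamma> 0" by (simp add: z_def)
    finally show ?thesis ..
  qed
  \<comment> \<open>The points \<open>\<xi>\<close> come from the mean value theorem with no
    continuity in \<open>t\<close>; it is enough that they lie in the shrinking box.\<close>
  have lim: "((\<lambda>t. G' j (\<xi> t j)) \<longlongrightarrow> G' j (\<gamma> 0)) (at 0)" if j: "j < l" for j
  proof (rule topological_tendstoI)
    fix T assume T: "open T" "G' j (\<gamma> 0) \<in> T"
    have "openR l {x\<in>V. G' j x \<in> T}" by (rule openR_vimage[OF V cont[OF j] T(1)])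
    from evnear[OF this] have "eventually (\<lambda>t. \<forall>y. near t y \<longrightarrow> y \<in> {x\<in>V. G' j x \<in> T}) (nhds 0)"
      using T \<gamma>0 by auto
    with evgood have "eventually (\<lambda>t. G' j (\<xi> t j) \<in> T) (nhds 0)"
      by eventually_elim (use \<xi>(1)[OF _ j] in auto)
    thus "eventually (\<lambda>t. G' j (\<xi> t j) \<in> T) (at 0)" by (simp add: eventually_nhds_conv_at)
  qed
  have "((\<lambda>t. \<Sum>j<l. (\<gamma> t j - \<gamma> 0 j) / t * G' j (\<xi> t j)) \<longlongrightarrow> (\<Sum>j<l. D j * G' j (\<gamma> 0))) (at 0)"
    by (intro tendsto_sum tendsto_mult lim) (use d in \<open>auto simp: DERIV_def\<close>)
  moreover have "eventually (\<lambda>t. (\<Sum>j<l. (\<gamma> t j - \<gamma> 0 j) / t * G' j (\<xi> t j)) = (G (\<gamma> t) - G (\<gamma> 0)) / t) (at 0)"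
    using evgood unfolding eventually_nhds_conv_at
    by (auto elim!: eventually_mono simp: tele sum_divide_distrib)
  ultimately have "((\<lambda>t. (G (\<gamma> t) - G (\<gamma> 0)) / t) \<longlongrightarrow> (\<Sum>j<l. D j * G' j (\<gamma> 0))) (at 0)"
    by (rule Lim_transform_eventually)
  thus ?thesis by (simp add: DERIV_def)
qed

lemma smooth_map_continuous:
  assumes "smooth_map k U l F"
  shows "continuous_on U F"
proof (rule continuous_on_coordinatewise_then_product)
  fix j
  show "continuous_on U (\<lambda>x. F x j)"
  proof (cases "j < l")
    case True thus ?thesis using assms smooth_real_continuous by (auto simp: smooth_map_def)
  next
    case False
    hence "\<And>x. x \<in> U \<Longrightarrow> F x j = 0" using assms Rk_beyond by (auto simp: smooth_map_def)
    thus ?thesis using continuous_on_cong[OF refl, of U "\<lambda>x. F x j" "\<lambda>x. 0"] by simp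
  qed
qed

lemma ck_compose:
  assumes U: "openR k U" and V: "openR l V" and F: "smooth_map k U l F" and FV: "F ` U \<subseteq> V"
  shows "ck p l V G \<Longrightarrow> ck p k U (\<lambda>x. G (F x))"
proof (induction p arbitrary: G)
  case 0
  thus ?case using continuous_on_compose2[OF _ smooth_map_continuous[OF F] FV] by auto
next
  case (Suc p)
  have cF: "continuous_on U F" by (rule smooth_map_continuous[OF F])
  have "\<exists>G'. (\<forall>x\<in>V. has_pd j G x (G' x)) \<and> ck p l V G'" if "j < l" for j
    using Suc.prems that by auto
  then obtain G' where G': "\<And>j x. j < l \<Longrightarrow> x \<in> V \<Longrightarrow> has_pd j G x (G' j x)"
    "\<And>j. j < l \<Longrightarrow> ck p l V (G' j)" by metis
  show ?case unfolding ck.simps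
  proof (intro conjI allI impI)
    show "continuous_on U (\<lambda>x. G (F x))"
      using continuous_on_compose2[OF ck_continuous[OF Suc.prems] cF FV] .
    fix i assume i: "i < k"
    let ?h = "\<lambda>x. \<Sum>j<l. pdir i (\<lambda>x. F x j) x * G' j (F x)"
    have sF: "smooth_real k U (\<lambda>x. F x j)" if "j < l" for j
      using F that by (auto simp: smooth_map_def)
    have "has_pd i (\<lambda>x. G (F x)) x (?h x)" if x: "x \<in> U" for x
    proof -
      let ?\<gamma> = "\<lambda>t. F (x(i := x i + t))"
      have "((\<lambda>t. G (?\<gamma> t)) has_real_derivative (\<Sum>j<l. pdir i (\<lambda>x. F x j) x * G' j (?\<gamma> 0))) (at 0)"
      proof (rule chain_rule_curve[OF V G'(1)])
        show "continuous_on V (G' j)" if "j < l" for j using G'(2)[OF that] by (rule ck_continuous)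
        show "eventually (\<lambda>t. ?\<gamma> t \<in> V) (nhds 0)"
          using openR_line[OF U x i] by eventually_elim (use FV in auto)
        show "((\<lambda>t. ?\<gamma> t j) has_real_derivative pdir i (\<lambda>x. F x j) x) (at 0)" if "j < l" for j
          using smooth_real_pd[OF sF[OF that] i x] by (simp add: has_pd_def)
      qed
      thus ?thesis by (simp add: has_pd_def)
    qed
    moreover have "ck p k U ?h"
      by (intro ck_sum ck_mult Suc.IH G'(2) spec[OF smooth_real_pdir[OF sF i, unfolded smooth_real_ck[OF U]]]) simp_all
    ultimately show "\<exists>g'. (\<forall>x\<in>U. has_pd i (\<lambda>x. G (F x)) x (g' x)) \<and> ck p k U g'"
      by (intro exI[of _ ?h] conjI ballI)
  qed
qed

lemma smooth_real_compose:
  assumes "openR k U" "openR l V" "smooth_map k U l F" "F ` U \<subseteq> V" "smooth_real l V G"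
  shows "smooth_real k U (\<lambda>x. G (F x))"
  using ck_compose[OF assms(1-4)] assms(5) smooth_real_ck assms(1,2) by blast

lemma smooth_map_id: "openR k U \<Longrightarrow> smooth_map k U k (\<lambda>x. x)"
  using openR_subset by (auto simp: smooth_map_def intro: smooth_real_coord)

lemma openR_Rk: "openR k (Rk k)"
  by (simp add: openR_iff)

lemma openR_half: "openR (Suc 0) {y \<in> Rk 1. y 0 > (0::real)}"
  using openR_vimage[OF openR_Rk continuous_on_product_coordinates[THEN continuous_on_subset], of _ "{0<..}" 0]
  by auto

text \<open>On the positive side every derivative of \<open>ell\<close> has the form P(1/t)
  exp(-1/t), and differentiating replaces P by x^2 (P - P'). Treating all P at once yields all
  orders.\<close>

lemma ell_poly_derivative:
  fixes P :: "real poly"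
  defines "e \<equiv> \<lambda>(P::real poly) t. if t \<le> 0 then 0 else poly P (1/t) * exp (-1/t)"
  shows "(e P has_real_derivative e ([:0,0,1:] * (P - pderiv P)) t) (at t)"
proof (cases t "0::real" rule: linorder_cases)
  case less
  have "((\<lambda>t. 0::real) has_real_derivative 0) (at t)" by simp
  moreover have "eventually (\<lambda>t. 0 = e P t) (nhds t)"
    using eventually_nhds_in_open[of "{..<0}" t] less by (auto elim!: eventually_mono simp: e_def)
  ultimately have "(e P has_real_derivative 0) (at t)"
    using DERIV_cong_ev[OF refl _ refl, of "\<lambda>t. 0" "e P" t 0] by simp
  thus ?thesis using less by (simp add: e_def)
next
  case greater
  have "((\<lambda>t. poly P (1/t) * exp (-1/t)) has_real_derivative
    poly ([:0,0,1:] * (P - pderiv P)) (1/t) * exp (-1/t)) (at t)"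
    using greater
    by (auto intro!: derivative_eq_intros DERIV_chain'[OF _ poly_DERIV] simp: field_simps power2_eq_square)
  moreover have "eventually (\<lambda>t. poly P (1/t) * exp (-1/t) = e P t) (nhds t)"
    using eventually_nhds_in_open[of "{0<..}" t] greater by (auto elim!: eventually_mono simp: e_def)
  ultimately have "(e P has_real_derivative poly ([:0,0,1:] * (P - pderiv P)) (1/t) * exp (-1/t)) (at t)"
    using DERIV_cong_ev[OF refl _ refl, of "\<lambda>t. poly P (1/t) * exp (-1/t)" "e P" t] by simp
  thus ?thesis using greater by (simp add: e_def)
next
  case equal
  have lim: "((\<lambda>x. poly Q x / exp x) \<longlongrightarrow> 0) at_top" for Q :: "real poly"
  proof -
    have "((\<lambda>x. \<Sum>i\<le>degree Q. coeff Q i * (x ^ i / exp x)) \<longlongrightarrow> (\<Sum>i\<le>degree Q. coeff Q i * 0)) at_top"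
      by (intro tendsto_intros tendsto_power_div_exp_0)
    thus ?thesis by (simp add: poly_altdef sum_divide_distrib)
  qed
  \<comment> \<open>With x = 1/t the difference quotient at 0 is x P(x) / exp x, a polynomial over
    an exponential.\<close>
  have "((\<lambda>t. poly ([:0,1:] * P) (inverse t) / exp (inverse t)) \<longlongrightarrow> 0) (at_right 0)"
    by (rule filterlim_compose[OF lim filterlim_inverse_at_top_right])
  hence R: "((\<lambda>t. e P t / t) \<longlongrightarrow> 0) (at_right 0)"
    by (rule Lim_transform_eventually)
      (auto simp: eventually_at_filter e_def exp_minus field_simps)
  have L: "((\<lambda>t. e P t / t) \<longlongrightarrow> 0) (at_left 0)"
    by (rule Lim_transform_eventually[of "\<lambda>t. 0"]) (auto simp: eventually_at_filter e_def)
  have "((\<lambda>t. e P t / t) \<longlongrightarrow> 0) (at 0)"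
    by (rule filterlim_split_at[OF L R])
  moreover have "e P 0 = 0" by (simp add: e_def)
  ultimately have "(e P has_real_derivative 0) (at 0)" by (simp add: DERIV_def)
  thus ?thesis using equal by (simp add: e_def)
qed

lemma smooth_real_ell:
  assumes U: "openR k U" and g: "smooth_real k U g"
  shows "smooth_real k U (\<lambda>x. ell (g x))"
proof -
  define e where "e = (\<lambda>(P::real poly) t. if t \<le> 0 then 0 else poly P (1/t) * exp (-1/t::real))"
  have D: "(e P has_real_derivative e ([:0,0,1:] * (P - pderiv P)) t) (at t)" for P t
    unfolding e_def by (rule ell_poly_derivative)
  have "ck p k U (\<lambda>x. e P (g x))" for p P
  proof (induction p arbitrary: P)
    case 0
    have "continuous_on UNIV (e P)" using D DERIV_isCont continuous_at_imp_continuous_on by blast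
    thus ?case using continuous_on_compose2[OF _ smooth_real_continuous[OF g], of UNIV "e P"] by simp
  next
    case (Suc p)
    let ?P = "[:0,0,1:] * (P - pderiv P)"
    have "has_pd i (\<lambda>x. e P (g x)) x (e ?P (g x) * pdir i g x)" if "i < k" "x \<in> U" for i x
      using DERIV_chain2[where g = "\<lambda>t. g (x(i := x i + t))" and x = 0 and s = UNIV, OF _ smooth_real_pd[OF g that, unfolded has_pd_def]]
        D[of P "g x"]
      by (simp add: has_pd_def)
    moreover have "ck p k U (\<lambda>x. e ?P (g x) * pdir i g x)" if "i < k" for i
      using Suc.IH smooth_real_pdir[OF g that] smooth_real_ck[OF U] by (intro ck_mult) auto
    moreover have "continuous_on U (\<lambda>x. e P (g x))" by (rule ck_continuous[OF Suc.IH])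
    ultimately show ?case unfolding ck.simps
      by (intro conjI allI impI exI[of _ "\<lambda>x. e ?P (g x) * pdir _ g x"] ballI)
  qed
  hence "smooth_real k U (\<lambda>x. e 1 (g x))" unfolding smooth_real_ck[OF U] by blast
  moreover have "e 1 t = ell t" for t by (simp add: ell_def e_def)
  ultimately show ?thesis by simp
qed

lemma ell_pos [simp]: "0 < ell t \<longleftrightarrow> 0 < t"
  by (simp add: ell_def)

lemma ell_nonneg [simp]: "0 \<le> ell t"
  by (simp add: ell_def)

lemma ell_eq_0 [simp]: "ell t = 0 \<longleftrightarrow> t \<le> 0"
  by (simp add: ell_def)

section \<open>Coefficients for the Seeley extension\<close>

text \<open>\<open>Z x = (\<Sum>k. zc k * x^k)\<close> satisfies \<open>Z (4 x) = (1 - 4 x) * Z x\<close>, so it vanishes at every \<open>4^p\<close>. Then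
  \<open>e x = (\<Sum>k. zc k / (1 + 4^k) * x^k)\<close> satisfies \<open>e (4 x) + e x = Z x\<close>, whence \<open>e (4^p) = (-1)^p * e 1\<close>.\<close>
primrec zc :: "nat \<Rightarrow> real" where
  "zc 0 = 1"
| "zc (Suc k) = - zc k * 4 / (4 ^ Suc k - 1)"

text \<open>Comparison of coefficients in \<open>Z (4 x) = (1 - 4 x) * Z x\<close>.\<close>

lemma zc_rec: "zc (Suc k) * 4 ^ Suc k = zc (Suc k) - 4 * zc k"
proof -
  have "(4::real) ^ Suc k > 1" by (rule one_less_power) auto
  thus ?thesis by (simp add: field_simps)
qed

lemma abs_zc_Suc: "\<bar>zc (Suc k)\<bar> = \<bar>zc k\<bar> * (4 / (4 ^ Suc k - 1))"
proof -
  have "(4::real) ^ Suc k > 1" by (rule one_less_power) auto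
  thus ?thesis by (simp add: abs_mult)
qed

lemma zc_summable:
  assumes "x \<ge> 0"
  shows "summable (\<lambda>k. \<bar>zc k\<bar> * x ^ k)"
proof -
  obtain n where n: "8 * x + 1 < 4 ^ n" using real_arch_pow[of 4 "8 * x + 1"] by auto
  show ?thesis
  proof (rule summable_ratio_test[of "1/2" n])
    fix k assume "n \<le> k"
    hence "(4::real) ^ n \<le> 4 ^ Suc k" by (intro power_increasing) auto
    hence "8 * x + 1 < 4 ^ Suc k" using n by linarith
    hence *: "4 / (4 ^ Suc k - 1) * x \<le> 1/2" using assms by (simp add: field_simps)
    have "\<bar>zc (Suc k)\<bar> * x ^ Suc k = (\<bar>zc k\<bar> * x ^ k) * (4 / (4 ^ Suc k - 1) * x)"
      by (simp add: abs_zc_Suc del: zc.simps)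
    also have "\<dots> \<le> (\<bar>zc k\<bar> * x ^ k) * (1/2)" by (rule mult_left_mono[OF *]) (use assms in auto)
    finally show "norm (\<bar>zc (Suc k)\<bar> * x ^ Suc k) \<le> 1/2 * norm (\<bar>zc k\<bar> * x ^ k)" using assms by (simp del: zc.simps)
  qed simp
qed

lemma zc_summable': "x \<ge> 0 \<Longrightarrow> summable (\<lambda>k. zc k * x ^ k)"
  using zc_summable[of x] by (rule_tac summable_rabs_cancel) (simp add: abs_mult power_abs)

lemma zc_sum_pow4: "(\<Sum>k. zc k * (4 ^ p) ^ k) = 0"
proof -
  have eq: "(\<Sum>k. zc k * (4 * y) ^ k) = (1 - 4 * y) * (\<Sum>k. zc k * y ^ k)" if "y \<ge> 0" for y
  proof -
    have S: "summable (\<lambda>k. zc k * y ^ k)" by (rule zc_summable'[OF that])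
    have S4: "summable (\<lambda>k. zc k * (4 * y) ^ k)" by (rule zc_summable') (use that in auto)
    have "(\<Sum>k. zc k * (4 * y) ^ k) = 1 + (\<Sum>k. zc (Suc k) * (4 * y) ^ Suc k)"
      using suminf_split_head[OF S4] by simp
    also have "(\<lambda>k. zc (Suc k) * (4 * y) ^ Suc k) = (\<lambda>k. zc (Suc k) * y ^ Suc k - 4 * y * (zc k * y ^ k))"
    proof
      fix k
      have "zc (Suc k) * (4 * y) ^ Suc k = (zc (Suc k) * 4 ^ Suc k) * y ^ Suc k"
        by (simp only: power_mult_distrib mult_ac)
      also have "\<dots> = zc (Suc k) * y ^ Suc k - 4 * y * (zc k * y ^ k)"
        unfolding zc_rec by (simp add: algebra_simps)
      finally show "zc (Suc k) * (4 * y) ^ Suc k = zc (Suc k) * y ^ Suc k - 4 * y * (zc k * y ^ k)" .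
    qed
    also have "(\<Sum>k. zc (Suc k) * y ^ Suc k - 4 * y * (zc k * y ^ k))
      = (\<Sum>k. zc (Suc k) * y ^ Suc k) - (\<Sum>k. 4 * y * (zc k * y ^ k))"
      by (rule suminf_diff[symmetric, OF iffD2[OF summable_Suc_iff S] summable_mult[OF S]])
    also have "(\<Sum>k. zc (Suc k) * y ^ Suc k) = (\<Sum>k. zc k * y ^ k) - 1"
      using suminf_split_head[OF S] by simp
    also have "(\<Sum>k. 4 * y * (zc k * y ^ k)) = 4 * y * (\<Sum>k. zc k * y ^ k)"
      by (rule suminf_mult[OF S])
    finally show ?thesis by (simp add: algebra_simps)
  qed
  show ?thesis
  proof (induction p)
    \<comment> \<open>At y = 1/4 the factor 1 - 4 y is zero. This gives the zero at 1, from which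
      those at higher powers of 4 are inherited.\<close>
    case 0 show ?case using eq[of "1/4"] by simp
  next
    case (Suc p) thus ?case using eq[of "4 ^ p"] by simp
  qed
qed

text \<open>Needed to normalise by \<open>e 1\<close>. The first two terms give 1/2 - 4/15 = 7/30;
  the tail is dominated by a geometric series, starting from |zc 2| = 16/45 over the denominator 1 +
  4^2 = 17, and is too small to cancel them.\<close>

lemma zc_weighted_pos: "(\<Sum>k. zc k / (1 + 4 ^ k)) > 0"
proof -
  have le: "\<bar>zc k / (1 + 4 ^ k)\<bar> \<le> \<bar>zc k\<bar>" for k
    by (simp add: abs_divide divide_le_eq add_pos_nonneg mult_le_cancel_left1)
  have S: "summable (\<lambda>k. zc k / (1 + 4 ^ k))"
    by (rule summable_comparison_test[OF _ zc_summable[of 1]]) (use le in auto)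
  have b: "\<bar>zc (k + 2)\<bar> \<le> 16/45 * (1/2) ^ k" for k
  proof (induction k)
    case 0 show ?case by (simp add: numeral_2_eq_2)
  next
    case (Suc k)
    have "(4::real) ^ 2 \<le> 4 ^ Suc (k + 2)" by (intro power_increasing) auto
    hence "4 / (4 ^ Suc (k + 2) - 1) \<le> (1/2::real)" by (simp add: field_simps)
    hence "\<bar>zc (k + 2)\<bar> * (4 / (4 ^ Suc (k + 2) - 1)) \<le> \<bar>zc (k + 2)\<bar> * (1/2)"
      by (intro mult_left_mono) auto
    also have "\<dots> \<le> (16/45 * (1/2) ^ k) * (1/2)" by (rule mult_right_mono[OF Suc]) simp
    also have "\<dots> = 16/45 * (1/2) ^ Suc k" by simp
    finally have "\<bar>zc (Suc (k + 2))\<bar> \<le> 16/45 * (1/2) ^ Suc k" by (simp only: abs_zc_Suc)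
    thus ?case by simp
  qed
  have t: "- (zc (k + 2) / (1 + 4 ^ (k + 2))) \<le> 16/45/17 * (1/2) ^ k" for k
  proof -
    have "(4::real) ^ 2 \<le> 4 ^ (k + 2)" by (intro power_increasing) auto
    hence "17 \<le> (1 + 4 ^ (k + 2) :: real)" by simp
    hence "\<bar>zc (k + 2) / (1 + 4 ^ (k + 2))\<bar> \<le> (16/45 * (1/2) ^ k) / 17"
      unfolding abs_divide by (intro frac_le b) auto
    thus ?thesis by linarith
  qed
  have S2: "summable (\<lambda>k. zc (k + 2) / (1 + 4 ^ (k + 2)))" using S by (rule summable_ignore_initial_segment)
  have geo: "summable (\<lambda>k. (1/2::real) ^ k)" "(\<Sum>k. (1/2::real) ^ k) = 2"
    using suminf_geometric[of "1/2::real"] by (auto intro: summable_geometric)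
  have "(\<Sum>k. - (zc (k + 2) / (1 + 4 ^ (k + 2)))) \<le> (\<Sum>k. 16/45/17 * (1/2::real) ^ k)"
    by (rule suminf_le[OF t summable_minus[OF S2] summable_mult[OF geo(1)]])
  also have "\<dots> = 16/45/17 * 2" using suminf_mult[OF geo(1), of "16/45/17"] geo(2) by simp
  finally have "- (\<Sum>k. zc (k + 2) / (1 + 4 ^ (k + 2))) \<le> 16/45/17 * 2" using suminf_minus[OF S2] by simp
  moreover have "(\<Sum>k. zc k / (1 + 4 ^ k)) = (\<Sum>k. zc (k + 2) / (1 + 4 ^ (k + 2))) + (\<Sum>k<2. zc k / (1 + 4 ^ k))"
    by (rule suminf_split_initial_segment[OF S])
  moreover have "(\<Sum>k<2. zc k / (1 + 4 ^ k)) = 1/2 - 4/15" by (simp add: numeral_2_eq_2)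
  ultimately show ?thesis by linarith
qed

text \<open>After division by \<open>e 1\<close> the moment of order p is (-1)^p e(4^p) / e(1), and
  the two alternating signs cancel. Absolute convergence against every power of 4^k pays for
  arbitrarily many normal derivatives.\<close>

lemma seeley_coefficients:
  "\<exists>a::nat \<Rightarrow> real. (\<forall>p. summable (\<lambda>k. \<bar>a k\<bar> * (4 ^ k) ^ p)) \<and> (\<forall>p. (\<Sum>k. a k * (-(4 ^ k)) ^ p) = 1)"
proof -
  define e where "e x = (\<Sum>k. zc k / (1 + 4 ^ k) * x ^ k)" for x :: real
  have S: "summable (\<lambda>k. \<bar>zc k / (1 + 4 ^ k)\<bar> * x ^ k)" if "x \<ge> 0" for x
  proof (rule summable_comparison_test[OF _ zc_summable[OF that]])
    have "\<bar>zc k / (1 + 4 ^ k)\<bar> \<le> \<bar>zc k\<bar>" for k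
      by (simp add: abs_divide divide_le_eq add_pos_nonneg mult_le_cancel_left1)
    thus "\<exists>N. \<forall>n\<ge>N. norm (\<bar>zc n / (1 + 4 ^ n)\<bar> * x ^ n) \<le> \<bar>zc n\<bar> * x ^ n"
      using that by (auto simp only: real_norm_def abs_mult abs_abs power_abs[symmetric] abs_of_nonneg[OF zero_le_power[OF that]] intro!: mult_right_mono zero_le_power)
  qed
  have S': "summable (\<lambda>k. zc k / (1 + 4 ^ k) * x ^ k)" if "x \<ge> 0" for x
    using S[OF that] that by (rule_tac summable_rabs_cancel) (simp add: abs_mult power_abs)
  have step: "e (4 ^ Suc p) = - e (4 ^ p)" for p
  proof -
    have "e (4 * 4 ^ p) + e (4 ^ p) = (\<Sum>k. zc k / (1 + 4 ^ k) * (4 * 4 ^ p) ^ k + zc k / (1 + 4 ^ k) * (4 ^ p) ^ k)"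
      unfolding e_def by (rule suminf_add[OF S' S']) auto
    also have "\<dots> = (\<Sum>k. zc k * (4 ^ p) ^ k)"
    proof (rule suminf_cong)
      fix k
      have "(1 + 4 ^ k :: real) \<noteq> 0" by (metis add_pos_pos less_irrefl zero_less_numeral zero_less_one zero_less_power)
      hence "zc k / (1 + 4 ^ k) * (4 ^ k + 1) = zc k" by (simp add: field_simps)
      hence "(zc k / (1 + 4 ^ k) * (4 ^ k + 1)) * (4 ^ p) ^ k = zc k * (4 ^ p) ^ k" by (simp only:)
      moreover have "A * (4 * 4 ^ p) ^ k + A * (4 ^ p) ^ k = (A * (4 ^ k + 1)) * (4 ^ p) ^ k" for A :: real
        unfolding power_mult_distrib by (simp add: algebra_simps)
      ultimately show "zc k / (1 + 4 ^ k) * (4 * 4 ^ p) ^ k + zc k / (1 + 4 ^ k) * (4 ^ p) ^ k = zc k * (4 ^ p) ^ k"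
        by (simp only:)
    qed
    finally show ?thesis using zc_sum_pow4[of p] by simp
  qed
  have e1: "e 1 > 0" using zc_weighted_pos by (simp add: e_def)
  have ep: "e (4 ^ p) = (-1) ^ p * e 1" for p
    by (induction p) (use step in auto)
  define a where "a k = zc k / (1 + 4 ^ k) / e 1" for k
  have "summable (\<lambda>k. \<bar>a k\<bar> * (4 ^ k) ^ p)" for p
  proof -
    have "summable (\<lambda>k. \<bar>zc k / (1 + 4 ^ k)\<bar> * (4 ^ p) ^ k / e 1)"
      by (rule summable_divide[OF S]) simp
    moreover have "\<bar>a k\<bar> * (4 ^ k) ^ p = \<bar>zc k / (1 + 4 ^ k)\<bar> * (4 ^ p) ^ k / e 1" for k
      using e1 by (simp add: a_def abs_divide power_mult[symmetric] mult.commute)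
    ultimately show ?thesis by simp
  qed
  moreover have "(\<Sum>k. a k * (-(4 ^ k)) ^ p) = 1" for p
  proof -
    have "a k * (-(4 ^ k)) ^ p = ((-1) ^ p / e 1) * (zc k / (1 + 4 ^ k) * (4 ^ p) ^ k)" for k
    proof -
      have "(-(4 ^ k)) ^ p = (-1) ^ p * ((4::real) ^ p) ^ k"
        by (subst power_minus) (simp add: power_mult[symmetric] mult.commute)
      thus ?thesis by (simp add: a_def mult.commute mult.left_commute)
    qed
    hence "(\<Sum>k. a k * (-(4 ^ k)) ^ p) = ((-1) ^ p / e 1) * e (4 ^ p)"
      unfolding e_def[of "4 ^ p"] by (simp only: suminf_mult[OF S'] zero_le_power zero_le_numeral)
    also have "\<dots> = 1" using e1 ep[of p] by (simp flip: power_mult_distrib mult.assoc)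
    finally show ?thesis .
  qed
  ultimately show ?thesis by blast
qed

text \<open>By the mean value theorem on either side, difference quotients at \<open>a\<close> are
  values of \<open>\<psi>\<close> at points squeezed towards \<open>a\<close>. This yields the
  derivative on the boundary, where the two branches of an extension meet.\<close>

lemma removable_derivative:
  fixes \<phi> \<psi> :: "real \<Rightarrow> real"
  assumes c: "continuous_on UNIV \<phi>" and D: "\<And>s. s \<noteq> a \<Longrightarrow> (\<phi> has_real_derivative \<psi> s) (at s)"
    and \<psi>: "isCont \<psi> a"
  shows "(\<phi> has_real_derivative \<psi> a) (at a)"
proof -
  have diff: "\<phi> differentiable (at s)" if "s \<noteq> a" for s
    using D[OF that] real_differentiable_def by blast
  have "\<exists>\<xi>. \<bar>\<xi> - a\<bar> \<le> \<bar>x - a\<bar> \<and> (\<phi> x - \<phi> a) / (x - a) = \<psi> \<xi>" if "x \<noteq> a" for x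
  proof (cases "a < x")
    case True
    have "\<exists>l z. a < z \<and> z < x \<and> DERIV \<phi> z :> l \<and> \<phi> x - \<phi> a = (x - a) * l"
      by (rule MVT[OF True continuous_on_subset[OF c]])
        (use diff in auto)
    then obtain l z where z: "a < z" "z < x" "DERIV \<phi> z :> l" "\<phi> x - \<phi> a = (x - a) * l" by blast
    hence "l = \<psi> z" using D[of z] DERIV_unique by auto
    thus ?thesis using z by (intro exI[of _ z]) auto
  next
    case False
    hence xa: "x < a" using that by auto
    have "\<exists>l z. x < z \<and> z < a \<and> DERIV \<phi> z :> l \<and> \<phi> a - \<phi> x = (a - x) * l"
      by (rule MVT[OF xa continuous_on_subset[OF c]])
        (use diff in auto)
    then obtain l z where z: "x < z" "z < a" "DERIV \<phi> z :> l" "\<phi> a - \<phi> x = (a - x) * l" by blast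
    hence "l = \<psi> z" using D[of z] DERIV_unique by auto
    thus ?thesis using z xa by (intro exI[of _ z]) (auto simp: field_simps)
  qed
  then obtain \<xi> where \<xi>: "\<And>x. x \<noteq> a \<Longrightarrow> \<bar>\<xi> x - a\<bar> \<le> \<bar>x - a\<bar>"
    "\<And>x. x \<noteq> a \<Longrightarrow> (\<phi> x - \<phi> a) / (x - a) = \<psi> (\<xi> x)" by metis
  have "((\<lambda>x. \<xi> x - a) \<longlongrightarrow> 0) (at a)"
  proof (rule Lim_null_comparison)
    show "eventually (\<lambda>x. norm (\<xi> x - a) \<le> \<bar>x - a\<bar>) (at a)"
      using \<xi>(1) by (auto simp: eventually_at_filter)
    have "((\<lambda>x. \<bar>x - a\<bar>) \<longlongrightarrow> \<bar>a - a\<bar>) (at a)" by (intro tendsto_intros)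
    thus "((\<lambda>x. \<bar>x - a\<bar>) \<longlongrightarrow> 0) (at a)" by simp
  qed
  hence "(\<xi> \<longlongrightarrow> a) (at a)" by (simp add: LIM_zero_iff)
  hence "((\<lambda>x. \<psi> (\<xi> x)) \<longlongrightarrow> \<psi> a) (at a)" by (rule isCont_tendsto_compose[OF \<psi>])
  hence "((\<lambda>x. (\<phi> x - \<phi> a) / (x - a)) \<longlongrightarrow> \<psi> a) (at a)"
    by (rule Lim_transform_eventually) (use \<xi>(2) in \<open>auto simp: eventually_at_filter\<close>)
  thus ?thesis by (simp add: has_field_derivative_iff)
qed

section \<open>Smooth functions on a half space\<close>

lemma smooth_map_subset: "smooth_map k U l F \<Longrightarrow> V \<subseteq> U \<Longrightarrow> smooth_map k V l F"
  using smooth_real_subset by (auto simp: smooth_map_def)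

lemma smooth_map_coord: "openR k U \<Longrightarrow> smooth_map k U l F \<Longrightarrow> smooth_real k U (\<lambda>x. F x j)"
proof (cases "j < l")
  case False
  assume *: "openR k U" "smooth_map k U l F"
  show ?thesis
    by (rule smooth_real_cong[OF *(1) smooth_real_const[OF *(1), of 0]])
      (use False * in \<open>auto simp: smooth_map_def Rk_beyond\<close>)
qed (auto simp: smooth_map_def)

lemma smooth_map_upd:
  assumes "openR k U" "smooth_map k U l F" "smooth_real k U g" "i < l'" "l \<le> Suc i" "l \<le> l'"
  shows "smooth_map k U l' (\<lambda>x. (F x)(i := g x))"
  unfolding smooth_map_def
proof (intro conjI ballI allI impI)
  fix x assume "x \<in> U"
  thus "(F x)(i := g x) \<in> Rk l'" using assms by (auto simp: smooth_map_def Rk_def)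
next
  fix j
  show "smooth_real k U (\<lambda>x. ((F x)(i := g x)) j)"
    using assms smooth_map_coord[OF assms(1,2)] by (cases "j = i") auto
qed

lemma smooth_map_upd_add:
  assumes "openR k U" "smooth_map k U l F" "smooth_real k U g" "i < l"
  shows "smooth_map k U l (\<lambda>x. (F x)(i := F x i + g x))"
  unfolding smooth_map_def
proof (intro conjI ballI allI impI)
  fix x assume "x \<in> U"
  thus "(F x)(i := F x i + g x) \<in> Rk l" using assms by (auto simp: smooth_map_def Rk_def)
next
  fix j
  show "smooth_real k U (\<lambda>x. ((F x)(i := F x i + g x)) j)"
    using assms smooth_map_coord[OF assms(1,2)] by (cases "j = i") (auto intro: smooth_real_add)
qed

text \<open>As \<open>Rk k\<close> is literally contained in \<open>Rk (Suc k)\<close>, a product with a line is formed by freeing the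
  coordinate \<open>k\<close>.\<close>
definition cyl :: "nat \<Rightarrow> rvec set \<Rightarrow> rvec set" where
  "cyl k W = {z \<in> Rk (Suc k). z(k := 0) \<in> W}"

lemma smooth_map_drop: "openR (Suc k) U \<Longrightarrow> smooth_map (Suc k) U k (\<lambda>z. z(k := 0))"
proof -
  assume U: "openR (Suc k) U"
  have "smooth_real (Suc k) U (\<lambda>z. (z(k := 0)) j)" if "j < k" for j
    using smooth_real_coord[OF U, of j] that by simp
  moreover have "z(k := 0) \<in> Rk k" if "z \<in> U" for z
  proof -
    have "z \<in> Rk (Suc k)" using openR_subset[OF U] that by auto
    thus ?thesis by (auto simp: Rk_def Suc_le_eq)
  qed
  ultimately show ?thesis by (simp add: smooth_map_def)
qed

lemma openR_cyl: "openR k W \<Longrightarrow> openR (Suc k) (cyl k W)"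
  using openR_vimage_R[OF openR_Rk smooth_map_continuous[OF smooth_map_drop[OF openR_Rk]], of k W k]
    smooth_map_drop[OF openR_Rk, of k] unfolding cyl_def by (auto simp: smooth_map_def)

lemma Rk_upd_self: "y \<in> Rk k \<Longrightarrow> y(k := 0) = y"
  by (auto simp: Rk_def)

lemma cyl_upd: "z \<in> cyl k W \<Longrightarrow> z(k := t) \<in> cyl k W"
  by (auto simp: cyl_def Rk_def)

lemma subset_cyl: "openR k W \<Longrightarrow> W \<subseteq> cyl k W"
  using openR_subset[of k W] Rk_upd_self Rk_mono[of k "Suc k"] by (fastforce simp: cyl_def)

lemma smooth_real_base:
  assumes "smooth_real l V g" "openR l V"
  shows "smooth_real (Suc l) (cyl l V) (\<lambda>z. g (z(l := 0)))"
proof (rule smooth_real_compose[OF openR_cyl[OF assms(2)] assms(2) smooth_map_drop[OF openR_cyl[OF assms(2)]] _ assms(1)])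
  show "(\<lambda>z. z(l := 0)) ` cyl l V \<subseteq> V" unfolding cyl_def by blast
qed

lemma smooth_map_base:
  assumes "smooth_map l V k F" "openR l V"
  shows "smooth_map (Suc l) (cyl l V) k (\<lambda>z. F (z(l := 0)))"
  using assms smooth_real_base[of l V "\<lambda>x. F x j" for j] unfolding smooth_map_def by (simp add: cyl_def)

text \<open>A function on the half space \<open>[0,\<infinity>) \<times> W\<close> is only tested along plots; the boundary
  regularity in the usual sense is a consequence.\<close>
definition halfsmooth :: "nat \<Rightarrow> rvec set \<Rightarrow> (real \<Rightarrow> rvec \<Rightarrow> real) \<Rightarrow> bool" where
  "halfsmooth k W f \<longleftrightarrow> (\<forall>l V \<sigma> \<omega>. openR l V \<and> smooth_real l V \<sigma> \<and> smooth_map l V k \<omega> \<and>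
     (\<forall>y\<in>V. 0 \<le> \<sigma> y \<and> \<omega> y \<in> W) \<longrightarrow> smooth_real l V (\<lambda>y. f (\<sigma> y) (\<omega> y)))"

lemma halfsmoothD:
  "halfsmooth k W f \<Longrightarrow> openR l V \<Longrightarrow> smooth_real l V \<sigma> \<Longrightarrow> smooth_map l V k \<omega> \<Longrightarrow>
    (\<And>y. y \<in> V \<Longrightarrow> 0 \<le> \<sigma> y) \<Longrightarrow> (\<And>y. y \<in> V \<Longrightarrow> \<omega> y \<in> W) \<Longrightarrow> smooth_real l V (\<lambda>y. f (\<sigma> y) (\<omega> y))"
  unfolding halfsmooth_def by blast

text \<open>A plot with one more parameter, shifting \<open>\<omega>\<close> in direction
  \<open>i\<close>, is again admissible. Differentiating in the fresh coordinate \<open>l\<close>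
  and restricting to its zero slice gives the claim.\<close>

lemma halfsmooth_pdir:
  assumes W: "openR k W" and f: "halfsmooth k W f" and i: "i < k"
  shows "halfsmooth k W (\<lambda>s. pdir i (f s))"
  unfolding halfsmooth_def
proof (intro allI impI, elim conjE)
  fix l V \<sigma> \<omega>
  assume V: "openR l V" and \<sigma>: "smooth_real l V \<sigma>" and \<omega>: "smooth_map l V k \<omega>"
    and r: "\<forall>y\<in>V. 0 \<le> \<sigma> y \<and> \<omega> y \<in> W"
  let ?\<omega> = "\<lambda>z. (\<omega> (z(l := 0)))(i := \<omega> (z(l := 0)) i + z l)"
  note cV = openR_cyl[OF V]
  have s\<omega>: "smooth_map (Suc l) (cyl l V) k ?\<omega>"
    by (rule smooth_map_upd_add[OF cV smooth_map_base[OF \<omega> V] smooth_real_coord[OF cV] i])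
  \<comment> \<open>The shift must keep the base point in \<open>W\<close>, so the domain is cut
    down; it still contains the slice \<open>V\<close>.\<close>
  define V' where "V' = {z \<in> cyl l V. ?\<omega> z \<in> W}"
  have V': "openR (Suc l) V'" unfolding V'_def
    by (rule openR_vimage_R[OF cV smooth_map_continuous[OF s\<omega>] W])
      (use s\<omega> in \<open>auto simp: smooth_map_def\<close>)
  let ?F = "\<lambda>z. f (\<sigma> (z(l := 0))) (?\<omega> z)"
  have "smooth_real (Suc l) V' ?F"
  proof (rule halfsmoothD[OF f V', where \<sigma> = "\<lambda>z. \<sigma> (z(l := 0))" and \<omega> = ?\<omega>])
    show "smooth_real (Suc l) V' (\<lambda>z. \<sigma> (z(l := 0)))"
      by (rule smooth_real_subset[OF smooth_real_base[OF \<sigma> V]]) (simp add: V'_def)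
    show "smooth_map (Suc l) V' k ?\<omega>"
      by (rule smooth_map_subset[OF s\<omega>]) (auto simp: V'_def)
  qed (use r in \<open>auto simp: V'_def cyl_def\<close>)
  hence "smooth_real (Suc l) V' (pdir l ?F)" by (rule smooth_real_pdir) simp
  hence "smooth_real l V' (pdir l ?F)" by (rule smooth_real_lower) simp
  moreover have VV': "V \<subseteq> V'"
  proof
    fix y assume y: "y \<in> V"
    hence "y \<in> Rk l" using openR_subset[OF V] by auto
    thus "y \<in> V'" using y r subset_cyl[OF V] by (auto simp: V'_def Rk_upd_self Rk_beyond)
  qed
  ultimately have "smooth_real l V (pdir l ?F)" by (rule smooth_real_subset)
  moreover have "pdir l ?F y = pdir i (f (\<sigma> y)) (\<omega> y)" if "y \<in> V" for y
  proof -
    have y: "y \<in> Rk l" using openR_subset[OF V] that by auto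
    thus ?thesis by (simp add: pdir_def Rk_upd_self Rk_beyond)
  qed
  ultimately show "smooth_real l V (\<lambda>y. pdir i (f (\<sigma> y)) (\<omega> y))"
    by (rule smooth_real_cong[OF V])
qed

text \<open>Both derivatives are taken at 0, with \<open>t + t'\<close> inside the square, so that
  the nested expression is what two applications of \<open>pdir\<close> to a plot with a fresh
  coordinate unfold to.\<close>

definition ds :: "(real \<Rightarrow> rvec \<Rightarrow> real) \<Rightarrow> real \<Rightarrow> rvec \<Rightarrow> real" where
  "ds f s w = deriv (\<lambda>t. deriv (\<lambda>t'. f (s + (t + t')^2) w) 0) 0 / 2"

text \<open>The second derivative of \<open>t \<mapsto> f (s + t\<^sup>2)\<close> at \<open>0\<close> is \<open>2 f' s\<close>, and it only involves plots
  of the half space, even at boundary points.\<close>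
lemma halfsmooth_ds:
  assumes f: "halfsmooth k W f"
  shows "halfsmooth k W (ds f)"
  unfolding halfsmooth_def
proof (intro allI impI, elim conjE)
  fix l V \<sigma> \<omega>
  assume V: "openR l V" and \<sigma>: "smooth_real l V \<sigma>" and \<omega>: "smooth_map l V k \<omega>"
    and r: "\<forall>y\<in>V. 0 \<le> \<sigma> y \<and> \<omega> y \<in> W"
  note cV = openR_cyl[OF V]
  let ?F = "\<lambda>z. f (\<sigma> (z(l := 0)) + (z l)^2) (\<omega> (z(l := 0)))"
  have "smooth_real (Suc l) (cyl l V) ?F"
  proof (rule halfsmoothD[OF f cV, where \<sigma> = "\<lambda>z. \<sigma> (z(l := 0)) + (z l)^2" and \<omega> = "\<lambda>z. \<omega> (z(l := 0))"])
    show "smooth_real (Suc l) (cyl l V) (\<lambda>z. \<sigma> (z(l := 0)) + (z l)^2)"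
      by (intro smooth_real_add smooth_real_power smooth_real_coord smooth_real_base[OF \<sigma> V] cV)
    show "smooth_map (Suc l) (cyl l V) k (\<lambda>z. \<omega> (z(l := 0)))" by (rule smooth_map_base[OF \<omega> V])
  qed (use r in \<open>auto simp: cyl_def\<close>)
  hence "smooth_real (Suc l) (cyl l V) (pdir l (pdir l ?F))" by (intro smooth_real_pdir) simp_all
  hence "smooth_real l (cyl l V) (pdir l (pdir l ?F))" by (rule smooth_real_lower) simp
  hence "smooth_real l V (pdir l (pdir l ?F))" by (rule smooth_real_subset[OF _ subset_cyl[OF V]])
  hence "smooth_real l V (\<lambda>y. pdir l (pdir l ?F) y / 2)"
    using V by (intro smooth_real_divide smooth_real_const) auto
  moreover have "pdir l (pdir l ?F) y / 2 = ds f (\<sigma> y) (\<omega> y)" if "y \<in> V" for y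
  proof -
    have y: "y \<in> Rk l" using openR_subset[OF V] that by auto
    thus ?thesis by (simp add: pdir_def Rk_upd_self Rk_beyond ds_def)
  qed
  ultimately show "smooth_real l V (\<lambda>y. ds f (\<sigma> y) (\<omega> y))"
    by (rule smooth_real_cong[OF V])
qed

lemma smooth_map_const: "openR l V \<Longrightarrow> w \<in> Rk k \<Longrightarrow> smooth_map l V k (\<lambda>y. w)"
  by (simp add: smooth_map_def smooth_real_const)

lemma halfsmooth_section:
  assumes "openR k W" "halfsmooth k W f" "s \<ge> 0"
  shows "smooth_real k W (f s)"
  by (rule halfsmoothD[OF assms(2,1), where \<sigma> = "\<lambda>y. s" and \<omega> = "\<lambda>y. y"])
    (use assms in \<open>auto intro: smooth_real_const smooth_map_id\<close>)

text \<open>Away from the boundary the inner derivative in \<open>ds\<close> is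
  \<open>2 * t * c' (s + t^2)\<close> for the ordinary derivative \<open>c'\<close>. Its difference
  quotient at 0 is \<open>2 * c' (s + t^2)\<close>, so continuity of \<open>c'\<close> replaces a
  second derivative.\<close>

lemma halfsmooth_ds_derivative:
  assumes W: "openR k W" and f: "halfsmooth k W f" and s: "s > 0" and w: "w \<in> W"
  shows "((\<lambda>s. f s w) has_real_derivative ds f s w) (at s)"
proof -
  let ?P = "{y \<in> Rk 1. y 0 > (0::real)}"
  have P: "openR 1 ?P" using openR_half by simp
  have S: "smooth_real 1 ?P (\<lambda>y. f (y 0) w)"
    by (rule halfsmoothD[OF f P, where \<sigma> = "\<lambda>y. y 0" and \<omega> = "\<lambda>y. w"])
      (use w openR_subset[OF W] P in \<open>auto intro!: smooth_real_coord smooth_map_const\<close>)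
  let ?pt = "\<lambda>s. (\<lambda>_::nat. 0::real)(0 := s::real)"
  have pt: "?pt s \<in> ?P \<longleftrightarrow> 0 < s" for s by (auto simp: Rk_def)
  define c' where "c' s = pdir 0 (\<lambda>y. f (y 0) w) (?pt s)" for s
  have D: "((\<lambda>s. f s w) has_real_derivative c' s) (at s)" if "s > 0" for s
  proof -
    have "has_pd 0 (\<lambda>y. f (y 0) w) (?pt s) (c' s)" unfolding c'_def
      by (rule smooth_real_pd[OF S]) (use that pt in auto)
    hence "((\<lambda>h. f (h + s) w) has_real_derivative c' s) (at 0)"
      by (simp add: has_pd_def add.commute)
    hence "((\<lambda>s. f s w) has_real_derivative c' s) (at (0 + s))"
      by (simp only: DERIV_shift[of _ _ 0 s])
    thus ?thesis by simp
  qed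
  have "continuous_on ?P (pdir 0 (\<lambda>y. f (y 0) w))"
    using smooth_real_continuous[OF smooth_real_pdir[OF S]] by simp
  hence "continuous_on {0<..} c'" unfolding c'_def[abs_def]
  proof (rule continuous_on_compose2)
    show "continuous_on {0<..} ?pt"
      using continuous_on_upd[OF continuous_on_const continuous_on_id, of "{0<..}" "\<lambda>_. 0" 0] by simp
    show "?pt ` {0<..} \<subseteq> ?P" using pt by blast
  qed
  hence c: "isCont c' s" using s by (simp add: continuous_on_eq_continuous_at)
  have "deriv (\<lambda>t'. f (s + (t + t')^2) w) 0 = 2 * t * c' (s + t^2)" for t
  proof (rule DERIV_imp_deriv)
    have pos: "s + t^2 > 0" using s by (simp add: add_pos_nonneg)
    have "((\<lambda>t'. s + (t + t')^2) has_real_derivative 2 * t) (at 0)"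
      by (auto intro!: derivative_eq_intros)
    moreover have "((\<lambda>s. f s w) has_real_derivative c' (s + t^2)) (at (s + (t + 0)^2))"
      using D[OF pos] by simp
    ultimately have "((\<lambda>t'. f (s + (t + t')^2) w) has_real_derivative c' (s + t^2) * (2 * t)) (at 0)"
      by (rule DERIV_chain2[where f = "\<lambda>s. f s w" and g = "\<lambda>t'. s + (t + t')^2", rotated])
    thus "((\<lambda>t'. f (s + (t + t')^2) w) has_real_derivative 2 * t * c' (s + t^2)) (at 0)"
      by (simp add: mult.commute)
  qed
  moreover have "((\<lambda>t. 2 * t * c' (s + t^2)) has_real_derivative 2 * c' s) (at 0)"
  proof -
    have "((\<lambda>t. 2 * c' (s + t^2)) \<longlongrightarrow> 2 * c' s) (at 0)"
    proof (intro tendsto_mult tendsto_const isCont_tendsto_compose[OF c])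
      have "((\<lambda>t. s + t^2) \<longlongrightarrow> s + 0^2) (at 0)" by (intro tendsto_intros)
      thus "((\<lambda>t. s + t^2) \<longlongrightarrow> s) (at 0)" by simp
    qed
    hence "((\<lambda>t. (2 * t * c' (s + t^2)) / t) \<longlongrightarrow> 2 * c' s) (at 0)"
      by (rule Lim_transform_eventually) (auto simp: eventually_at_filter)
    thus ?thesis by (simp add: DERIV_def)
  qed
  ultimately have "ds f s w = c' s" unfolding ds_def by (simp add: DERIV_imp_deriv)
  thus ?thesis using D[OF s] by simp
qed

text \<open>\<open>f\<close> can be tested only along plots with nonnegative first argument.
  Squaring the coordinate \<open>k\<close> makes one, and composing with \<open>sqrt\<close>
  afterwards undoes it, which costs smoothness but keeps continuity.\<close>

lemma halfsmooth_continuous: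
  assumes W: "openR k W" and f: "halfsmooth k W f"
  shows "continuous_on {z \<in> cyl k W. z k \<ge> 0} (\<lambda>z. f (z k) (z(k := 0)))"
proof -
  let ?\<Phi> = "\<lambda>z. f ((z k)^2) (z(k := 0))"
  note cW = openR_cyl[OF W]
  have "smooth_real (Suc k) (cyl k W) ?\<Phi>"
    by (rule halfsmoothD[OF f cW, where \<sigma> = "\<lambda>z. (z k)^2" and \<omega> = "\<lambda>z. z(k := 0)"])
      (intro smooth_real_power smooth_real_coord cW smooth_map_drop | simp add: cyl_def)+
  hence "continuous_on (cyl k W) ?\<Phi>" by (rule smooth_real_continuous)
  hence "continuous_on {z \<in> cyl k W. z k \<ge> 0} (\<lambda>z. ?\<Phi> (z(k := sqrt (z k))))"
  proof (rule continuous_on_compose2)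
    show "continuous_on {z \<in> cyl k W. z k \<ge> 0} (\<lambda>z. z(k := sqrt (z k)))"
      by (intro continuous_on_upd continuous_on_real_sqrt continuous_on_id
        continuous_on_subset[OF continuous_on_product_coordinates]) auto
    show "(\<lambda>z. z(k := sqrt (z k))) ` {z \<in> cyl k W. z k \<ge> 0} \<subseteq> cyl k W"
      using cyl_upd by blast
  qed
  thus ?thesis by (rule continuous_on_eq) auto
qed

section \<open>The Seeley extension\<close>

lemma DERIV_transform_ev:
  fixes f g :: "real \<Rightarrow> real"
  assumes "(f has_real_derivative u) (at x)" "u = v" "eventually (\<lambda>x. f x = g x) (nhds x)"
  shows "(g has_real_derivative v) (at x)"
  using DERIV_cong_ev[OF refl assms(3,2)] assms(1) by blast

lemma compact_Rk_cball:
  assumes c: "c \<in> Rk k"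
  shows "compact {w \<in> Rk k. (\<Sum>i<k. (w i - c i)^2) \<le> r^2}" (is "compact ?K")
proof -
  let ?B = "PiE UNIV (\<lambda>i::nat. {c i - \<bar>r\<bar>..c i + \<bar>r\<bar>})"
  have "compactin (product_topology (\<lambda>i::nat. euclidean::real topology) UNIV) ?B"
    by (simp add: compactin_PiE)
  hence "compact ?B" by (simp add: euclidean_product_topology)
  moreover have K: "closed ?K"
  proof -
    have "closed (Rk k)"
    proof -
      have "Rk k = (\<Inter>i\<in>{k..}. {x. x i = 0})" by (auto simp: Rk_def)
      moreover have "closed {x::rvec. x i = 0}" for i
        by (intro closed_Collect_eq continuous_on_const continuous_on_product_coordinates)
      ultimately show ?thesis by auto
    qed
    moreover have "closed {w::rvec. (\<Sum>i<k. (w i - c i)^2) \<le> r^2}"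
      by (intro closed_Collect_le continuous_on_sum continuous_on_power continuous_on_diff continuous_on_const
          continuous_on_product_coordinates)
    moreover have "?K = Rk k \<inter> {w. (\<Sum>i<k. (w i - c i)^2) \<le> r^2}" by auto
    ultimately show ?thesis by auto
  qed
  ultimately have "compact (?B \<inter> ?K)" by (rule compact_Int_closed)
  moreover have "?K \<subseteq> ?B"
  proof
    fix w assume w: "w \<in> ?K"
    have near: "\<bar>w i - c i\<bar> \<le> \<bar>r\<bar>" for i
    proof (cases "i < k")
      case True
      have "(w i - c i)^2 \<le> (\<Sum>i<k. (w i - c i)^2)" by (rule member_le_sum) (use True in auto)
      hence "(w i - c i)^2 \<le> r^2" using w by auto
      thus ?thesis by (simp add: abs_le_square_iff)
    next
      case False hence "w i = 0" "c i = 0" using w c by (auto simp: Rk_beyond)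
      thus ?thesis by simp
    qed
    hence "w i \<in> {c i - \<bar>r\<bar>..c i + \<bar>r\<bar>}" for i
      using near[of i] unfolding atLeastAtMost_iff abs_le_iff[of _ "\<bar>r\<bar>"] by linarith
    thus "w \<in> ?B" by auto
  qed
  ultimately show ?thesis by (simp only: Int_absorb1)
qed

lemma continuous_on_local:
  fixes f :: "rvec \<Rightarrow> real"
  assumes "\<And>x. x \<in> S \<Longrightarrow> \<exists>T. open T \<and> x \<in> T \<and> continuous_on (S \<inter> T) f"
  shows "continuous_on S f"
  unfolding continuous_on_eq_continuous_within
proof
  fix x assume x: "x \<in> S"
  then obtain T where T: "open T" "x \<in> T" "continuous_on (S \<inter> T) f" using assms by blast
  hence "continuous (at x within S \<inter> T) f" using x by (auto simp: continuous_on_eq_continuous_within)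
  thus "continuous (at x within S) f"
    using T at_within_nhd[of x T S "S \<inter> T"] by (simp add: continuous_within Int_assoc)
qed

text \<open>The two branches agree to infinite order at the boundary because the moments
  \<open>\<Sum>j. a j * (- 4^j)^p\<close> all equal \<open>1\<close>.\<close>
definition seeley_ext :: "(nat \<Rightarrow> real) \<Rightarrow> nat \<Rightarrow> nat \<Rightarrow> (real \<Rightarrow> rvec \<Rightarrow> real) \<Rightarrow> rvec \<Rightarrow> real" where
  "seeley_ext a k p f z = (if 0 \<le> z k then f (z k) (z(k := 0))
     else (\<Sum>j. a j * (-(4 ^ j)) ^ p * f (-(4 ^ j) * z k) (z(k := 0))))"

text \<open>At a fixed s < 0 the arguments 4^j (-s) soon exceed 1. Below the boundary the series can
  therefore be differentiated as a finite sum; uniform convergence is called for only in the proof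
  of continuity.\<close>

lemma suminf_cutoff:
  fixes f :: "real \<Rightarrow> rvec \<Rightarrow> real"
  assumes "\<And>s. s \<ge> 1 \<Longrightarrow> f s w = 0" "s < 0" "1 \<le> 4 ^ n * (- s)"
  shows "(\<Sum>j. a j * (-(4 ^ j)) ^ p * f (-(4 ^ j) * s) w) = (\<Sum>j<n. a j * (-(4 ^ j)) ^ p * f (-(4 ^ j) * s) w)"
proof (rule suminf_finite)
  fix j assume "j \<notin> {..<n}"
  hence "(4::real) ^ n \<le> 4 ^ j" by (intro power_increasing) auto
  hence "4 ^ n * (- s) \<le> 4 ^ j * (- s)" using assms(2) by (intro mult_right_mono) auto
  thus "a j * (-(4 ^ j)) ^ p * f (-(4 ^ j) * s) w = 0" using assms(1)[of "-(4 ^ j) * s"] assms(3) by simp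
qed simp

context
  fixes a :: "nat \<Rightarrow> real" and k :: nat and W :: "rvec set"
  assumes a: "\<And>p. summable (\<lambda>j. \<bar>a j\<bar> * (4 ^ j) ^ p)" "\<And>p. (\<Sum>j. a j * (-(4 ^ j)) ^ p) = 1"
    and W: "openR k W"
begin

definition cuthalf :: "(real \<Rightarrow> rvec \<Rightarrow> real) \<Rightarrow> bool" where
  "cuthalf f \<longleftrightarrow> halfsmooth k W f \<and> (\<forall>s\<ge>1. \<forall>w\<in>W. f s w = 0)"

lemma cuthalf_pdir: "cuthalf f \<Longrightarrow> i < k \<Longrightarrow> cuthalf (\<lambda>s. pdir i (f s))"
proof -
  assume f: "cuthalf f" and i: "i < k"
  have "pdir i (f s) w = 0" if "s \<ge> 1" "w \<in> W" for s w
    using pdir_cong[OF W that(2) i, of "f s" "\<lambda>x. 0"] f that has_pd_pdir[OF has_pd_const]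
    by (auto simp: cuthalf_def)
  thus ?thesis using f halfsmooth_pdir[OF W _ i] by (auto simp: cuthalf_def)
qed

lemma cuthalf_ds: "cuthalf f \<Longrightarrow> cuthalf (ds f)"
proof -
  assume f: "cuthalf f"
  have "ds f s w = 0" if "s \<ge> 1" "w \<in> W" for s w
  proof -
    have "f (s + (t + t')^2) w = 0" for t t'
    proof -
      have "s + (t + t')^2 \<ge> 1" using that(1) zero_le_power2[of "t + t'"] by linarith
      thus ?thesis using f that(2) by (auto simp: cuthalf_def)
    qed
    thus ?thesis by (simp add: ds_def)
  qed
  thus ?thesis using f halfsmooth_ds by (auto simp: cuthalf_def)
qed

text \<open>Supplies the majorant for the Weierstrass test. The arguments 4^j (- z k) are unbounded
  in \<open>j\<close>, but \<open>f\<close> vanishes beyond 1 and is bounded on the compact product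
  of [0,1] with a small closed ball.\<close>

lemma cuthalf_locally_bounded:
  assumes f: "cuthalf f" and z0: "z0 \<in> cyl k W"
  shows "\<exists>T M. open T \<and> z0 \<in> T \<and> (\<forall>z\<in>cyl k W \<inter> T. \<forall>s\<ge>0. \<bar>f s (z(k := 0))\<bar> \<le> M)"
proof -
  define w0 where "w0 = z0(k := 0)"
  have w0: "w0 \<in> W" "w0 \<in> Rk k" using z0 openR_subset[OF W] by (auto simp: cyl_def w0_def)
  obtain e where e: "e > 0" "\<And>y. y \<in> Rk k \<Longrightarrow> (\<Sum>i<k. (y i - w0 i)^2) < e^2 \<Longrightarrow> y \<in> W"
    using W w0(1) by (auto simp: openR_def)
  let ?K = "{w \<in> Rk k. (\<Sum>i<k. (w i - w0 i)^2) \<le> (e/2)^2}"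
  have KW: "?K \<subseteq> W"
  proof
    fix w assume "w \<in> ?K"
    moreover have "(e/2)^2 < e^2" using e(1) by (intro power_strict_mono) auto
    ultimately show "w \<in> W" using e(2)[of w] by auto
  qed
  let ?g = "\<lambda>(s::real, w::rvec). w(k := s)"
  have "continuous_on ({0..1} \<times> ?K) ?g"
    unfolding case_prod_unfold by (intro continuous_on_upd continuous_on_fst continuous_on_snd continuous_on_id)
  hence "compact (?g ` ({0..1} \<times> ?K))"
    by (intro compact_continuous_image compact_Times compact_Rk_cball w0(2)) auto
  moreover have sub: "?g ` ({0..1} \<times> ?K) \<subseteq> {z \<in> cyl k W. z k \<ge> 0}"
    using KW subset_cyl[OF W] cyl_upd by fastforce
  moreover have "continuous_on {z \<in> cyl k W. z k \<ge> 0} (\<lambda>z. f (z k) (z(k := 0)))"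
    using halfsmooth_continuous[OF W, of f] f by (simp add: cuthalf_def)
  ultimately have "compact ((\<lambda>z. f (z k) (z(k := 0))) ` ?g ` ({0..1} \<times> ?K))"
    by (blast intro: compact_continuous_image continuous_on_subset)
  hence "bounded ((\<lambda>z. f (z k) (z(k := 0))) ` ?g ` ({0..1} \<times> ?K))" by (rule compact_imp_bounded)
  then obtain M where "\<forall>x\<in>(\<lambda>z. f (z k) (z(k := 0))) ` ?g ` ({0..1} \<times> ?K). norm x \<le> M"
    unfolding bounded_iff by (elim exE)
  note M0 = this[rule_format, OF imageI, OF imageI]
  have M: "norm (f ((w(k := s)) k) ((w(k := s))(k := 0))) \<le> M" if "w \<in> ?K" "s \<in> {0..1}" for w s
    using M0[of "(s, w)"] that by (simp only: prod.case mem_Times_iff fst_conv snd_conv conj_absorb simp_thms)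
  let ?T = "{z::rvec. (\<Sum>i<k. (z i - z0 i)^2) < (e/2)^2}"
  have "open ?T"
    by (intro open_Collect_less continuous_on_sum continuous_on_power continuous_on_diff continuous_on_const
        continuous_on_product_coordinates)
  moreover have "z0 \<in> ?T" using e by auto
  moreover have "\<bar>f s (z(k := 0))\<bar> \<le> \<bar>M\<bar>" if z: "z \<in> cyl k W \<inter> ?T" and s: "s \<ge> 0" for z s
  proof (cases "s \<ge> 1")
    case True thus ?thesis using f z by (auto simp: cuthalf_def cyl_def)
  next
    case False
    let ?w = "z(k := 0)"
    have wW: "?w \<in> W" using z by (simp add: cyl_def)
    hence "?w \<in> Rk k" using openR_subset[OF W] by auto
    moreover have "(\<Sum>i<k. (?w i - w0 i)^2) = (\<Sum>i<k. (z i - z0 i)^2)" by (simp add: w0_def)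
    ultimately have "?w \<in> ?K" using z by auto
    from M[OF this, of s] False s show ?thesis by auto
  qed
  ultimately show ?thesis by blast
qed

lemma seeley_ext_continuous:
  assumes f: "cuthalf f"
  shows "continuous_on (cyl k W) (seeley_ext a k p f)"
proof -
  let ?S = "\<lambda>z. \<Sum>j. a j * (-(4 ^ j)) ^ p * f (-(4 ^ j) * z k) (z(k := 0))"
  let ?N = "{z \<in> cyl k W. z k \<le> 0}"
  have cp: "continuous_on {z \<in> cyl k W. 0 \<le> z k} (\<lambda>z. f (z k) (z(k := 0)))"
    using halfsmooth_continuous[OF W] f by (auto simp: cuthalf_def)
  have tm: "continuous_on ?N (\<lambda>z. f (-(4 ^ j) * z k) (z(k := 0)))" for j
  proof -
    have "continuous_on ?N (\<lambda>z. (\<lambda>z. f (z k) (z(k := 0))) (z(k := -(4 ^ j) * z k)))"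
    proof (rule continuous_on_compose2[OF cp])
      show "continuous_on ?N (\<lambda>z. z(k := -(4 ^ j) * z k))"
        by (intro continuous_on_upd continuous_on_mult continuous_on_const continuous_on_id
            continuous_on_subset[OF continuous_on_product_coordinates]) auto
      show "(\<lambda>z. z(k := -(4 ^ j) * z k)) ` ?N \<subseteq> {z \<in> cyl k W. 0 \<le> z k}"
        using cyl_upd by (auto simp: mult_nonneg_nonpos)
    qed
    thus ?thesis by simp
  qed
  have cm: "continuous_on ?N ?S"
  proof (rule continuous_on_local)
    fix z0 assume "z0 \<in> ?N"
    then obtain T M where T: "open T" "z0 \<in> T" "\<And>z s. z \<in> cyl k W \<inter> T \<Longrightarrow> s \<ge> 0 \<Longrightarrow> \<bar>f s (z(k := 0))\<bar> \<le> M"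
      using cuthalf_locally_bounded[OF f, of z0] by auto
    have "uniform_limit (?N \<inter> T) (\<lambda>n z. \<Sum>j<n. a j * (-(4 ^ j)) ^ p * f (-(4 ^ j) * z k) (z(k := 0))) ?S sequentially"
    proof (rule Weierstrass_m_test)
      show "summable (\<lambda>j. \<bar>a j\<bar> * (4 ^ j) ^ p * M)" by (rule summable_mult2[OF a(1)])
      fix j z assume z: "z \<in> ?N \<inter> T"
      hence "0 \<le> -(4 ^ j) * z k" by (auto simp: mult_nonneg_nonpos)
      hence "\<bar>f (-(4 ^ j) * z k) (z(k := 0))\<bar> \<le> M" using T(3) z by auto
      moreover have "norm (a j * (-(4 ^ j)) ^ p) = \<bar>a j\<bar> * (4 ^ j) ^ p" by (simp add: abs_mult power_abs)
      ultimately show "norm (a j * (-(4 ^ j)) ^ p * f (-(4 ^ j) * z k) (z(k := 0))) \<le> \<bar>a j\<bar> * (4 ^ j) ^ p * M"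
        unfolding norm_mult[of "a j * (-(4 ^ j)) ^ p"] by (simp add: mult_left_mono)
    qed
    hence "continuous_on (?N \<inter> T) ?S"
      by (rule uniform_limit_theorem[rotated])
        (simp_all only: trivial_limit_sequentially not_False_eq_True, intro always_eventually allI continuous_on_sum continuous_on_mult
          continuous_on_const continuous_on_subset[OF tm] Int_lower1)
    thus "\<exists>T. open T \<and> z0 \<in> T \<and> continuous_on (?N \<inter> T) ?S" using T by blast
  qed
  \<comment> \<open>Testing \<open>z k \<le> 0\<close> instead of \<open>z k < 0\<close> makes both
    pieces relatively closed. On the common face the series is the value of \<open>f\<close> at 0
    times the moment of order \<open>p\<close>, which is 1.\<close>
  have "continuous_on (cyl k W) (\<lambda>z. if z k \<le> 0 then ?S z else f (z k) (z(k := 0)))"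
  proof (rule continuous_on_cases_le[OF cm cp])
    show "continuous_on (cyl k W) (\<lambda>z. z k)" by (rule continuous_on_subset[OF continuous_on_product_coordinates]) auto
    fix z assume "z \<in> cyl k W" "z k = 0"
    have "summable (\<lambda>j. a j * (-(4 ^ j)) ^ p)"
      using a(1)[of p] by (rule_tac summable_rabs_cancel) (simp add: abs_mult power_abs)
    thus "?S z = f (z k) (z(k := 0))" using \<open>z k = 0\<close> a(2)[of p] by (simp add: suminf_mult2[symmetric])
  qed
  moreover have "seeley_ext a k p f z = (if z k \<le> 0 then ?S z else f (z k) (z(k := 0)))" if "z \<in> cyl k W" for z
  proof (cases "z k = 0")
    case True
    have "summable (\<lambda>j. a j * (-(4 ^ j)) ^ p)"
      using a(1)[of p] by (rule_tac summable_rabs_cancel) (simp add: abs_mult power_abs)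
    thus ?thesis using True a(2)[of p] by (simp add: seeley_ext_def suminf_mult2[symmetric])
  qed (simp add: seeley_ext_def)
  ultimately show ?thesis using continuous_on_cong[OF refl, of "cyl k W"] by simp
qed

text \<open>Moving in a base direction keeps \<open>z k\<close> fixed, hence also the branch and the
  truncation \<open>n\<close>.\<close>

lemma seeley_ext_pd_base:
  assumes f: "cuthalf f" and z: "z \<in> cyl k W" and i: "i < k"
  shows "has_pd i (seeley_ext a k p f) z (seeley_ext a k p (\<lambda>s. pdir i (f s)) z)"
proof -
  let ?w = "z(k := 0)"
  have w: "?w \<in> W" using z by (simp add: cyl_def)
  have swap: "(z(i := z i + t))(k := 0) = ?w(i := ?w i + t)" "(z(i := z i + t)) k = z k" for t
    using i by (auto simp: fun_upd_twist)
  have D: "((\<lambda>t. f s (?w(i := ?w i + t))) has_real_derivative pdir i (f s) ?w) (at 0)" if "s \<ge> 0" for s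
    using smooth_real_pd[OF halfsmooth_section[OF W _ that] i w] f by (auto simp: cuthalf_def has_pd_def)
  show ?thesis
  proof (cases "z k \<ge> 0")
    case True
    thus ?thesis using D[OF True] unfolding has_pd_def seeley_ext_def swap by simp
  next
    case False
    then obtain n where "1 / (- z k) < 4 ^ n" using real_arch_pow[of 4 "1 / (- z k)"] by auto
    hence n: "1 \<le> 4 ^ n * (- z k)" using False by (simp add: field_simps)
    have zk: "z k < 0" using False by simp
    have fin: "seeley_ext a k p g y = (\<Sum>j<n. a j * (-(4 ^ j)) ^ p * g (-(4 ^ j) * z k) (y(k := 0)))"
      if "y(k := 0) \<in> W" "y k = z k" "cuthalf g" for g y
      unfolding seeley_ext_def that(2) using suminf_cutoff[of g "y(k := 0)" "z k" n] zk n that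
      by (auto simp: cuthalf_def)
    have "((\<lambda>t. \<Sum>j<n. a j * (-(4 ^ j)) ^ p * f (-(4 ^ j) * z k) (?w(i := ?w i + t))) has_real_derivative
      (\<Sum>j<n. a j * (-(4 ^ j)) ^ p * pdir i (f (-(4 ^ j) * z k)) ?w)) (at 0)"
      by (intro DERIV_sum DERIV_cmult D) (use zk in \<open>simp add: mult_nonneg_nonpos\<close>)
    moreover have "(\<Sum>j<n. a j * (-(4 ^ j)) ^ p * pdir i (f (-(4 ^ j) * z k)) ?w) =
      seeley_ext a k p (\<lambda>s. pdir i (f s)) z"
      using fin[OF w refl cuthalf_pdir[OF f i]] by simp
    moreover have "eventually (\<lambda>t. (\<Sum>j<n. a j * (-(4 ^ j)) ^ p * f (-(4 ^ j) * z k) (?w(i := ?w i + t)))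
      = seeley_ext a k p f (z(i := z i + t))) (nhds 0)"
      using openR_line[OF W w i]
    proof eventually_elim
      case (elim t)
      thus ?case using fin[of "z(i := z i + t)" f, OF _ swap(2) f] unfolding swap(1) by simp
    qed
    ultimately show ?thesis unfolding has_pd_def by (rule DERIV_transform_ev)
  qed
qed

text \<open>Off the boundary the chain rule pulls a factor \<open>-(4 ^ j)\<close> out of each
  summand, which raises \<open>p\<close> by one. At the boundary, continuity of both extensions
  makes the derivative removable.\<close>

lemma seeley_ext_pd_normal:
  assumes f: "cuthalf f" and z: "z \<in> cyl k W"
  shows "has_pd k (seeley_ext a k p f) z (seeley_ext a k (Suc p) (ds f) z)"
proof -
  let ?w = "z(k := 0)"
  define \<phi> where "\<phi> s = seeley_ext a k p f (z(k := s))" for s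
  define \<psi> where "\<psi> s = seeley_ext a k (Suc p) (ds f) (z(k := s))" for s
  have w: "?w \<in> W" using z by (simp add: cyl_def)
  have line: "continuous_on UNIV (\<lambda>s::real. z(k := s))"
    by (rule continuous_on_upd[OF continuous_on_const continuous_on_id])
  have c\<phi>: "continuous_on UNIV \<phi>" unfolding \<phi>_def
    by (rule continuous_on_compose2[OF seeley_ext_continuous[OF f] line]) (use cyl_upd[OF z] in blast)
  have c\<psi>: "continuous_on UNIV \<psi>" unfolding \<psi>_def
    by (rule continuous_on_compose2[OF seeley_ext_continuous[OF cuthalf_ds[OF f]] line]) (use cyl_upd[OF z] in blast)
  have D: "((\<lambda>s. f s ?w) has_real_derivative ds f s ?w) (at s)" if "s > 0" for s
    using halfsmooth_ds_derivative[OF W _ that w] f by (auto simp: cuthalf_def)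
  have D0: "(\<phi> has_real_derivative \<psi> s) (at s)" if s: "s \<noteq> 0" for s
  proof (cases "s > 0")
    case True
    have "eventually (\<lambda>s. f s ?w = \<phi> s) (nhds s)"
      using eventually_nhds_in_open[of "{0<..}" s] True
      by (auto elim!: eventually_mono simp: \<phi>_def seeley_ext_def)
    from DERIV_cong_ev[OF refl this refl] have "(\<phi> has_real_derivative ds f s ?w) (at s)"
      using D[OF True] by blast
    thus ?thesis using True by (simp add: \<psi>_def seeley_ext_def)
  next
    case False
    hence s: "s < 0" using that by simp
    \<comment> \<open>The constant 2 makes the truncation \<open>n\<close> valid for all
      \<open>r < s / 2\<close>, a neighbourhood of \<open>s\<close>, and not only at
      \<open>s\<close>.\<close>
    obtain n where "2 / (- s) < 4 ^ n" using real_arch_pow[of 4 "2 / (- s)"] by auto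
    hence n: "1 \<le> 4 ^ n * (- (s / 2))" using s by (simp add: field_simps)
    have n': "1 \<le> 4 ^ n * (- r)" if "r < s / 2" for r
    proof -
      have "4 ^ n * (- (s / 2)) \<le> 4 ^ n * (- r)" using that by (intro mult_left_mono) auto
      thus ?thesis using n by linarith
    qed
    have fin: "seeley_ext a k q g (z(k := r)) = (\<Sum>j<n. a j * (-(4 ^ j)) ^ q * g (-(4 ^ j) * r) ?w)"
      if "r < s / 2" "cuthalf g" for g r q
      using suminf_cutoff[of g ?w r n] s n'[OF that(1)] that w by (auto simp: cuthalf_def seeley_ext_def)
    have "((\<lambda>r. \<Sum>j<n. a j * (-(4 ^ j)) ^ p * f (-(4 ^ j) * r) ?w) has_real_derivative
      (\<Sum>j<n. a j * (-(4 ^ j)) ^ p * (ds f (-(4 ^ j) * s) ?w * -(4 ^ j)))) (at s)"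
    proof (intro DERIV_sum DERIV_cmult)
      fix j
      have "-(4 ^ j) * s > 0" using s by (simp add: mult_pos_neg)
      moreover have "((\<lambda>r. -(4 ^ j) * r) has_real_derivative -(4 ^ j)) (at s)"
        by (auto intro!: derivative_eq_intros)
      ultimately show "((\<lambda>r. f (-(4 ^ j) * r) ?w) has_real_derivative ds f (-(4 ^ j) * s) ?w * -(4 ^ j)) (at s)"
        using DERIV_chain2[where f = "\<lambda>s. f s ?w" and g = "\<lambda>r. -(4 ^ j) * r" and x = s, OF D] by blast
    qed
    moreover have "(\<Sum>j<n. a j * (-(4 ^ j)) ^ p * (ds f (-(4 ^ j) * s) ?w * -(4 ^ j))) = \<psi> s"
      using fin[of s "ds f" "Suc p", OF _ cuthalf_ds[OF f]] s by (simp add: \<psi>_def mult_ac)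
    moreover have "eventually (\<lambda>r. (\<Sum>j<n. a j * (-(4 ^ j)) ^ p * f (-(4 ^ j) * r) ?w) = \<phi> r) (nhds s)"
      using eventually_nhds_in_open[of "{..<s/2}" s] s
      by (auto elim!: eventually_mono simp: \<phi>_def fin[OF _ f])
    ultimately show ?thesis by (rule DERIV_transform_ev)
  qed
  have "(\<phi> has_real_derivative \<psi> s) (at s)" for s
  proof (cases "s = 0")
    case True
    show ?thesis unfolding True
      by (rule removable_derivative[OF c\<phi> D0]) (use c\<psi> in \<open>auto simp: continuous_on_eq_continuous_at\<close>)
  qed (rule D0)
  hence "(\<phi> has_real_derivative \<psi> (z k)) (at (0 + z k))" by simp
  hence "((\<lambda>h. \<phi> (h + z k)) has_real_derivative \<psi> (z k)) (at 0)"
    by (simp only: DERIV_shift[of _ _ 0 "z k"])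
  thus ?thesis by (simp add: has_pd_def \<phi>_def \<psi>_def add.commute)
qed

text \<open>The derivatives send (\<open>p\<close>, \<open>f\<close>) to (\<open>p\<close>,
  \<open>pdir\<close> of \<open>f\<close>) and to (\<open>Suc p\<close>, \<open>ds f\<close>), so
  the family over all \<open>p\<close> and all \<open>cuthalf\<close> functions is closed. This is
  why \<open>p\<close> is a parameter of \<open>seeley_ext\<close>.\<close>

lemma seeley_ext_smooth:
  assumes "cuthalf f"
  shows "smooth_real (Suc k) (cyl k W) (seeley_ext a k p f)"
proof (rule smooth_real_coinduct[where \<P> = "\<lambda>g. \<exists>p f. cuthalf f \<and> g = seeley_ext a k p f"])
  show "openR (Suc k) (cyl k W)" by (rule openR_cyl[OF W])
  show "\<exists>p' f'. cuthalf f' \<and> seeley_ext a k p f = seeley_ext a k p' f'" using assms by blast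
  show "continuous_on (cyl k W) g" if "\<exists>p f. cuthalf f \<and> g = seeley_ext a k p f" for g
    using that seeley_ext_continuous by blast
  fix g i assume "\<exists>p f. cuthalf f \<and> g = seeley_ext a k p f" and i: "i < Suc k"
  then obtain p f where f: "cuthalf f" "g = seeley_ext a k p f" by blast
  show "\<exists>g'. (\<forall>x\<in>cyl k W. has_pd i g x (g' x)) \<and> (\<exists>p f. cuthalf f \<and> g' = seeley_ext a k p f)"
  proof (cases "i < k")
    case True
    thus ?thesis using seeley_ext_pd_base[OF f(1)] cuthalf_pdir[OF f(1) True] unfolding f(2) by blast
  next
    case False
    hence "i = k" using i by simp
    thus ?thesis using seeley_ext_pd_normal[OF f(1)] cuthalf_ds[OF f(1)] unfolding f(2) by blast
  qed
qed

end

lemma halfspace_extension: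
  assumes W: "openR k W" and f: "halfsmooth k W f" "\<And>s w. s \<ge> 1 \<Longrightarrow> w \<in> W \<Longrightarrow> f s w = 0"
  shows "\<exists>G. smooth_real (Suc k) (cyl k W) G \<and> (\<forall>z. z k \<ge> 0 \<longrightarrow> G z = f (z k) (z(k := 0)))"
proof -
  obtain a :: "nat \<Rightarrow> real" where a: "\<And>p. summable (\<lambda>j. \<bar>a j\<bar> * (4 ^ j) ^ p)" "\<And>p. (\<Sum>j. a j * (-(4 ^ j)) ^ p) = 1"
    using seeley_coefficients by blast
  have "smooth_real (Suc k) (cyl k W) (seeley_ext a k 0 f)"
    by (rule seeley_ext_smooth[OF a W]) (use f in \<open>auto simp: cuthalf_def[OF a W]\<close>)
  thus ?thesis by (intro exI[of _ "seeley_ext a k 0 f"]) (simp add: seeley_ext_def)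
qed

section \<open>Extension from a shell\<close>

definition sstep :: "real \<Rightarrow> real" where
  "sstep x = ell (x - 1/4) / (ell (x - 1/4) + ell (1/2 - x))"

lemma sstep_denom: "ell (x - 1/4) + ell (1/2 - x) \<noteq> 0"
proof -
  have "0 < x - 1/4 \<or> 0 < 1/2 - x" by linarith
  hence "0 < ell (x - 1/4) \<or> 0 < ell (1/2 - x)" by (simp only: ell_pos)
  thus ?thesis using ell_nonneg[of "x - 1/4"] ell_nonneg[of "1/2 - x"] by linarith
qed

lemma sstep_0: "x \<le> 1/4 \<Longrightarrow> sstep x = 0"
  by (simp add: sstep_def)

lemma sstep_1: "x \<ge> 1/2 \<Longrightarrow> sstep x = 1"
  using sstep_denom[of x] by (simp add: sstep_def)

lemma smooth_real_sstep:
  assumes U: "openR k U" and g: "smooth_real k U g"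
  shows "smooth_real k U (\<lambda>x. sstep (g x))"
  unfolding sstep_def
  by (intro smooth_real_divide smooth_real_add smooth_real_ell smooth_real_diff smooth_real_const U g sstep_denom)

text \<open>The square of \<open>normu\<close>: smooth also at u = 0, and equivalent to it for
  comparison with 1.\<close>

definition usq :: "nat \<Rightarrow> rvec \<Rightarrow> real" where
  "usq n w = (\<Sum>i<n. (w i)^2)"

lemma smooth_real_usq: "openR k U \<Longrightarrow> smooth_map k U l F \<Longrightarrow> smooth_real k U (\<lambda>x. usq n (F x))"
  unfolding usq_def by (intro smooth_real_sum smooth_real_power smooth_map_coord)

lemma smooth_real_usq': "openR k U \<Longrightarrow> smooth_real k U (usq n)"
  using smooth_real_usq[OF _ smooth_map_id] by blast

lemma openR_usq: "open T \<Longrightarrow> openR N {w \<in> Rk N. usq n w \<in> T}"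
  by (rule openR_vimage[OF openR_Rk smooth_real_continuous[OF smooth_real_usq'[OF openR_Rk]]])

text \<open>For \<open>s \<ge> 0\<close> the point \<open>shell_flow n s w\<close> lies in the shell \<open>usq n w \<ge> 1\<close>, since
  \<open>(q + 1 + s)\<^sup>2 / (4 q) \<ge> (q + 1)\<^sup>2 / (4 q) \<ge> 1\<close>; and \<open>shell_flow n (usq n w - 1) w = w\<close>.\<close>
definition shell_flow :: "nat \<Rightarrow> real \<Rightarrow> rvec \<Rightarrow> rvec" where
  "shell_flow n s w = (\<lambda>i. if i < n then (usq n w + 1 + s) / (2 * usq n w) * w i else w i)"

lemma shell_flow_self: "usq n w > 0 \<Longrightarrow> shell_flow n (usq n w - 1) w = w"
  by (auto simp: shell_flow_def fun_eq_iff)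

lemma usq_shell_flow:
  assumes q: "usq n w > 0" and s: "s \<ge> 0"
  shows "1 \<le> usq n (shell_flow n s w)"
proof -
  let ?q = "usq n w"
  define c where "c = (?q + 1 + s) / (2 * ?q)"
  have "usq n (shell_flow n s w) = (\<Sum>i<n. (c * w i)^2)"
    unfolding usq_def[of n "shell_flow n s w"] by (rule sum.cong) (auto simp: shell_flow_def c_def)
  also have "\<dots> = c^2 * ?q" by (simp add: usq_def power_mult_distrib sum_distrib_left)
  also have "\<dots> = ((?q + 1 + s) / (2 * ?q))^2 * ?q" by (simp add: c_def)
  also have "\<dots> = (?q + 1 + s)^2 / (4 * ?q)" using q by (simp add: power2_eq_square field_simps)
  also have "\<dots> \<ge> 1"
  proof -
    have "(?q + 1)^2 \<le> (?q + 1 + s)^2" by (rule power_mono) (use q s in auto)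
    moreover have "4 * ?q \<le> (?q + 1)^2" using zero_le_power2[of "?q - 1"] by (simp add: power2_eq_square algebra_simps)
    ultimately show ?thesis using q by simp
  qed
  finally show ?thesis .
qed

lemma smooth_map_shell_flow:
  assumes V: "openR l V" and \<sigma>: "smooth_real l V \<sigma>" and \<omega>: "smooth_map l V N \<omega>" and n: "n \<le> N"
    and pos: "\<And>y. y \<in> V \<Longrightarrow> usq n (\<omega> y) > 0"
  shows "smooth_map l V N (\<lambda>y. shell_flow n (\<sigma> y) (\<omega> y))"
  unfolding smooth_map_def
proof (intro conjI ballI allI impI)
  fix y assume "y \<in> V"
  thus "shell_flow n (\<sigma> y) (\<omega> y) \<in> Rk N" using \<omega> n by (auto simp: smooth_map_def Rk_def shell_flow_def)
next
  fix j
  have q: "smooth_real l V (\<lambda>y. usq n (\<omega> y))" by (rule smooth_real_usq[OF V \<omega>])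
  have "2 * usq n (\<omega> y) \<noteq> 0" if "y \<in> V" for y using pos[OF that] by simp
  hence "smooth_real l V (\<lambda>y. (usq n (\<omega> y) + 1 + \<sigma> y) / (2 * usq n (\<omega> y)) * \<omega> y j)"
    by (intro smooth_real_mult smooth_real_divide smooth_real_add smooth_real_const q V \<sigma> smooth_map_coord[OF V \<omega>])
  thus "smooth_real l V (\<lambda>y. shell_flow n (\<sigma> y) (\<omega> y) j)"
    using smooth_map_coord[OF V \<omega>] by (cases "j < n") (simp_all add: shell_flow_def)
qed

text \<open>\<open>f (shell_flow n s w)\<close> is defined for s \<ge> 0 over the set u \<noteq> 0,
  with \<open>s\<close> independent of \<open>w\<close>; there the half space theorem applies, and
  the graph s = usq n w - 1 leads back. This replaces polar coordinates and charts of the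
  sphere.\<close>

lemma shell_extension:
  assumes n: "n \<le> N"
    and f: "\<And>l V R. openR l V \<Longrightarrow> smooth_map l V N R \<Longrightarrow> (\<And>y. y \<in> V \<Longrightarrow> 1 \<le> usq n (R y)) \<Longrightarrow>
      smooth_real l V (\<lambda>y. f (R y))"
  shows "\<exists>F. smooth_real N (Rk N) F \<and> (\<forall>w. 1 \<le> usq n w \<longrightarrow> F w = f w)"
proof -
  define W where "W = {w \<in> Rk N. usq n w \<in> {0<..}}"
  have W: "openR N W" unfolding W_def by (rule openR_usq) simp
  \<comment> \<open>The cutoff leaves \<open>f\<close> unchanged for s \<le> 1/4 and supplies the
    vanishing for s \<ge> 1.\<close>
  define g where "g s w = (1 - sstep s) * f (shell_flow n s w)" for s w
  have g: "halfsmooth N W g" unfolding halfsmooth_def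
  proof (intro allI impI, elim conjE)
    fix l V \<sigma> \<omega>
    assume V: "openR l V" and \<sigma>: "smooth_real l V \<sigma>" and \<omega>: "smooth_map l V N \<omega>"
      and r: "\<forall>y\<in>V. 0 \<le> \<sigma> y \<and> \<omega> y \<in> W"
    have pos: "usq n (\<omega> y) > 0" if "y \<in> V" for y using r that by (auto simp: W_def)
    have "smooth_real l V (\<lambda>y. f (shell_flow n (\<sigma> y) (\<omega> y)))"
      by (rule f[OF V smooth_map_shell_flow[OF V \<sigma> \<omega> n pos]]) (use r pos usq_shell_flow in auto)
    thus "smooth_real l V (\<lambda>y. g (\<sigma> y) (\<omega> y))" unfolding g_def
      by (intro smooth_real_mult smooth_real_diff smooth_real_const smooth_real_sstep V \<sigma>)
  qed
  have "g s w = 0" if "s \<ge> 1" for s w using that by (simp add: g_def sstep_1)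
  from halfspace_extension[OF W g this]
  obtain G where G: "smooth_real (Suc N) (cyl N W) G" "\<And>z. z N \<ge> 0 \<Longrightarrow> G z = g (z N) (z(N := 0))" by blast
  \<comment> \<open>Restriction to the graph; \<open>usq n w - 1\<close> is negative exactly off the
    shell, where the extended values are picked up.\<close>
  define H where "H w = G (w(N := usq n w - 1))" for w
  have H: "smooth_real N W H" unfolding H_def
  proof (rule smooth_real_compose[OF W openR_cyl[OF W] _ _ G(1)])
    show "smooth_map N W (Suc N) (\<lambda>w. w(N := usq n w - 1))"
      by (rule smooth_map_upd[OF W smooth_map_id[OF W]
          smooth_real_diff[OF W smooth_real_usq'[OF W] smooth_real_const[OF W]]]) auto
    show "(\<lambda>w. w(N := usq n w - 1)) ` W \<subseteq> cyl N W"
      using subset_cyl[OF W] cyl_upd by blast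
  qed
  have Hf: "H w = f w" if "w \<in> Rk N" "1 \<le> usq n w" "usq n w < 5/4" for w
  proof -
    have "H w = g (usq n w - 1) (w(N := 0))" unfolding H_def using G(2)[of "w(N := usq n w - 1)"] that by simp
    also have "w(N := 0) = w" by (rule Rk_upd_self[OF that(1)])
    finally show ?thesis using that by (simp add: g_def sstep_0 shell_flow_self)
  qed
  define F where "F w = (if 1 \<le> usq n w then f w else sstep (usq n w) * H w)" for w
  have o: "openR N {w \<in> Rk N. usq n w \<in> T}" if "open T" for T using openR_usq[OF that] .
  have "smooth_real N (Rk N) F"
  proof (rule smooth_real_local)
    fix x assume x: "x \<in> Rk N"
    have loc: "\<exists>V. openR N V \<and> x \<in> V \<and> smooth_real N V F"
      if "open T" "usq n x \<in> T" "smooth_real N {w \<in> Rk N. usq n w \<in> T} E"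
        "\<And>w. w \<in> Rk N \<Longrightarrow> usq n w \<in> T \<Longrightarrow> E w = F w" for T E
      using o[OF that(1)] smooth_real_cong[OF o[OF that(1)] that(3), of F] that x
      by (intro exI[of _ "{w \<in> Rk N. usq n w \<in> T}"]) auto
    \<comment> \<open>The bounds 1/4 and 1/2 are those of \<open>sstep\<close>, and 5/4 = 1 + 1/4
      limits the collar on which \<open>H\<close> equals \<open>f\<close>. Near u = 0, where
      \<open>shell_flow\<close> would divide by zero, \<open>F\<close> is 0.\<close>
    consider "usq n x < 1/4" | "1/8 < usq n x" "usq n x < 1" | "1/2 < usq n x" "usq n x < 5/4" | "1 < usq n x"
      by linarith
    thus "\<exists>V. openR N V \<and> x \<in> V \<and> smooth_real N V F"
    proof cases
      case 1
      show ?thesis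
        by (rule loc[of "{..<1/4}" "\<lambda>w. 0"])
          (use 1 o[of "{..<1/4}"] in \<open>auto simp: F_def sstep_0 intro!: smooth_real_const\<close>)
    next
      case 2
      have "smooth_real N {w \<in> Rk N. usq n w \<in> {1/8<..<1}} (\<lambda>w. sstep (usq n w) * H w)"
        by (intro smooth_real_mult smooth_real_sstep smooth_real_usq' o smooth_real_subset[OF H])
          (auto simp: W_def)
      from loc[OF _ _ this] 2 show ?thesis by (auto simp: F_def)
    next
      case 3
      have "smooth_real N {w \<in> Rk N. usq n w \<in> {1/2<..<5/4}} H"
        by (rule smooth_real_subset[OF H]) (auto simp: W_def)
      from loc[OF _ _ this] 3 show ?thesis using Hf by (auto simp: F_def sstep_1)
    next
      case 4
      have "smooth_real N {w \<in> Rk N. usq n w \<in> {1<..}} (\<lambda>w. f w)"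
        by (rule f[OF o smooth_map_id[OF o]]) auto
      from loc[OF _ _ this] 4 show ?thesis by (auto simp: F_def)
    qed
  qed simp
  thus ?thesis by (intro exI[of _ F]) (simp add: F_def)
qed

section \<open>Attaching cells\<close>

text \<open>The integral of a non-integrable function and a quotient by 0 both default to 0, so the
  sign holds in every case.\<close>

lemma lam_nonneg: "lam t \<ge> 0"
proof -
  have nn: "0 \<le> integral S (\<lambda>x. ell (3 * x) * ell (3 - 3 * x))" for S
    by (cases "(\<lambda>x. ell (3 * x) * ell (3 - 3 * x)) integrable_on S")
      (auto intro: integral_nonneg simp: not_integrable_integral)
  show ?thesis unfolding lam_def alpha0_def by (intro divide_nonneg_nonneg nn)
qed

lemma phi_nonneg: "phi t \<ge> 0"
  unfolding phi_def using lam_nonneg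
  by (cases "lam integrable_on {0..1/2 + t}") (auto intro: integral_nonneg simp: not_integrable_integral)

lemma phi_eq_0:
  assumes "t \<le> -1/2"
  shows "phi t = 0"
proof -
  have "{0..1/2 + t} = {} \<or> {0..1/2 + t} = {0}" using assms by auto
  thus ?thesis by (auto simp: phi_def)
qed

lemma normu_ge_1: "normu n w \<ge> 1 \<longleftrightarrow> usq n w \<ge> 1"
  by (simp add: normu_def usq_def)

lemma Snm_iff: "w \<in> Snm n m \<longleftrightarrow> w \<in> Rk (n + m) \<and> 1 \<le> usq n w"
  by (simp add: Snm_def normu_ge_1)

lemma Snm_subset_Dnm: "Snm n m \<subseteq> Dnm n m"
proof
  fix w assume w: "w \<in> Snm n m"
  have "0 \<le> phi (2 - normu n w - normv n m w)" by (rule phi_nonneg)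
  thus "w \<in> Dnm n m" using w by (auto simp: Snm_def Dnm_def)
qed

text \<open>If \<parallel>u\<parallel> < 1, then \<open>phi\<close> is positive at 2 -
  \<parallel>u\<parallel> - \<parallel>v\<parallel>, which therefore exceeds -1/2; hence
  \<parallel>v\<parallel> < 5/2. The radius 3 is a convenient bound for 1 + 25/4.\<close>

lemma Dnm_minus_Snm_bounded:
  assumes "w \<in> Dnm n m" "w \<notin> Snm n m"
  shows "(\<Sum>i<n + m. (w i - 0)^2) \<le> 3^2"
proof -
  have u: "normu n w < 1" using assms by (auto simp: Dnm_def Snm_def)
  hence "phi (2 - normu n w - normv n m w) > 0" using assms(1) by (auto simp: Dnm_def)
  hence "2 - normu n w - normv n m w > -1/2" using phi_eq_0 by (metis less_irrefl not_le)
  moreover have "normu n w \<ge> 0" by (simp add: normu_def sum_nonneg)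
  ultimately have v: "normv n m w < 5/2" by linarith
  have "(normu n w)^2 \<le> 1^2" using u by (intro power_mono) (auto simp: normu_def sum_nonneg)
  moreover have "(normv n m w)^2 \<le> (5/2)^2" using v by (intro power_mono) (auto simp: normv_def sum_nonneg)
  moreover have "(\<Sum>i<n + m. (w i)^2) = (normu n w)^2 + (normv n m w)^2"
  proof -
    have "(\<Sum>i<n + m. (w i)^2) = (\<Sum>i<n. (w i)^2) + (\<Sum>i<m. (w (n + i))^2)"
      by (induction m) auto
    thus ?thesis by (simp add: normu_def normv_def sum_nonneg)
  qed
  ultimately show ?thesis by (simp add: power2_eq_square)
qed

text \<open>The function space is a metric space, so failure of a local property at \<open>x\<close>
  yields a sequence of violations converging to \<open>x\<close>; the arguments by compactness start
  from it.\<close>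

lemma not_near_sequence:
  assumes U: "openR k U" and x: "x \<in> U"
    and no: "\<not> (\<exists>V. openR k V \<and> x \<in> V \<and> V \<subseteq> U \<and> (\<forall>y\<in>V. P y))"
  shows "\<exists>y::nat \<Rightarrow> rvec. (\<forall>i. y i \<in> U \<and> \<not> P (y i)) \<and> y \<longlonglongrightarrow> x"
proof -
  have "\<exists>y. y \<in> U \<and> dist y x < inverse (real (Suc i)) \<and> \<not> P y" for i
  proof (rule ccontr)
    assume n: "\<not> ?thesis"
    have "openR k {y \<in> U. y \<in> ball x (inverse (real (Suc i)))}"
      by (rule openR_vimage[OF U continuous_on_id]) simp
    moreover have "x \<in> {y \<in> U. y \<in> ball x (inverse (real (Suc i)))}" using x by simp
    moreover have "\<forall>y\<in>{y \<in> U. y \<in> ball x (inverse (real (Suc i)))}. P y"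
      using n by (auto simp: dist_commute)
    ultimately show False using no by (metis (no_types, lifting) mem_Collect_eq subsetI)
  qed
  then obtain y where y: "\<And>i. y i \<in> U" "\<And>i. dist (y i) x < inverse (real (Suc i))" "\<And>i. \<not> P (y i)" by metis
  have "(\<lambda>i. dist (y i) x) \<longlonglongrightarrow> 0"
    by (rule Lim_null_comparison[OF _ LIMSEQ_inverse_real_of_nat])
      (use y(2) in \<open>auto intro!: always_eventually less_imp_le\<close>)
  hence "y \<longlonglongrightarrow> x" by (subst tendsto_dist_iff)
  thus ?thesis using y by blast
qed

lemma continuous_on_seq:
  fixes f :: "rvec \<Rightarrow> real"
  assumes "continuous_on U f" "\<And>i. y i \<in> U" "x \<in> U" "y \<longlonglongrightarrow> x"
  shows "(\<lambda>i. f (y i)) \<longlonglongrightarrow> f x"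
  by (rule continuous_on_tendsto_compose[OF assms(1,4,3)]) (simp add: assms(2))

lemma compact_subseq:
  assumes "compact K" "\<And>i. (w i :: rvec) \<in> K"
  obtains l r where "l \<in> K" "strict_mono (r :: nat \<Rightarrow> nat)" "(\<lambda>i. w (r i)) \<longlonglongrightarrow> l"
proof -
  have "seq_compact K" using assms(1) by (simp add: compact_eq_seq_compact_metric)
  from this[unfolded seq_compact_def, rule_format, of w] assms(2) that show ?thesis
    by (auto simp: o_def)
qed

section \<open>Diffeologies carried through the induction\<close>

lemma smooth_fun_plot: "smooth_fun Y D f \<Longrightarrow> D k U P \<Longrightarrow> smooth_real k U (\<lambda>x. f (P x))"
  unfolding smooth_fun_def o_def by blast

lemma sumD_I:
  assumes "openR k U" "j \<in> J" "smooth_map k U (d j) R" "R ` U \<subseteq> A j" "\<And>y. y \<in> U \<Longrightarrow> P y = (j, R y)"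
  shows "sumD J d A k U P"
  unfolding sumD_def using assms by blast

lemma sumD_restrict:
  assumes "sumD J d A k U P" "openR k V" "V \<subseteq> U"
  shows "sumD J d A k V P"
  unfolding sumD_def
proof (intro conjI ballI)
  fix x assume x: "x \<in> V"
  hence "x \<in> U" using assms(3) by blast
  then obtain T j R where T: "openR k T" "x \<in> T" "T \<subseteq> U" "j \<in> J" "smooth_map k T (d j) R"
    "R ` T \<subseteq> A j" "\<forall>y\<in>T. P y = (j, R y)" using assms(1) unfolding sumD_def by blast
  show "\<exists>V'. openR k V' \<and> x \<in> V' \<and> V' \<subseteq> V \<and>
        (\<exists>j\<in>J. \<exists>R. smooth_map k V' (d j) R \<and> R ` V' \<subseteq> A j \<and> (\<forall>y\<in>V'. P y = (j, R y)))"
  proof (intro exI[of _ "T \<inter> V"] conjI bexI[of _ j] exI[of _ R])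
    show "smooth_map k (T \<inter> V) (d j) R" by (rule smooth_map_subset[OF T(5)]) simp
  qed (use T x openR_Int[OF T(1) assms(2)] in auto)
qed (rule assms(2))

text \<open>The type of plot predicates carries no axioms, so openness of domains, landing in
  \<open>A\<close> and stability under restriction have to travel along with separation and
  reflexivity.\<close>

definition good_diffeology :: "'a set \<Rightarrow> 'a diffeology \<Rightarrow> bool" where
  "good_diffeology A DA \<longleftrightarrow>
     (\<forall>k U P. DA k U P \<longrightarrow> openR k U \<and> P ` U \<subseteq> A) \<and>
     (\<forall>k U V P. DA k U P \<and> openR k V \<and> V \<subseteq> U \<longrightarrow> DA k V P) \<and>
     (\<forall>p\<in>A. \<forall>q\<in>A. p \<noteq> q \<longrightarrow> (\<exists>g. smooth_fun A DA g \<and> g p \<noteq> g q)) \<and>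
     reflexive_diff A DA"

locale regular_attachment =
  fixes n :: nat and J :: "'j set" and m :: "'j \<Rightarrow> nat" and A :: "'a set" and DA :: "'a diffeology"
    and h :: "'j \<times> rvec \<Rightarrow> 'a" and B :: "'a set" and DB :: "'a diffeology" and Phi :: "'j \<times> rvec \<Rightarrow> 'a"
  assumes po: "cell_pushout n J m A DA h B DB Phi"
    and ind: "induction (cellsS n J m) (sumD J (\<lambda>j. n + m j) (\<lambda>j. Snm n (m j))) A DA h"
    and dop: "D_open A DA (h ` cellsS n J m)"
    and good: "good_diffeology A DA"
begin

abbreviation "D \<equiv> cellsD n J m"
abbreviation "S \<equiv> cellsS n J m"

lemma DA_open: "DA k U P \<Longrightarrow> openR k U" and DA_sub: "DA k U P \<Longrightarrow> P ` U \<subseteq> A"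
  using good[unfolded good_diffeology_def, THEN conjunct1] by simp_all

lemma DA_restrict: "DA k U P \<Longrightarrow> openR k V \<Longrightarrow> V \<subseteq> U \<Longrightarrow> DA k V P"
  using good[unfolded good_diffeology_def, THEN conjunct2, THEN conjunct1] by simp

lemma DA_sep: "p \<in> A \<Longrightarrow> q \<in> A \<Longrightarrow> p \<noteq> q \<Longrightarrow> \<exists>g. smooth_fun A DA g \<and> g p \<noteq> g q"
  using good[unfolded good_diffeology_def, THEN conjunct2, THEN conjunct2, THEN conjunct1] by simp

lemma DA_reflexive: "pre_plot A DA k U P \<Longrightarrow> DA k U P"
  using good[unfolded good_diffeology_def, THEN conjunct2, THEN conjunct2, THEN conjunct2]
  by (simp add: reflexive_diff_def)

lemma B_eq: "B = A \<union> Phi ` D"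
  using po[unfolded cell_pushout_def, THEN conjunct1] .

lemma Phi_S: "c \<in> S \<Longrightarrow> Phi c = h c"
  using po[unfolded cell_pushout_def, THEN conjunct2, THEN conjunct1] by simp

lemma Phi_inj_interior: "inj_on Phi (D - S)"
  using po[unfolded cell_pushout_def, THEN conjunct2, THEN conjunct2, THEN conjunct1] .

lemma Phi_interior: "c \<in> D \<Longrightarrow> c \<notin> S \<Longrightarrow> Phi c \<notin> A"
  using po[unfolded cell_pushout_def, THEN conjunct2, THEN conjunct2, THEN conjunct2, THEN conjunct1] by auto

lemma DB_iff: "DB k U P \<longleftrightarrow> openR k U \<and> P ` U \<subseteq> B \<and>
   (\<forall>x\<in>U. \<exists>V. openR k V \<and> x \<in> V \<and> V \<subseteq> U \<and>
     ((\<exists>Q. DA k V Q \<and> (\<forall>y\<in>V. P y = Q y)) \<or>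
      (\<exists>Q. sumD J (\<lambda>j. n + m j) (\<lambda>j. Dnm n (m j)) k V Q \<and> (\<forall>y\<in>V. P y = Phi (Q y)))))"
  using po[unfolded cell_pushout_def, THEN conjunct2, THEN conjunct2, THEN conjunct2, THEN conjunct2] by simp

lemma h_inj: "inj_on h S"
  and h_A: "c \<in> S \<Longrightarrow> h c \<in> A"
  and h_plot: "sumD J (\<lambda>j. n + m j) (\<lambda>j. Snm n (m j)) k U Q \<Longrightarrow> DA k U (h \<circ> Q)"
  and h_inv_plot: "DA k U P \<Longrightarrow> P ` U \<subseteq> h ` S \<Longrightarrow>
    sumD J (\<lambda>j. n + m j) (\<lambda>j. Snm n (m j)) k U (inv_into S h \<circ> P)"
  using ind unfolding induction_def smooth_between_def by auto

lemma S_sub_D: "S \<subseteq> D"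
  using Snm_subset_Dnm by (fastforce simp: cellsS_def cellsD_def)

lemma in_S: "(j, w) \<in> S \<longleftrightarrow> j \<in> J \<and> w \<in> Rk (n + m j) \<and> 1 \<le> usq n w"
  by (auto simp: cellsS_def Snm_iff)

lemma in_D_Rk: "(j, w) \<in> D \<Longrightarrow> j \<in> J \<and> w \<in> Rk (n + m j)"
  by (auto simp: cellsD_def Dnm_def)

text \<open>On shells this is injectivity of \<open>h\<close>, on open cells a property of the
  pushout; a shell point and an interior point differ because only the former lands in
  \<open>A\<close>.\<close>

lemma Phi_inj: "inj_on Phi D"
proof (rule inj_onI)
  fix c d assume cd: "c \<in> D" "d \<in> D" "Phi c = Phi d"
  consider "c \<in> S" "d \<in> S" | "c \<in> S" "d \<notin> S" | "c \<notin> S" "d \<in> S" | "c \<notin> S" "d \<notin> S" by blast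
  thus "c = d"
  proof cases
    case 1 thus ?thesis using cd(3) Phi_S h_inj by (metis inj_onD)
  next
    case 2 thus ?thesis using cd Phi_interior[of d] Phi_S[of c] h_A[of c] by simp
  next
    case 3 thus ?thesis using cd Phi_interior[of c] Phi_S[of d] h_A[of d] by simp
  next
    case 4 thus ?thesis using cd Phi_inj_interior by (meson DiffI inj_onD)
  qed
qed

section \<open>Smooth functions on the pushout\<close>

definition glue :: "('a \<Rightarrow> real) \<Rightarrow> ('j \<times> rvec \<Rightarrow> real) \<Rightarrow> 'a \<Rightarrow> real" where
  "glue g E p = (if p \<in> A then g p else E (inv_into D Phi p))"

lemma glue_A: "p \<in> A \<Longrightarrow> glue g E p = g p"
  by (simp add: glue_def)

lemma glue_Phi:
  assumes "\<And>c. c \<in> S \<Longrightarrow> E c = g (h c)" "c \<in> D"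
  shows "glue g E (Phi c) = E c"
proof (cases "c \<in> S")
  case True thus ?thesis using assms h_A by (simp add: glue_def Phi_S)
next
  case False thus ?thesis using assms(2) Phi_interior Phi_inj by (simp add: glue_def)
qed

text \<open>Asking for smoothness of \<open>E\<close> on all of \<open>Rk (n + m j)\<close> suits
  the subset diffeology: plots into a cell are smooth maps into the ambient space, so ordinary
  composition applies.\<close>

lemma glue_smooth:
  assumes g: "smooth_fun A DA g"
    and E: "\<And>j. j \<in> J \<Longrightarrow> smooth_real (n + m j) (Rk (n + m j)) (\<lambda>w. E (j, w))"
    and comp: "\<And>c. c \<in> S \<Longrightarrow> E c = g (h c)"
  shows "smooth_fun B DB (glue g E)"
  unfolding smooth_fun_def o_def
proof (intro allI impI)
  fix k U P assume P: "DB k U P"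
  hence U: "openR k U" by (simp add: DB_iff)
  show "smooth_real k U (\<lambda>x. glue g E (P x))"
  proof (rule smooth_real_local[OF openR_subset[OF U]])
    fix x assume "x \<in> U"
    with P obtain V where V: "openR k V" "x \<in> V" "V \<subseteq> U"
      "(\<exists>Q. DA k V Q \<and> (\<forall>y\<in>V. P y = Q y)) \<or>
       (\<exists>Q. sumD J (\<lambda>j. n + m j) (\<lambda>j. Dnm n (m j)) k V Q \<and> (\<forall>y\<in>V. P y = Phi (Q y)))"
      unfolding DB_iff by blast
    from V(4) show "\<exists>V. openR k V \<and> x \<in> V \<and> smooth_real k V (\<lambda>x. glue g E (P x))"
    proof (elim disjE exE conjE)
      fix Q assume Q: "DA k V Q" "\<forall>y\<in>V. P y = Q y"
      have "smooth_real k V (\<lambda>x. glue g E (P x))"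
        by (rule smooth_real_cong[OF V(1) smooth_fun_plot[OF g, OF Q(1)]])
          (use Q DA_sub[OF Q(1)] in \<open>auto simp: glue_A\<close>)
      thus ?thesis using V by blast
    next
      fix Q assume Q: "sumD J (\<lambda>j. n + m j) (\<lambda>j. Dnm n (m j)) k V Q" "\<forall>y\<in>V. P y = Phi (Q y)"
      then obtain T j R where T: "openR k T" "x \<in> T" "T \<subseteq> V" "j \<in> J" "smooth_map k T (n + m j) R"
        "R ` T \<subseteq> Dnm n (m j)" "\<forall>y\<in>T. Q y = (j, R y)" using V(2) unfolding sumD_def by blast
      have "smooth_real k T (\<lambda>y. E (j, R y))"
        by (rule smooth_real_compose[OF T(1) openR_Rk T(5) _ E[OF T(4)]])
          (use T(5) in \<open>auto simp: smooth_map_def\<close>)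
      moreover have "E (j, R y) = glue g E (P y)" if "y \<in> T" for y
      proof -
        have "(j, R y) \<in> D" using T(4,6) that by (auto simp: cellsD_def)
        moreover have "P y = Phi (j, R y)" using Q(2) T(3,7) that by auto
        ultimately show ?thesis using glue_Phi[where E = E and g = g, OF comp] by simp
      qed
      ultimately have "smooth_real k T (\<lambda>x. glue g E (P x))" by (rule smooth_real_cong[OF T(1)])
      thus ?thesis using T by blast
    qed
  qed
qed

lemma smooth_fun_zero: "smooth_fun A DA (\<lambda>p. 0)"
  unfolding smooth_fun_def o_def using DA_open smooth_real_const by blast

text \<open>\<open>h\<close> carries plots of the shell to plots of \<open>A\<close>, so
  \<open>g\<close> composed with \<open>h\<close> is smooth along them, which is exactly what
  \<open>shell_extension\<close> asks for.\<close>

lemma cell_extension: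
  assumes g: "smooth_fun A DA g" and j: "j \<in> J"
  shows "\<exists>F. smooth_real (n + m j) (Rk (n + m j)) F \<and> (\<forall>w\<in>Snm n (m j). F w = g (h (j, w)))"
proof -
  have "\<exists>F. smooth_real (n + m j) (Rk (n + m j)) F \<and> (\<forall>w. 1 \<le> usq n w \<longrightarrow> F w = g (h (j, w)))"
  proof (rule shell_extension)
    fix l V R assume V: "openR l V" and R: "smooth_map l V (n + m j) R"
      and r: "\<And>y. y \<in> V \<Longrightarrow> 1 \<le> usq n (R y)"
    have "sumD J (\<lambda>j. n + m j) (\<lambda>j. Snm n (m j)) l V (\<lambda>y. (j, R y))"
      by (rule sumD_I[where j = j and R = R]) (use V j r R in \<open>auto simp: Snm_iff smooth_map_def\<close>)
    from smooth_fun_plot[OF g, OF h_plot[OF this]]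
    show "smooth_real l V (\<lambda>y. g (h (j, R y)))" by (simp add: o_def)
  qed simp
  thus ?thesis by (auto simp: Snm_iff)
qed

lemma cells_extension:
  assumes g: "smooth_fun A DA g"
  obtains E where "\<And>j. j \<in> J \<Longrightarrow> smooth_real (n + m j) (Rk (n + m j)) (\<lambda>w. E (j, w))"
    "\<And>c. c \<in> S \<Longrightarrow> E c = g (h c)"
proof -
  from cell_extension[OF g] obtain F where F: "\<And>j. j \<in> J \<Longrightarrow> smooth_real (n + m j) (Rk (n + m j)) (F j)"
    "\<And>j w. j \<in> J \<Longrightarrow> w \<in> Snm n (m j) \<Longrightarrow> F j w = g (h (j, w))" by metis
  show ?thesis
    by (rule that[of "\<lambda>(j, w). F j w"]) (use F in \<open>auto simp: cellsS_def\<close>)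
qed

lemma extend_smooth_fun:
  assumes g: "smooth_fun A DA g"
  shows "\<exists>f. smooth_fun B DB f \<and> (\<forall>p\<in>A. f p = g p)"
  by (rule cells_extension[OF g]) (use glue_smooth[OF g] glue_A in blast)

text \<open>The factor \<open>ell (1 - usq n w)\<close> vanishes on the shells, so 0 on
  \<open>A\<close> is always compatible and \<open>e\<close> may vary from cell to cell without any
  uniform bound.\<close>

lemma interior_function:
  assumes "\<And>j. j \<in> J \<Longrightarrow> smooth_real (n + m j) (Rk (n + m j)) (\<lambda>w. e (j, w))"
  defines "E \<equiv> \<lambda>c. ell (1 - usq n (snd c)) * e c"
  shows "smooth_fun B DB (glue (\<lambda>p. 0) E)" "c \<in> D \<Longrightarrow> glue (\<lambda>p. 0) E (Phi c) = E c"
proof -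
  have comp: "E c = 0" if "c \<in> S" for c using that by (cases c) (simp add: E_def in_S)
  show "c \<in> D \<Longrightarrow> glue (\<lambda>p. 0) E (Phi c) = E c" by (rule glue_Phi) (simp_all add: comp)
  show "smooth_fun B DB (glue (\<lambda>p. 0) E)"
  proof (rule glue_smooth[OF smooth_fun_zero])
    fix j assume j: "j \<in> J"
    have "smooth_real (n + m j) (Rk (n + m j)) (\<lambda>w. ell (1 - usq n w) * e (j, w))"
      by (intro smooth_real_mult smooth_real_ell smooth_real_diff smooth_real_const smooth_real_usq'
          openR_Rk assms(1) j)
    thus "smooth_real (n + m j) (Rk (n + m j)) (\<lambda>w. E (j, w))" by (simp add: E_def)
  qed (simp add: comp)
qed

text \<open>Points of the base are separated by smooth functions, so the image of a compact part of a
  shell is closed along plots and a compactly supported function can be extended by zero.\<close>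
lemma bump_smooth:
  assumes j0: "j0 \<in> J" and \<beta>: "smooth_real (n + m j0) (Rk (n + m j0)) \<beta>"
    and K: "compact K" "K \<subseteq> Rk (n + m j0)" "\<And>w. w \<in> Rk (n + m j0) \<Longrightarrow> w \<notin> K \<Longrightarrow> \<beta> w = 0"
  defines "E \<equiv> \<lambda>(j, w). if j = j0 then \<beta> w else 0"
  shows "smooth_fun A DA (\<lambda>p. if p \<in> h ` S then E (inv_into S h p) else 0)"
    (is "smooth_fun A DA ?b")
  unfolding smooth_fun_def o_def
proof (intro allI impI)
  fix k U Q assume Q: "DA k U Q"
  note U = DA_open[OF Q]
  show "smooth_real k U (\<lambda>x. ?b (Q x))"
  proof (rule smooth_real_local[OF openR_subset[OF U]])
    fix x assume x: "x \<in> U"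
    show "\<exists>V. openR k V \<and> x \<in> V \<and> smooth_real k V (\<lambda>x. ?b (Q x))"
    proof (cases "Q x \<in> h ` S")
      case True
      \<comment> \<open>\<open>D\<close>-openness gives an open domain on which \<open>Q\<close>
        stays in the image of the shells; there the induction property lifts it.\<close>
      define V1 where "V1 = {y\<in>U. Q y \<in> h ` S}"
      have V1: "openR k V1" using dop Q unfolding D_open_def V1_def by blast
      have "DA k V1 Q" by (rule DA_restrict[OF Q V1]) (simp add: V1_def)
      hence "sumD J (\<lambda>j. n + m j) (\<lambda>j. Snm n (m j)) k V1 (inv_into S h \<circ> Q)"
        by (rule h_inv_plot) (auto simp: V1_def)
      moreover have "x \<in> V1" using x True by (simp add: V1_def)
      ultimately obtain T j R where T: "openR k T" "x \<in> T" "T \<subseteq> V1" "j \<in> J" "smooth_map k T (n + m j) R"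
        "\<forall>y\<in>T. (inv_into S h \<circ> Q) y = (j, R y)" unfolding sumD_def by blast
      have "smooth_real k T (\<lambda>y. E (j, R y))"
      proof (cases "j = j0")
        case True
        have "smooth_real k T (\<lambda>y. \<beta> (R y))"
          by (rule smooth_real_compose[OF T(1) openR_Rk _ _ \<beta>]) (use T(5) True in \<open>auto simp: smooth_map_def\<close>)
        thus ?thesis using True by (simp add: E_def)
      next
        case False thus ?thesis by (simp add: E_def smooth_real_const[OF T(1)])
      qed
      hence "smooth_real k T (\<lambda>x. ?b (Q x))"
        by (rule smooth_real_cong[OF T(1)]) (use T(3,6) in \<open>auto simp: V1_def\<close>)
      thus ?thesis using T by blast
    next
      case False
      have "\<exists>V. openR k V \<and> x \<in> V \<and> V \<subseteq> U \<and> (\<forall>y\<in>V. \<not> (\<exists>w\<in>K. (j0, w) \<in> S \<and> Q y = h (j0, w)))"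
      proof (rule ccontr)
        assume "\<not> ?thesis"
        from not_near_sequence[OF U x this] obtain y where
          y: "\<And>i. y i \<in> U" "\<And>i. \<exists>w\<in>K. (j0, w) \<in> S \<and> Q (y i) = h (j0, w)" "y \<longlonglongrightarrow> x" by blast
        from y(2) obtain w where w: "\<And>i. w i \<in> K" "\<And>i. (j0, w i) \<in> S" "\<And>i. Q (y i) = h (j0, w i)" by metis
        obtain l r where l: "l \<in> K" "strict_mono (r :: nat \<Rightarrow> nat)" "(\<lambda>i. w (r i)) \<longlonglongrightarrow> l"
          by (rule compact_subseq[OF K(1) w(1)])
        have wR: "w i \<in> Rk (n + m j0)" for i using w(1) K(2) by blast
        have lR: "l \<in> Rk (n + m j0)" using l(1) K(2) by blast
        have "(\<lambda>i. usq n (w (r i))) \<longlonglongrightarrow> usq n l"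
          by (rule continuous_on_seq[OF smooth_real_continuous[OF smooth_real_usq'[OF openR_Rk]] wR lR l(3)])
        hence "1 \<le> usq n l" by (rule LIMSEQ_le_const) (use w(2) in \<open>auto simp: in_S\<close>)
        hence lS: "(j0, l) \<in> S" using lR j0 by (simp add: in_S)
        hence "h (j0, l) \<noteq> Q x" using False by (metis imageI)
        then obtain g where g: "smooth_fun A DA g" "g (h (j0, l)) \<noteq> g (Q x)"
          using DA_sep[OF h_A[OF lS]] DA_sub[OF Q] x by blast
        \<comment> \<open>So far \<open>g\<close> composed with \<open>h\<close> is controlled only
          along plots; the extension \<open>F\<close> is continuous on the ambient space and passes
          to the limit \<open>l\<close>.\<close>
        obtain F where F: "smooth_real (n + m j0) (Rk (n + m j0)) F" "\<forall>w\<in>Snm n (m j0). F w = g (h (j0, w))"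
          using cell_extension[OF g(1) j0] by blast
        have FS: "F w = g (h (j0, w))" if "(j0, w) \<in> S" for w using F(2) that by (simp add: cellsS_def)
        have "(\<lambda>i. F (w (r i))) \<longlonglongrightarrow> F l"
          by (rule continuous_on_seq[OF smooth_real_continuous[OF F(1)] wR lR l(3)])
        hence "(\<lambda>i. g (Q (y (r i)))) \<longlonglongrightarrow> g (h (j0, l))" using FS[OF w(2)] FS[OF lS] w(3) by simp
        moreover have "(\<lambda>i. g (Q (y (r i)))) \<longlonglongrightarrow> g (Q x)"
          by (rule continuous_on_seq[OF smooth_real_continuous[OF smooth_fun_plot[OF g(1), OF Q]] y(1) x])
            (use LIMSEQ_subseq_LIMSEQ[OF y(3) l(2)] in \<open>simp add: o_def\<close>)
        ultimately show False using g(2) LIMSEQ_unique by blast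
      qed
      then obtain V where V: "openR k V" "x \<in> V" "V \<subseteq> U"
        "\<And>y. y \<in> V \<Longrightarrow> \<not> (\<exists>w\<in>K. (j0, w) \<in> S \<and> Q y = h (j0, w))" by blast
      have "smooth_real k V (\<lambda>x. ?b (Q x))"
      proof (rule smooth_real_cong[OF V(1) smooth_real_const[OF V(1), of 0]])
        fix y assume y: "y \<in> V"
        show "0 = ?b (Q y)"
        proof (cases "Q y \<in> h ` S")
          case True
          then obtain j w where jw: "(j, w) \<in> S" "Q y = h (j, w)" by auto
          hence "inv_into S h (Q y) = (j, w)" using h_inj by simp
          moreover have "E (j, w) = 0" using V(4)[OF y] K(3)[of w] jw by (auto simp: E_def in_S)
          ultimately show ?thesis by simp
        qed simp
      qed
      thus ?thesis using V by blast
    qed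
  qed
qed

text \<open>A nonzero value certifies that a point lies in the closed cell \<open>j0\<close>. This
  works at boundary points too, where functions supported in the open cell give no
  information.\<close>

lemma bump_glue:
  assumes j0: "j0 \<in> J" and \<beta>: "smooth_real (n + m j0) (Rk (n + m j0)) \<beta>"
    and K: "compact K" "K \<subseteq> Rk (n + m j0)" "\<And>w. w \<in> Rk (n + m j0) \<Longrightarrow> w \<notin> K \<Longrightarrow> \<beta> w = 0"
  shows "\<exists>f. smooth_fun B DB f \<and> (\<forall>j w. (j, w) \<in> D \<longrightarrow> f (Phi (j, w)) = (if j = j0 then \<beta> w else 0)) \<and>
    (\<forall>p\<in>B - Phi ` D. f p = 0)"
proof -
  define E where "E = (\<lambda>(j, w). if j = j0 then \<beta> w else 0)"
  let ?b = "\<lambda>p. if p \<in> h ` S then E (inv_into S h p) else 0"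
  have b: "smooth_fun A DA ?b" unfolding E_def by (rule bump_smooth[OF assms])
  have comp: "E c = ?b (h c)" if "c \<in> S" for c using that h_inj by simp
  have "smooth_fun B DB (glue ?b E)"
  proof (rule glue_smooth[OF b _ comp])
    show "smooth_real (n + m j) (Rk (n + m j)) (\<lambda>w. E (j, w))" for j
      using \<beta> smooth_real_const[OF openR_Rk] by (cases "j = j0") (simp_all add: E_def)
  qed
  moreover have "glue ?b E (Phi (j, w)) = (if j = j0 then \<beta> w else 0)" if "(j, w) \<in> D" for j w
    using glue_Phi[of E ?b, OF comp that] by (simp add: E_def)
  moreover have "glue ?b E p = 0" if "p \<in> B - Phi ` D" for p
  proof -
    have "p \<in> A" using that B_eq by blast
    moreover have "p \<notin> h ` S" 
    proof
      assume "p \<in> h ` S"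
      then obtain c where "c \<in> S" "p = h c" by blast
      hence "p = Phi c" "c \<in> D" using Phi_S S_sub_D by auto
      thus False using that by blast
    qed
    ultimately show ?thesis by (simp add: glue_A)
  qed
  ultimately show ?thesis by blast
qed

section \<open>Pre-plots of the pushout are plots\<close>

lemma pre_plot_lift:
  assumes P: "pre_plot B DB k U P" and x: "x \<in> U" and c: "(j0, c) \<in> D" "P x = Phi (j0, c)"
  shows "\<exists>V R. openR k V \<and> x \<in> V \<and> V \<subseteq> U \<and> smooth_map k V (n + m j0) R \<and> R ` V \<subseteq> Dnm n (m j0) \<and>
    (\<forall>y\<in>V. P y = Phi (j0, R y))"
proof -
  let ?N = "n + m j0"
  have U: "openR k U" and PB: "P ` U \<subseteq> B" using P by (auto simp: pre_plot_def)
  have Pf: "smooth_real k U (\<lambda>y. f (P y))" if "smooth_fun B DB f" for f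
    using P that by (auto simp: pre_plot_def o_def)
  have j0: "j0 \<in> J" and cR: "c \<in> Rk ?N" using in_D_Rk[OF c(1)] by auto
  let ?\<beta> = "\<lambda>w. ell (1 - (\<Sum>i<?N. (w i - c i)^2))"
  let ?K = "{w \<in> Rk ?N. (\<Sum>i<?N. (w i - c i)^2) \<le> 1^2}"
  have \<beta>: "smooth_real ?N (Rk ?N) ?\<beta>"
    by (intro smooth_real_ell smooth_real_diff smooth_real_sum smooth_real_power smooth_real_const
        smooth_real_coord openR_Rk)
  have K: "compact ?K" by (rule compact_Rk_cball[OF cR])
  have K0: "?\<beta> w = 0" if "w \<in> Rk ?N" "w \<notin> ?K" for w using that by simp
  obtain f where f: "smooth_fun B DB f" "\<And>j w. (j, w) \<in> D \<Longrightarrow> f (Phi (j, w)) = (if j = j0 then ?\<beta> w else 0)"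
    "\<And>p. p \<in> B - Phi ` D \<Longrightarrow> f p = 0"
    using bump_glue[OF j0 \<beta> K _ K0] by blast
  have "\<exists>f. smooth_fun B DB f \<and> (\<forall>j w. (j, w) \<in> D \<longrightarrow> f (Phi (j, w)) = (if j = j0 then ?\<beta> w * w i else 0))" for i
    using bump_glue[OF j0 smooth_real_mult[OF openR_Rk \<beta> smooth_real_coord[OF openR_Rk, of _ i]] K] K0 by auto
  hence "\<forall>i. \<exists>f. smooth_fun B DB f \<and> (\<forall>j w. (j, w) \<in> D \<longrightarrow> f (Phi (j, w)) = (if j = j0 then ?\<beta> w * w i else 0))"
    by (rule allI)
  from choice[OF this] obtain fi where "\<forall>i. smooth_fun B DB (fi i) \<and>
    (\<forall>j w. (j, w) \<in> D \<longrightarrow> fi i (Phi (j, w)) = (if j = j0 then ?\<beta> w * w i else 0))" by (elim exE)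
  hence fi: "\<And>i. smooth_fun B DB (fi i)"
    "\<And>i j w. (j, w) \<in> D \<Longrightarrow> fi i (Phi (j, w)) = (if j = j0 then ?\<beta> w * w i else 0)" by simp_all
  \<comment> \<open>\<open>f\<close> vanishes on the other cells and off all cells, so positivity
    confines \<open>P\<close> to the cell \<open>j0\<close> near \<open>x\<close>.\<close>
  define V where "V = {y\<in>U. f (P y) \<in> {0<..}}"
  have V: "openR k V" unfolding V_def
    by (rule openR_vimage[OF U smooth_real_continuous[OF Pf[OF f(1)]]]) simp
  have xV: "x \<in> V" using x c f(2)[OF c(1)] by (simp add: V_def)
  have "\<exists>w. (j0, w) \<in> D \<and> P y = Phi (j0, w)" if y: "y \<in> V" for y
  proof -
    have "f (P y) \<noteq> 0" "P y \<in> B" using y PB by (auto simp: V_def)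
    hence "P y \<in> Phi ` D" using f(3) by blast
    then obtain j w where jw: "(j, w) \<in> D" "P y = Phi (j, w)" by auto
    hence "j = j0" using f(2)[OF jw(1)] \<open>f (P y) \<noteq> 0\<close> by (auto split: if_splits)
    thus ?thesis using jw by blast
  qed
  then obtain R where R: "\<And>y. y \<in> V \<Longrightarrow> (j0, R y) \<in> D" "\<And>y. y \<in> V \<Longrightarrow> P y = Phi (j0, R y)" by metis
  have "smooth_map k V ?N R" unfolding smooth_map_def
  proof (intro conjI ballI allI impI)
    show "R y \<in> Rk ?N" if "y \<in> V" for y using in_D_Rk[OF R(1)[OF that]] by simp
    fix i
    have VU: "V \<subseteq> U" by (auto simp: V_def)
    have nz: "f (P y) \<noteq> 0" if "y \<in> V" for y using that by (auto simp: V_def)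
    \<comment> \<open>The lift \<open>R\<close> was chosen pointwise; the quotient recovers its
      coordinate \<open>i\<close> from two smooth functions on \<open>B\<close>, so its smoothness
      follows afterwards.\<close>
    have "smooth_real k V (\<lambda>y. fi i (P y) / f (P y))"
      by (intro smooth_real_divide V smooth_real_subset[OF Pf VU] f(1) fi(1) nz)
    thus "smooth_real k V (\<lambda>y. R y i)"
    proof (rule smooth_real_cong[OF V])
      fix y assume y: "y \<in> V"
      have "f (P y) = ?\<beta> (R y)" using f(2)[OF R(1)[OF y]] R(2)[OF y] by simp
      moreover have "fi i (P y) = ?\<beta> (R y) * R y i" using fi(2)[OF R(1)[OF y]] R(2)[OF y] by simp
      ultimately show "fi i (P y) / f (P y) = R y i" using nz[OF y] by simp
    qed
  qed
  moreover have "R ` V \<subseteq> Dnm n (m j0)" using R(1) by (auto simp: cellsD_def)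
  moreover have "V \<subseteq> U" by (auto simp: V_def)
  ultimately show ?thesis using V xV R(2) by blast
qed

text \<open>A bump certifies membership in one closed cell, but staying in \<open>A\<close> means
  avoiding all open cells at once, possibly infinitely many; hence the indirect argument along a
  sequence of violations.\<close>

lemma pre_plot_stays_in_base:
  assumes P: "pre_plot B DB k U P" and x: "x \<in> U" and Px: "P x \<in> A" "P x \<notin> h ` S"
  shows "\<exists>V. openR k V \<and> x \<in> V \<and> V \<subseteq> U \<and> (\<forall>y\<in>V. P y \<in> A)"
proof (rule ccontr)
  assume no: "\<not> ?thesis"
  have U: "openR k U" and PB: "P ` U \<subseteq> B" using P by (auto simp: pre_plot_def)
  have Pf: "smooth_real k U (\<lambda>y. f (P y))" if "smooth_fun B DB f" for f
    using P that by (auto simp: pre_plot_def o_def)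
  obtain y where y: "\<And>i. y i \<in> U" "\<And>i. P (y i) \<notin> A" "y \<longlonglongrightarrow> x"
    using not_near_sequence[OF U x no] by blast
  have lim: "(\<lambda>i. f (P (y i))) \<longlonglongrightarrow> f (P x)" if "smooth_fun B DB f" for f
    by (rule continuous_on_seq[OF smooth_real_continuous[OF Pf[OF that]] y(1) x y(3)])
  have "\<exists>j w. (j, w) \<in> D \<and> P (y i) = Phi (j, w)" for i
  proof -
    have "P (y i) \<in> Phi ` D" using y(1,2)[of i] PB B_eq by blast
    thus ?thesis by auto
  qed
  then obtain jj w where jw: "\<And>i. (jj i, w i) \<in> D" "\<And>i. P (y i) = Phi (jj i, w i)" by metis
  have notS: "(jj i, w i) \<notin> S" for i using jw(2)[of i] y(2)[of i] Phi_S h_A by auto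
  have jJ: "jj i \<in> J" and wR: "w i \<in> Rk (n + m (jj i))" for i using in_D_Rk[OF jw(1)] by auto
  have small: "usq n (w i) < 1" for i using notS[of i] jJ wR by (auto simp: in_S)

  text \<open>The plot meets only finitely many open cells: otherwise rescale the function
    \<open>ell (1 - usq n w)\<close> on each of these cells to take the value 1 along the sequence.\<close>
  define i0 where "i0 j = (LEAST i. jj i = j)" for j
  define c where "c j = 1 / ell (1 - usq n (w (i0 j)))" for j
  define E1 where "E1 = (\<lambda>d. ell (1 - usq n (snd d)) * c (fst d))"
  have E1: "smooth_fun B DB (glue (\<lambda>p. 0) E1)" "\<And>d. d \<in> D \<Longrightarrow> glue (\<lambda>p. 0) E1 (Phi d) = E1 d"
    using interior_function[of "\<lambda>d. c (fst d)"] smooth_real_const[OF openR_Rk]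
    by (simp_all add: E1_def)
  have i0: "jj (i0 (jj i)) = jj i" for i unfolding i0_def by (rule LeastI[of _ i]) simp
  \<comment> \<open>The function is 0 at \<open>P x\<close>, which lies in \<open>A\<close>, yet 1
    at the first visit to each cell; so all first visits happen before some index
    \<open>I\<close>.\<close>
  have "(\<lambda>i. glue (\<lambda>p. 0) E1 (P (y i))) \<longlonglongrightarrow> 0"
    using lim[OF E1(1)] Px(1) by (simp add: glue_A)
  hence "eventually (\<lambda>i. glue (\<lambda>p. 0) E1 (P (y i)) < 1) sequentially" by (rule order_tendstoD) simp
  then obtain I where I: "\<And>i. i \<ge> I \<Longrightarrow> glue (\<lambda>p. 0) E1 (P (y i)) < 1"
    unfolding eventually_sequentially by blast
  have "i0 (jj i) < I" for i
  proof (rule ccontr)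
    assume "\<not> i0 (jj i) < I"
    hence "glue (\<lambda>p. 0) E1 (P (y (i0 (jj i)))) < 1" using I by simp
    moreover have "glue (\<lambda>p. 0) E1 (P (y (i0 (jj i)))) = E1 (jj (i0 (jj i)), w (i0 (jj i)))"
      using E1(2)[OF jw(1)] jw(2) by simp
    moreover have "\<dots> = ell (1 - usq n (w (i0 (jj i)))) * (1 / ell (1 - usq n (w (i0 (jj i)))))"
      unfolding i0 by (simp add: E1_def c_def)
    moreover have "\<dots> = 1" using small[of "i0 (jj i)"] by simp
    ultimately show False by simp
  qed
  hence "range jj \<subseteq> jj ` {..<I}" using i0 by (metis imageI image_subsetI lessThan_iff)
  hence "finite (range jj)" by (rule finite_subset) simp
  from pigeonhole_infinite[OF infinite_UNIV_nat this]
  obtain i1 where "infinite {i. jj i = jj i1}" by auto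
  from infinite_enumerate[OF this]
  obtain r where r: "strict_mono (r :: nat \<Rightarrow> nat)" "\<And>i. jj (r i) = jj i1" by auto
  define j where "j = jj i1"
  let ?N = "n + m j"
  let ?K = "{w \<in> Rk ?N. (\<Sum>i<?N. (w i - 0)^2) \<le> 3^2}"
  have j: "j \<in> J" using jJ by (simp add: j_def)
  have wD: "(j, w (r i)) \<in> D" and wS: "(j, w (r i)) \<notin> S" for i
    using jw(1)[of "r i"] notS[of "r i"] r(2)[of i] by (simp_all add: j_def)
  have wK: "w (r i) \<in> ?K" for i
    using Dnm_minus_Snm_bounded[of "w (r i)" n "m j"] wD[of i] wS[of i] in_D_Rk[OF wD[of i]]
    by (simp add: cellsD_def cellsS_def)
  have "(\<lambda>_. 0) \<in> Rk ?N" by (simp add: Rk_def)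
  hence "compact ?K" using compact_Rk_cball[of "\<lambda>_. 0" ?N 3] by simp
  then obtain l s where l: "l \<in> ?K" "strict_mono (s :: nat \<Rightarrow> nat)" "(\<lambda>i. w (r (s i))) \<longlonglongrightarrow> l"
    by (rule compact_subseq[OF _ wK])
  have lR: "l \<in> Rk ?N" using l(1) by simp
  have wRr: "w (r i) \<in> Rk ?N" for i using wK[of i] by simp
  have lim2: "(\<lambda>i. f (P (y (r (s i))))) \<longlonglongrightarrow> f (P x)" if "smooth_fun B DB f" for f
    using LIMSEQ_subseq_LIMSEQ[OF lim[OF that] strict_mono_o[OF r(1) l(2)]] by (simp add: o_def)
  have Pw: "P (y (r i)) = Phi (j, w (r i))" for i using jw(2)[of "r i"] r(2)[of i] by (simp add: j_def)
  have cl: "(\<lambda>i. f (w (r (s i)))) \<longlonglongrightarrow> f l" if "smooth_real ?N (Rk ?N) f" for f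
    by (rule continuous_on_seq[OF smooth_real_continuous[OF that] wRr lR l(3)])
  \<comment> \<open>Either way one sequence gets two limits. If \<open>usq n l < 1\<close>, the
    values of \<open>ell\<close> tend to a positive number and to the value 0 at \<open>P x\<close>;
    on the shell, the glued extension of \<open>g\<close> tends to both \<open>g (h (j, l))\<close>
    and \<open>g (P x)\<close>.\<close>
  show False
  proof (cases "1 \<le> usq n l")
    case False
    define E2 where "E2 = (\<lambda>d::'j \<times> rvec. ell (1 - usq n (snd d)) * 1)"
    have E2: "smooth_fun B DB (glue (\<lambda>p. 0) E2)" "\<And>d. d \<in> D \<Longrightarrow> glue (\<lambda>p. 0) E2 (Phi d) = E2 d"
      using interior_function[of "\<lambda>d. 1"] smooth_real_const[OF openR_Rk]
      by (simp_all add: E2_def)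
    have "(\<lambda>i. ell (1 - usq n (w (r (s i))))) \<longlonglongrightarrow> ell (1 - usq n l)"
      by (rule cl) (intro smooth_real_ell smooth_real_diff smooth_real_const smooth_real_usq' openR_Rk)
    moreover have "(\<lambda>i. ell (1 - usq n (w (r (s i))))) \<longlonglongrightarrow> 0"
      using lim2[OF E2(1)] Px(1) E2(2)[OF wD] by (simp add: glue_A Pw E2_def)
    ultimately have "ell (1 - usq n l) = 0" by (rule LIMSEQ_unique)
    thus False using False by simp
  next
    case True
    hence lS: "(j, l) \<in> S" using lR j by (simp add: in_S)
    hence "h (j, l) \<noteq> P x" using Px(2) by (metis imageI)
    then obtain g where g: "smooth_fun A DA g" "g (h (j, l)) \<noteq> g (P x)"
      using DA_sep[OF h_A[OF lS] Px(1)] by blast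
    obtain E where E: "\<And>j. j \<in> J \<Longrightarrow> smooth_real (n + m j) (Rk (n + m j)) (\<lambda>w. E (j, w))"
      "\<And>c. c \<in> S \<Longrightarrow> E c = g (h c)" by (rule cells_extension[OF g(1), OF that])
    have "(\<lambda>i. glue g E (P (y (r (s i))))) \<longlonglongrightarrow> g (P x)"
      using lim2[OF glue_smooth[OF g(1) E]] Px(1) by (simp add: glue_A)
    moreover have "glue g E (P (y (r i))) = E (j, w (r i))" for i
      unfolding Pw by (rule glue_Phi[where E = E and g = g, OF E(2) wD])
    moreover have "(\<lambda>i. E (j, w (r (s i)))) \<longlonglongrightarrow> g (h (j, l))"
      using cl[OF E(1)[OF j]] E(2)[OF lS] by simp
    ultimately show False using g(2) LIMSEQ_unique by fastforce
  qed
qed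

lemma pre_plot_is_plot:
  assumes P: "pre_plot B DB k U P"
  shows "DB k U P"
  unfolding DB_iff
proof (intro conjI ballI)
  show U: "openR k U" and PB: "P ` U \<subseteq> B" using P by (auto simp: pre_plot_def)
  fix x assume x: "x \<in> U"
  show "\<exists>V. openR k V \<and> x \<in> V \<and> V \<subseteq> U \<and> ((\<exists>Q. DA k V Q \<and> (\<forall>y\<in>V. P y = Q y)) \<or>
     (\<exists>Q. sumD J (\<lambda>j. n + m j) (\<lambda>j. Dnm n (m j)) k V Q \<and> (\<forall>y\<in>V. P y = Phi (Q y))))"
  proof (cases "P x \<in> Phi ` D")
    case True
    then obtain j c where c: "(j, c) \<in> D" "P x = Phi (j, c)" by auto
    from pre_plot_lift[OF P x c] obtain V R where V: "openR k V" "x \<in> V" "V \<subseteq> U"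
      "smooth_map k V (n + m j) R" "R ` V \<subseteq> Dnm n (m j)" "\<forall>y\<in>V. P y = Phi (j, R y)" by blast
    have "sumD J (\<lambda>j. n + m j) (\<lambda>j. Dnm n (m j)) k V (\<lambda>y. (j, R y))"
      by (rule sumD_I[where j = j and R = R]) (use V in_D_Rk[OF c(1)] in auto)
    thus ?thesis using V by blast
  next
    case False
    hence PA: "P x \<in> A" using x PB B_eq by blast
    have "P x \<notin> h ` S"
    proof
      assume "P x \<in> h ` S"
      then obtain d where "d \<in> S" "P x = h d" by blast
      thus False using False Phi_S S_sub_D by (metis imageI subsetD)
    qed
    from pre_plot_stays_in_base[OF P x PA this]
    obtain V where V: "openR k V" "x \<in> V" "V \<subseteq> U" "\<forall>y\<in>V. P y \<in> A" by blast
    have "pre_plot A DA k V P" unfolding pre_plot_def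
    proof (intro conjI allI impI)
      fix g assume g: "smooth_fun A DA g"
      then obtain f where f: "smooth_fun B DB f" "\<forall>p\<in>A. f p = g p" using extend_smooth_fun by blast
      have "smooth_real k U (f \<circ> P)" using P f(1) by (simp add: pre_plot_def)
      from smooth_real_cong[OF V(1) smooth_real_subset[OF this V(3)], of "g \<circ> P"]
      show "smooth_real k V (g \<circ> P)" using f(2) V(4) by simp
    qed (use V in auto)
    thus ?thesis using V DA_reflexive by blast
  qed
qed

section \<open>Base plots, restriction and separation on the pushout\<close>

lemma base_plot: "DA k U P \<Longrightarrow> DB k U P"
  unfolding DB_iff using DA_open DA_sub B_eq by blast

lemma DB_restrict:
  assumes P: "DB k U P" and V: "openR k V" "V \<subseteq> U"
  shows "DB k V P"
  unfolding DB_iff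
proof (intro conjI ballI)
  show "P ` V \<subseteq> B" using P V(2) unfolding DB_iff by blast
  fix x assume x: "x \<in> V"
  with P V(2) obtain T where T: "openR k T" "x \<in> T" "T \<subseteq> U" "(\<exists>Q. DA k T Q \<and> (\<forall>y\<in>T. P y = Q y)) \<or>
      (\<exists>Q. sumD J (\<lambda>j. n + m j) (\<lambda>j. Dnm n (m j)) k T Q \<and> (\<forall>y\<in>T. P y = Phi (Q y)))"
    unfolding DB_iff by blast
  have TV: "openR k (T \<inter> V)" by (rule openR_Int[OF T(1) V(1)])
  have "(\<exists>Q. DA k (T \<inter> V) Q \<and> (\<forall>y\<in>T \<inter> V. P y = Q y)) \<or>
      (\<exists>Q. sumD J (\<lambda>j. n + m j) (\<lambda>j. Dnm n (m j)) k (T \<inter> V) Q \<and> (\<forall>y\<in>T \<inter> V. P y = Phi (Q y)))"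
    using T(4) DA_restrict[OF _ TV] sumD_restrict[OF _ TV] by (meson Int_iff Int_lower1)
  thus "\<exists>V'. openR k V' \<and> x \<in> V' \<and> V' \<subseteq> V \<and> ((\<exists>Q. DA k V' Q \<and> (\<forall>y\<in>V'. P y = Q y)) \<or>
      (\<exists>Q. sumD J (\<lambda>j. n + m j) (\<lambda>j. Dnm n (m j)) k V' Q \<and> (\<forall>y\<in>V'. P y = Phi (Q y))))"
    using TV T(2) x by (intro exI[of _ "T \<inter> V"] conjI) auto
qed (rule V(1))

text \<open>Multiples of \<open>ell (1 - usq n w)\<close> supported in the open cell of
  \<open>c\<close> suffice: the plain factor recognises the cell, and the products with the
  coordinates, divided by it, recognise the point.\<close>

lemma interior_separated:
  assumes c: "c \<in> D" "c \<notin> S" and q: "q \<in> B" "q \<noteq> Phi c"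
  shows "\<exists>f. smooth_fun B DB f \<and> f (Phi c) \<noteq> f q"
proof -
  obtain j w where jw: "c = (j, w)" by (cases c)
  have j: "j \<in> J" "w \<in> Rk (n + m j)" using in_D_Rk c(1) jw by auto
  hence lw: "ell (1 - usq n w) > 0" using c(2) by (auto simp: jw in_S)
  define E where "E e = (\<lambda>d. ell (1 - usq n (snd d)) * (if fst d = j then e (snd d) else 0))" for e
  have E: "smooth_fun B DB (glue (\<lambda>p. 0) (E e))" "\<And>d. d \<in> D \<Longrightarrow> glue (\<lambda>p. 0) (E e) (Phi d) = E e d"
    if e: "smooth_real (n + m j) (Rk (n + m j)) e" for e
  proof -
    have "smooth_real (n + m j') (Rk (n + m j')) (\<lambda>w. if fst (j', w) = j then e (snd (j', w)) else 0)" for j'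
      using e smooth_real_const[OF openR_Rk] by (cases "j' = j") simp_all
    note F = interior_function[of "\<lambda>d. if fst d = j then e (snd d) else 0", OF this]
    show "smooth_fun B DB (glue (\<lambda>p. 0) (E e))" unfolding E_def by (rule F(1))
    show "glue (\<lambda>p. 0) (E e) (Phi d) = E e d" if "d \<in> D" for d unfolding E_def by (rule F(2)[OF that])
  qed
  have s1: "smooth_real (n + m j) (Rk (n + m j)) (\<lambda>w. 1)" by (rule smooth_real_const[OF openR_Rk])
  have si: "smooth_real (n + m j) (Rk (n + m j)) (\<lambda>w. w i)" for i by (rule smooth_real_coord[OF openR_Rk])
  show ?thesis
  proof (cases "q \<in> A")
    case True
    have "glue (\<lambda>p. 0) (E (\<lambda>w. 1)) q = 0" using True by (simp add: glue_A)
    moreover have "glue (\<lambda>p. 0) (E (\<lambda>w. 1)) (Phi c) = ell (1 - usq n w)"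
      using E(2)[OF s1 c(1)] by (simp add: E_def jw)
    ultimately show ?thesis using E(1)[OF s1] lw by (metis less_irrefl)
  next
    case False
    then obtain j' w' where d: "(j', w') \<in> D" "q = Phi (j', w')" using q(1) B_eq by auto
    show ?thesis
    proof (rule ccontr)
      assume no: "\<not> ?thesis"
      have eq: "E e (j, w) = E e (j', w')" if "smooth_real (n + m j) (Rk (n + m j)) e" for e
        using no E(1)[OF that] E(2)[OF that c(1)] E(2)[OF that d(1)] d(2) jw by metis
      have one: "ell (1 - usq n w) = (if j' = j then ell (1 - usq n w') else 0)"
        using eq[OF s1] by (simp add: E_def split: if_splits)
      hence jj: "j' = j" using lw by (auto split: if_splits)
      have "w i = w' i" for i using eq[OF si, of i] one lw by (simp add: E_def jj)
      hence "w = w'" by (rule ext)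
      thus False using jj d(2) q(2) jw by simp
    qed
  qed
qed

lemma good_attachment: "good_diffeology B DB"
  unfolding good_diffeology_def
proof (intro conjI)
  show "\<forall>k U P. DB k U P \<longrightarrow> openR k U \<and> P ` U \<subseteq> B" by (simp add: DB_iff)
  show "\<forall>k U V P. DB k U P \<and> openR k V \<and> V \<subseteq> U \<longrightarrow> DB k V P" using DB_restrict by blast
  show "reflexive_diff B DB" using pre_plot_is_plot by (simp add: reflexive_diff_def)
  show "\<forall>p\<in>B. \<forall>q\<in>B. p \<noteq> q \<longrightarrow> (\<exists>g. smooth_fun B DB g \<and> g p \<noteq> g q)"
  proof (intro ballI impI)
    fix p q assume pq: "p \<in> B" "q \<in> B" "p \<noteq> q"
    have int: "\<exists>c\<in>D. c \<notin> S \<and> p = Phi c" if p: "p \<in> B" "p \<notin> A" for p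
    proof -
      obtain c where c: "c \<in> D" "p = Phi c" using p B_eq by blast
      moreover have "c \<notin> S" using c(2) p(2) Phi_S[of c] h_A[of c] by auto
      ultimately show ?thesis by blast
    qed
    consider "p \<in> A" "q \<in> A" | "p \<notin> A" | "q \<notin> A" by blast
    thus "\<exists>g. smooth_fun B DB g \<and> g p \<noteq> g q"
    proof cases
      case 1
      then obtain g where g: "smooth_fun A DA g" "g p \<noteq> g q" using DA_sep pq by blast
      then obtain f where "smooth_fun B DB f" "\<forall>p\<in>A. f p = g p" using extend_smooth_fun by blast
      thus ?thesis using 1 g(2) by (intro exI[of _ f]) simp
    next
      case 2
      then obtain c where "c \<in> D" "c \<notin> S" "p = Phi c" using int pq(1) by blast
      thus ?thesis using interior_separated[of c q] pq by blast
    next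
      case 3
      then obtain c where c: "c \<in> D" "c \<notin> S" "q = Phi c" using int pq(2) by blast
      from interior_separated[OF c(1,2) pq(1)] pq(3) c(3) obtain f where
        "smooth_fun B DB f" "f q \<noteq> f p" by blast
      thus ?thesis by (intro exI[of _ f]) simp
    qed
  qed
qed

end

section \<open>Induction over the skeleta\<close>

lemma regular_CW_attachment_skel:
  assumes "regular_CW X DX Xs Ds J m h Phi" "good_diffeology (skel Xs n) (skelD Ds n)"
  shows "regular_attachment n (J n) (m n) (skel Xs n) (skelD Ds n) (h n) (Xs n) (Ds n) (Phi n)"
  using assms by unfold_locales (simp_all add: regular_CW_def fat_CW_def)

text \<open>The induction starts at the empty skeleton, whose maps have empty domain. The shells of
  0-cells are empty, so these cells are attached by the same step as all others.\<close>

lemma skel_good: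
  assumes "regular_CW X DX Xs Ds J m h Phi"
  shows "good_diffeology (skel Xs n) (skelD Ds n)"
proof (induction n)
  case 0
  have "openR k {}" for k by (rule openR_empty)
  thus ?case by (auto simp: good_diffeology_def skel_def skelD_def reflexive_diff_def pre_plot_def)
next
  case (Suc n)
  show ?case using regular_attachment.good_attachment[OF regular_CW_attachment_skel[OF assms Suc]]
    by (simp add: skel_def skelD_def)
qed

lemma regular_CW_attachment:
  assumes "regular_CW X DX Xs Ds J m h Phi"
  shows "regular_attachment (Suc n) (J (Suc n)) (m (Suc n)) (Xs n) (Ds n) (h (Suc n)) (Xs (Suc n)) (Ds (Suc n)) (Phi (Suc n))"
  using regular_CW_attachment_skel[OF assms skel_good[OF assms], of "Suc n"] by (simp add: skel_def skelD_def)

theorem theorem8p1: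
  fixes X :: "'a set" and DX :: "'a diffeology"
    and Xs :: "nat \<Rightarrow> 'a set" and Ds :: "nat \<Rightarrow> 'a diffeology"
    and J :: "nat \<Rightarrow> 'j set" and m :: "nat \<Rightarrow> 'j \<Rightarrow> nat"
    and h Phi :: "nat \<Rightarrow> 'j \<times> rvec \<Rightarrow> 'a" and N :: nat
  assumes "regular_CW X DX Xs Ds J m h Phi"
    and "X = Xs N"
  shows "reflexive_diff X DX"
proof -
  note att = regular_CW_attachment[OF assms(1)]
  have refl: "reflexive_diff (Xs N) (Ds N)"
    using skel_good[OF assms(1), of "Suc N"] by (simp add: skel_def skelD_def good_diffeology_def)
  have DX: "DX k U P \<longleftrightarrow> openR k U \<and> P ` U \<subseteq> X \<and>
        (\<forall>x\<in>U. \<exists>V. openR k V \<and> x \<in> V \<and> V \<subseteq> U \<and>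
           (\<exists>n Q. Ds n k V Q \<and> (\<forall>y\<in>V. P y = Q y)))" for k U P
    using assms(1) unfolding regular_CW_def fat_CW_def by blast
  have up: "Ds (n + d) k V Q" if "Ds n k V Q" for n d k V Q
    by (induction d) (use that regular_attachment.base_plot[OF att] in simp_all)
  \<comment> \<open>A plot of \<open>DX\<close> may factor through a skeleton beyond
    \<open>N\<close>, whose diffeology is not compared with \<open>Ds N\<close>; instead, smooth
    functions on \<open>Xs N\<close> are extended upwards.\<close>
  have ext: "\<exists>f'. smooth_fun (Xs (N + d)) (Ds (N + d)) f' \<and> (\<forall>p\<in>Xs N. f' p = f p)"
    if "smooth_fun (Xs N) (Ds N) f" for f d
  proof (induction d)
    case 0 thus ?case using that by auto
  next
    case (Suc d)
    then obtain f' where f': "smooth_fun (Xs (N + d)) (Ds (N + d)) f'" "\<forall>p\<in>Xs N. f' p = f p" by blast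
    from regular_attachment.extend_smooth_fun[OF att f'(1)] obtain f'' where
      f'': "smooth_fun (Xs (Suc (N + d))) (Ds (Suc (N + d))) f''" "\<forall>p\<in>Xs (N + d). f'' p = f' p" by blast
    have "Xs N \<subseteq> Xs (N + d)"
      by (induction d) (use regular_attachment.B_eq[OF att] in auto)
    thus ?case using f' f'' by (intro exI[of _ f'']) auto
  qed
  have smooth_DX: "smooth_fun X DX f" if f: "smooth_fun (Xs N) (Ds N) f" for f
    unfolding smooth_fun_def
  proof (intro allI impI)
    fix k U P assume P: "DX k U P"
    hence U: "openR k U" and PX: "P ` U \<subseteq> X" by (auto simp: DX)
    show "smooth_real k U (f \<circ> P)"
    proof (rule smooth_real_local[OF openR_subset[OF U]])
      fix x assume "x \<in> U"
      then obtain V n Q where V: "openR k V" "x \<in> V" "V \<subseteq> U" "Ds n k V Q" "\<forall>y\<in>V. P y = Q y"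
        using P unfolding DX by blast
      \<comment> \<open>Raising both levels to \<open>N + n\<close> puts the plot \<open>Q\<close>
        and the extension \<open>f'\<close> on a common skeleton.\<close>
      have "Ds (N + n) k V Q" using up[OF V(4), of N] by (simp add: add.commute)
      moreover obtain f' where f': "smooth_fun (Xs (N + n)) (Ds (N + n)) f'" "\<forall>p\<in>Xs N. f' p = f p"
        using ext[OF f] by blast
      ultimately have "smooth_real k V (\<lambda>y. f' (Q y))" by (intro smooth_fun_plot)
      hence "smooth_real k V (f \<circ> P)"
      proof (rule smooth_real_cong[OF V(1)])
        fix y assume y: "y \<in> V"
        hence "P y \<in> Xs N" using PX V(3) assms(2) by blast
        thus "f' (Q y) = (f \<circ> P) y" using f'(2) V(5) y by simp
      qed
      thus "\<exists>V. openR k V \<and> x \<in> V \<and> smooth_real k V (f \<circ> P)" using V by blast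
    qed
  qed
  show ?thesis unfolding reflexive_diff_def
  proof (intro allI impI)
    fix k U P assume P: "pre_plot X DX k U P"
    hence U: "openR k U" and PX: "P ` U \<subseteq> X" and Pf: "\<And>f. smooth_fun X DX f \<Longrightarrow> smooth_real k U (f \<circ> P)"
      unfolding pre_plot_def by blast+
    have "pre_plot (Xs N) (Ds N) k U P"
      unfolding pre_plot_def using U PX Pf smooth_DX by (simp flip: assms(2))
    hence plot: "Ds N k U P" using refl unfolding reflexive_diff_def by blast
    show "DX k U P" unfolding DX
    proof (intro conjI ballI U PX)
      fix x assume "x \<in> U"
      thus "\<exists>V. openR k V \<and> x \<in> V \<and> V \<subseteq> U \<and> (\<exists>n Q. Ds n k V Q \<and> (\<forall>y\<in>V. P y = Q y))"
        using U plot by (intro exI[of _ U] exI[of _ N] exI[of _ P] conjI) auto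
    qed
  qed
qed

end
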